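(* Let $n,N\in\mathbb{N}$ with $n\geq 2$, and suppose that $f\colon \mathbb{B}^n\to\mathbb{B}^N$ is a monomial map that is proper and of degree $d$. Then $$ d \leq \begin{cases} 2N-3 & \text{if } n=2,\\[2pt] \dfrac{N-1}{n-1} & \text{if } n\geq 3. \end{cases} $$ Moreover this inequality is sharp in the following sense. For every $n\geq 3$ and every $d\geq 1$ there exist $N$ and a proper monomial map $\mathbb{B}^n\to\mathbb{B}^N$ of degree $d$ for which equality holds. For $n=2$ and every odd $d\geq 1$ there exist $N$ and a proper monomial map $\mathbb{B}^2\to\mathbb{B}^N$ of degree $d$ for which equality holds, and for $n=2$ and every even $d\geq 2$ there exist $N$ and a proper monomial map $\mathbb{B}^2\to\mathbb{B}^N$ of degree $d$ with $2N-3=d+1$.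
   Context: $\mathbb{B}^n$ denotes the open unit ball in $\mathbb{C}^n$. A map $f=(f_1,\dots,f_N)\colon\mathbb{B}^n\to\mathbb{B}^N$ is called monomial if every coordinate function $f_j$ is a monomial (a complex constant times $z_1^{\alpha_1}\cdots z_n^{\alpha_n}$). The degree of $f$ is the maximum of the degrees of its (nonzero) coordinate functions. "Proper" is meant in the usual topological sense (preimages of compact sets are compact). *)

theory Defs
  imports "HOL-Analysis.Analysis"
begin

(* The dimensions n and N are quantified in the theorem, so C^n is realised inside
   "nat => complex" as the set of sequences vanishing from index n on (as for
   "Euclidean_space" over the reals).  The type "nat => complex" carries the topology of
   pointwise convergence, which on this n-dimensional subspace is the usual topology of C^n;
   hence "compact" below has its usual meaning. *)
definition complex_space :: "nat \<Rightarrow> (nat \<Rightarrow> complex) set" where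
  "complex_space n = {z. \<forall>i\<ge>n. z i = 0}"

definition unit_ball :: "nat \<Rightarrow> (nat \<Rightarrow> complex) set" where
  "unit_ball n = {z \<in> complex_space n. (\<Sum>i<n. (cmod (z i))\<^sup>2) < 1}"

definition proper_on ::
    "'a::topological_space set \<Rightarrow> 'b::topological_space set \<Rightarrow> ('a \<Rightarrow> 'b) \<Rightarrow> bool" where
  "proper_on S T f \<longleftrightarrow> (\<forall>K. K \<subseteq> T \<and> compact K \<longrightarrow> compact {x \<in> S. f x \<in> K})"

definition monomial :: "nat \<Rightarrow> complex \<Rightarrow> (nat \<Rightarrow> nat) \<Rightarrow> (nat \<Rightarrow> complex) \<Rightarrow> complex" where
  "monomial n c \<alpha> z = c * (\<Prod>i<n. z i ^ \<alpha> i)"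

definition monomial_map ::
    "nat \<Rightarrow> nat \<Rightarrow> ((nat \<Rightarrow> complex) \<Rightarrow> (nat \<Rightarrow> complex)) \<Rightarrow> bool" where
  "monomial_map n N f \<longleftrightarrow> f \<in> unit_ball n \<rightarrow> unit_ball N \<and>
     (\<forall>j<N. \<exists>c \<alpha>. \<forall>z\<in>unit_ball n. f z j = monomial n c \<alpha> z)"

(* A nonzero monomial on the ball determines its coefficient and its exponents below n, so each
   nonzero coordinate contributes exactly one number and the set is finite.  It is empty
   only if every coordinate vanishes identically, and such a map is not proper for n > 0. *)
definition map_degree ::
    "nat \<Rightarrow> nat \<Rightarrow> ((nat \<Rightarrow> complex) \<Rightarrow> (nat \<Rightarrow> complex)) \<Rightarrow> nat" where
  "map_degree n N f = Max {\<Sum>i<n. \<alpha> i | j c \<alpha>.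
     j < N \<and> c \<noteq> 0 \<and> (\<forall>z\<in>unit_ball n. f z j = monomial n c \<alpha> z)}"

definition proper_monomial_map ::
    "nat \<Rightarrow> nat \<Rightarrow> ((nat \<Rightarrow> complex) \<Rightarrow> (nat \<Rightarrow> complex)) \<Rightarrow> bool" where
  "proper_monomial_map n N f \<longleftrightarrow> monomial_map n N f \<and> proper_on (unit_ball n) (unit_ball N) f"

end

theory Submission
  imports Defs "HOL-Computational_Algebra.Polynomial"
begin

text \<open>
With \<open>x_i = |z_i|\<^sup>2\<close>, the squared norm of a monomial map is a polynomial \<open>P\<close> in \<open>x\<close> with nonnegative
coefficients, and the map is proper only if \<open>P = 1\<close> on the simplex \<open>s = 1\<close>, where \<open>s = x_0 + \<dots> + x_(n-1)\<close>
(\<open>proper_sphere\<close>).  The number of monomials of \<open>P\<close> is at most \<open>N\<close>, so the claim is a lower bound for this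
number in terms of the degree \<open>d\<close> (\<open>constant_on_simplex_bound\<close>).

Write \<open>P - 1 = (s - 1) * q\<close>.  The homogeneous parts of \<open>q\<close> satisfy \<open>q_(k+1) = s * q_k - p_(k+1)\<close> with \<open>p_(k+1)\<close> the part
of \<open>P\<close> of degree \<open>k + 1\<close>, they are nonzero for \<open>k < d\<close>, and \<open>q_d = 0\<close>.  Such a sequence is called a run.  Multiplying
by \<open>s\<close> makes the array of coefficients larger and its sign pattern simpler; the monomials of \<open>P\<close> have to make
the array vanish in the end, and what they can do at one place is limited.

For two variables this is Descartes' rule of signs: a potential, essentially the number of sign changes
and zeros of a row of coefficients, does not increase under multiplication by \<open>s\<close>, changes by at most two for
each monomial, and has to match the length of the row when the row vanishes (\<open>row_grow\<close>, \<open>row_kill\<close>,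
\<open>run2_terms\<close>).  For three variables the coefficients form a triangle.  Its zeros are given
auxiliary colours, and the potential consists of the one-coloured triangles of zeros and the potentials of the three
sides.  It changes by at most two for each monomial while the triangle grows, and it rewards cutting off
vanishing sides (\<open>step_same\<close>, \<open>step_cut\<close>, \<open>cost_shrink\<close>, \<open>step_kill\<close>), whence \<open>2 * d + 1\<close> monomials (\<open>triangle_rows\<close>).

More variables are treated by induction (\<open>run_terms\<close>).  Those monomials in which the last variable has
its currently lowest exponent belong to runs in the other variables, to which the induction hypothesis applies.  The
others are counted after merging the other variables into two, by one-dimensional
potentials on two sides of the triangle (\<open>behind3\<close>).  Changes of the lowest exponent are gained in the first count and lost in
the second.

Equality holds for the Whitney maps if \<open>n \<ge> 3\<close>, and for maps built from Lucas polynomials if \<open>n = 2\<close> and the degree is odd; for even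
degrees one term of the latter is split.
\<close>

section \<open>Coloured rows and sign changes\<close>

text \<open>
A cell of a row carries a coefficient, of which only the two facts "is it zero" (\<open>z\<close>) and "which
colour does it have" (\<open>s\<close>) matter; the colour of a nonzero coefficient is its sign, the colour of a
zero is free.  A pair of neighbours is expensive if it is a sign change, or if it is a pair of equally
coloured zeros; the latter charge pays for removing rows that vanish.
\<close>

definition edge :: "bool \<Rightarrow> bool \<Rightarrow> bool \<Rightarrow> bool \<Rightarrow> int" where
  "edge z s z' s' = of_bool ((z \<and> z' \<and> s = s') \<or> (\<not> z \<and> \<not> z' \<and> s \<noteq> s'))"

text \<open>
For a row without zeros this is the number of sign changes, the quantity in Descartes' rule.
\<close>

definition row_cost :: "nat \<Rightarrow> (nat \<Rightarrow> real) \<Rightarrow> (nat \<Rightarrow> bool) \<Rightarrow> int" where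
  "row_cost n f s = (\<Sum>i\<le>n. of_bool (f i = 0)) + (\<Sum>i<n. edge (f i = 0) (s i) (f (Suc i) = 0) (s (Suc i)))"

definition coloured :: "(nat \<Rightarrow> real) \<Rightarrow> (nat \<Rightarrow> bool) \<Rightarrow> bool" where
  "coloured f s \<longleftrightarrow> (\<forall>i. f i \<noteq> 0 \<longrightarrow> s i = (f i > 0))"

text \<open>
The coefficients of \<open>(1 + x) * f\<close>.  The functions \<open>up2\<close> and \<open>up\<close> below do the same for \<open>1 + x + y\<close> and for the
sum of \<open>n\<close> variables.
\<close>

definition up1 :: "(nat \<Rightarrow> real) \<Rightarrow> nat \<Rightarrow> real" where
  "up1 f i = f i + (if i = 0 then 0 else f (i - 1))"

text \<open>
What a discrepancy between the new row \<open>g\<close> (of length \<open>k + 2\<close>) and \<open>up1 f\<close> is allowed to cost.  An end cell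
lies on two sides of a triangle of coefficients, so it is charged only once per side.
\<close>

definition price :: "nat \<Rightarrow> (nat \<Rightarrow> real) \<Rightarrow> (nat \<Rightarrow> real) \<Rightarrow> nat \<Rightarrow> int" where
  "price k f g i = (if i = 0 \<or> i = Suc k then 1 else 2) * of_bool (g i \<noteq> up1 f i)"

text \<open>
The sign of a sum of two coefficients, as far as it can be read off from their colours: two zeros
give a zero, and two parents that do not pull in opposite directions pass their colour on.
\<close>

definition forced :: "bool \<Rightarrow> bool \<Rightarrow> bool \<Rightarrow> bool \<Rightarrow> bool \<Rightarrow> bool \<Rightarrow> bool" where
  "forced z0 s0 z1 s1 z t \<longleftrightarrow>
     (z0 \<and> z1 \<longrightarrow> z) \<and> (\<not> z0 \<and> (z1 \<or> s1 = s0) \<longrightarrow> \<not> z \<and> t = s0)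
      \<and> (\<not> z1 \<and> (z0 \<or> s0 = s1) \<longrightarrow> \<not> z \<and> t = s1)"

lemma forced_up1:
  assumes "coloured f s" "coloured g t" "g (Suc i) = up1 f (Suc i)"
  shows "forced (f i = 0) (s i) (f (Suc i) = 0) (s (Suc i)) (g (Suc i) = 0) (t (Suc i))"
proof -
  have "g (Suc i) = f (Suc i) + f i" using assms(3) by (simp add: up1_def)
  moreover have "f i \<noteq> 0 \<longrightarrow> s i = (f i > 0)" "f (Suc i) \<noteq> 0 \<longrightarrow> s (Suc i) = (f (Suc i) > 0)"
    "g (Suc i) \<noteq> 0 \<longrightarrow> t (Suc i) = (g (Suc i) > 0)"
    using assms(1,2) by (auto simp: coloured_def)
  ultimately show ?thesis unfolding forced_def
    by (smt (verit))
qed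

lemma cut_step:
  assumes "zg \<Longrightarrow> t = s" "zg' \<Longrightarrow> t' = s'" "\<not> d \<Longrightarrow> forced z s z' s' zg' t'"
    "cc \<Longrightarrow> zg'" "\<not> z \<Longrightarrow> fl"
  shows "of_bool zg' + (if cc then of_bool (s = s') else edge zg t zg' t')
      + of_bool (z' \<and> (fl \<or> \<not> zg')) + of_bool (\<not> z' \<and> \<not> zg' \<and> t' \<noteq> s')
    \<le> of_bool z' + edge z s z' s' + 2 * of_bool d
      + (of_bool (z \<and> (fl \<or> \<not> zg)) + of_bool (\<not> z \<and> \<not> zg \<and> t \<noteq> s) :: int)"
  using assms
  unfolding edge_def forced_def of_bool_def
  by (smt (verit))

text \<open>
The strengthening that makes the induction over the prefixes of a row go through: a zero of the old
row that comes after a nonzero cell, or stands above a nonzero cell, leaves one unit in hand, and so does a cell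
whose sign flips.
\<close>

definition slack :: "(nat \<Rightarrow> real) \<Rightarrow> (nat \<Rightarrow> bool) \<Rightarrow> (nat \<Rightarrow> real) \<Rightarrow> (nat \<Rightarrow> bool) \<Rightarrow> nat \<Rightarrow> int" where
  "slack f s g t m = of_bool (f m = 0 \<and> ((\<exists>i\<le>m. f i \<noteq> 0) \<or> g m \<noteq> 0))
     + of_bool (f m \<noteq> 0 \<and> g m \<noteq> 0 \<and> t m \<noteq> s m)"

text \<open>
The zeros of the new row keep the colour of the cell above them.  After the cell \<open>k'\<close> the new row
vanishes, and there the pairs of equal old colours are counted instead: in a triangle these pay for
the line along which the triangle is cut.
\<close>

lemma row_prefix:
  assumes col: "coloured f s" "coloured g t"
    and keep: "\<And>i. i \<le> k \<Longrightarrow> g i = 0 \<Longrightarrow> t i = s i"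
    and cut: "\<And>i. k' < i \<Longrightarrow> i \<le> k \<Longrightarrow> g i = 0" and "m \<le> k"
  shows "(\<Sum>i\<le>m. of_bool (g i = 0))
      + (\<Sum>i<m. if i < k' then edge (g i = 0) (t i) (g (Suc i) = 0) (t (Suc i)) else of_bool (s i = s (Suc i)))
      + slack f s g t m
    \<le> row_cost m f s + (\<Sum>i\<le>m. price k f g i)"
  using \<open>m \<le> k\<close>
proof (induction m)
  case 0
  have "g 0 \<noteq> 0 \<Longrightarrow> t 0 = (g 0 > 0)" "f 0 \<noteq> 0 \<Longrightarrow> s 0 = (f 0 > 0)"
    using col by (auto simp: coloured_def)
  then show ?case
    by (cases "f 0 = 0"; cases "g 0 = 0"; cases "g 0 = f 0") (simp_all add: row_cost_def price_def up1_def slack_def del: sum_of_bool_eq)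
next
  case (Suc m)
  let ?fl = "\<exists>i\<le>m. f i \<noteq> 0"
  have fl': "(\<exists>i\<le>Suc m. f i \<noteq> 0) \<longleftrightarrow> ?fl \<or> f (Suc m) \<noteq> 0"
    by (auto simp: le_Suc_eq)
  have "of_bool (g (Suc m) = 0) + (if \<not> m < k' then of_bool (s m = s (Suc m)) else edge (g m = 0) (t m) (g (Suc m) = 0) (t (Suc m)))
      + of_bool (f (Suc m) = 0 \<and> (?fl \<or> \<not> g (Suc m) = 0))
      + of_bool (\<not> f (Suc m) = 0 \<and> \<not> g (Suc m) = 0 \<and> t (Suc m) \<noteq> s (Suc m))
    \<le> of_bool (f (Suc m) = 0) + edge (f m = 0) (s m) (f (Suc m) = 0) (s (Suc m))
      + 2 * of_bool (g (Suc m) \<noteq> up1 f (Suc m))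
      + (of_bool (f m = 0 \<and> (?fl \<or> \<not> g m = 0)) + of_bool (\<not> f m = 0 \<and> \<not> g m = 0 \<and> t m \<noteq> s m) :: int)"
  proof (rule cut_step)
    show "\<not> g (Suc m) \<noteq> up1 f (Suc m) \<Longrightarrow> forced (f m = 0) (s m) (f (Suc m) = 0) (s (Suc m)) (g (Suc m) = 0) (t (Suc m))"
      using forced_up1[OF col, of m] by simp
    show "g m = 0 \<Longrightarrow> t m = s m" "g (Suc m) = 0 \<Longrightarrow> t (Suc m) = s (Suc m)"
      using keep Suc.prems by simp_all
    show "\<not> m < k' \<Longrightarrow> g (Suc m) = 0" using cut Suc.prems by simp
    show "\<not> f m = 0 \<Longrightarrow> ?fl" by blast
  qed
  moreover have "slack f s g t (Suc m) = of_bool (f (Suc m) = 0 \<and> (?fl \<or> \<not> g (Suc m) = 0))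
      + of_bool (\<not> f (Suc m) = 0 \<and> \<not> g (Suc m) = 0 \<and> t (Suc m) \<noteq> s (Suc m))"
    unfolding slack_def fl' by auto
  moreover have "price k f g (Suc m) = 2 * of_bool (g (Suc m) \<noteq> up1 f (Suc m))"
    using Suc.prems by (simp add: price_def)
  moreover have "row_cost (Suc m) f s = row_cost m f s + of_bool (f (Suc m) = 0) + edge (f m = 0) (s m) (f (Suc m) = 0) (s (Suc m))"
    by (simp add: row_cost_def)
  moreover have "(if \<not> m < k' then of_bool (s m = s (Suc m)) else edge (g m = 0) (t m) (g (Suc m) = 0) (t (Suc m)))
     = (if m < k' then edge (g m = 0) (t m) (g (Suc m) = 0) (t (Suc m)) else of_bool (s m = s (Suc m)))"
    by simp
  moreover note Suc.IH[OF Suc_leD[OF Suc.prems]]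
  ultimately show ?case
    unfolding sum.atMost_Suc sum.lessThan_Suc slack_def by linarith
qed

lemma grow_last:
  assumes "zg \<Longrightarrow> t = s" "zg' \<Longrightarrow> t' \<noteq> s" "\<not> d \<Longrightarrow> forced z s True s' zg' t'"
  shows "of_bool zg' + edge zg t zg' t'
    \<le> of_bool d + (of_bool z + of_bool (\<not> z \<and> \<not> zg \<and> t \<noteq> s) :: int)"
  using assms unfolding edge_def forced_def of_bool_def
  by (cases zg; cases z) (smt (verit))+

text \<open>
The coloured form of the fact that multiplication by \<open>1 + x\<close> cannot create sign changes.  The extra zero
at the new end takes the colour opposite to its only parent.
\<close>

lemma row_grow:
  assumes col: "coloured f s" "coloured g t"
    and keep: "\<And>i. i \<le> k \<Longrightarrow> g i = 0 \<Longrightarrow> t i = s i"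
    and last: "g (Suc k) = 0 \<Longrightarrow> t (Suc k) = (\<not> s k)"
    and f: "f (Suc k) = 0" "\<exists>i\<le>k. f i \<noteq> 0"
  shows "row_cost (Suc k) g t \<le> row_cost k f s + (\<Sum>i\<le>Suc k. price k f g i)"
proof -
  have "(\<Sum>i<k. if i < Suc k then edge (g i = 0) (t i) (g (Suc i) = 0) (t (Suc i)) else of_bool (s i = s (Suc i)))
      = (\<Sum>i<k. edge (g i = 0) (t i) (g (Suc i) = 0) (t (Suc i)))"
    by (rule sum.cong) auto
  moreover have "(\<Sum>i\<le>k. of_bool (g i = 0))
      + (\<Sum>i<k. if i < Suc k then edge (g i = 0) (t i) (g (Suc i) = 0) (t (Suc i)) else of_bool (s i = s (Suc i)))
      + slack f s g t k \<le> row_cost k f s + (\<Sum>i\<le>k. price k f g i)"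
    by (rule row_prefix[OF col]) (use keep in simp_all)
  ultimately have *: "row_cost k g t + slack f s g t k \<le> row_cost k f s + (\<Sum>i\<le>k. price k f g i)"
    unfolding row_cost_def[of k g t] by linarith
  have "\<not> g (Suc k) \<noteq> up1 f (Suc k) \<Longrightarrow> forced (f k = 0) (s k) (f (Suc k) = 0) (s (Suc k)) (g (Suc k) = 0) (t (Suc k))"
    using forced_up1[OF col] by simp
  moreover have "slack f s g t k = of_bool (f k = 0) + of_bool (f k \<noteq> 0 \<and> g k \<noteq> 0 \<and> t k \<noteq> s k)"
    using f(2) by (simp add: slack_def)
  moreover have "price k f g (Suc k) = of_bool (g (Suc k) \<noteq> up1 f (Suc k))"
    by (simp add: price_def)
  moreover have "of_bool (g (Suc k) = 0) + edge (g k = 0) (t k) (g (Suc k) = 0) (t (Suc k))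
     \<le> of_bool (g (Suc k) \<noteq> up1 f (Suc k)) + (of_bool (f k = 0) + of_bool (\<not> f k = 0 \<and> \<not> g k = 0 \<and> t k \<noteq> s k))"
    by (rule grow_last[where s' = "s (Suc k)"]) (use calculation f(1) last keep[of k] in simp_all)
  ultimately have "of_bool (g (Suc k) = 0) + edge (g k = 0) (t k) (g (Suc k) = 0) (t (Suc k))
     \<le> price k f g (Suc k) + slack f s g t k" by linarith
  then show ?thesis using * unfolding row_cost_def sum.atMost_Suc sum.lessThan_Suc by linarith
qed

lemma row_cut:
  assumes col: "coloured f s" "coloured g t"
    and keep: "\<And>i. i \<le> k' \<Longrightarrow> g i = 0 \<Longrightarrow> t i = s i"
    and cut: "\<And>i. k' < i \<Longrightarrow> g i = 0" and "k' \<le> k"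
    and f: "f (Suc k) = 0" "\<exists>i\<le>k. f i \<noteq> 0"
  shows "row_cost k' g t + int (Suc k - k') + (\<Sum>i=k'..<k. of_bool (s i = s (Suc i)))
    \<le> row_cost k f s + (\<Sum>i\<le>Suc k. price k f g i)"
proof -
  define t' where "t' i = (if i \<le> k' then t i else s i)" for i
  have col': "coloured g t'" using col cut by (auto simp: coloured_def t'_def)
  let ?e = "\<lambda>i. if i < k' then edge (g i = 0) (t' i) (g (Suc i) = 0) (t' (Suc i)) else of_bool (s i = s (Suc i))"
  have 1: "(\<Sum>i\<le>k. of_bool (g i = 0)) + (\<Sum>i<k. ?e i) + slack f s g t' k
      \<le> row_cost k f s + (\<Sum>i\<le>k. price k f g i)"
    by (rule row_prefix[OF col(1) col']) (use keep cut in \<open>auto simp: t'_def\<close>)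
  have split: "{..k} = {..k'} \<union> {k'<..k}" "{..<k} = {..<k'} \<union> {k'..<k}" using \<open>k' \<le> k\<close> by auto
  have "(\<Sum>i\<le>k. of_bool (g i = 0) :: int) = (\<Sum>i\<le>k'. of_bool (g i = 0)) + (\<Sum>i\<in>{k'<..k}. of_bool (g i = 0))"
    unfolding split(1) by (rule sum.union_disjoint) auto
  moreover have "(\<Sum>i<k. ?e i) = (\<Sum>i<k'. ?e i) + (\<Sum>i=k'..<k. ?e i)"
    unfolding split(2) by (rule sum.union_disjoint) auto
  moreover have "(\<Sum>i\<in>{k'<..k}. of_bool (g i = 0) :: int) = (\<Sum>i\<in>{k'<..k}. 1)"
    by (rule sum.cong) (use cut in auto)
  moreover have "(\<Sum>i<k'. ?e i) = (\<Sum>i<k'. edge (g i = 0) (t i) (g (Suc i) = 0) (t (Suc i)))"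
    by (rule sum.cong) (auto simp: t'_def)
  moreover have "(\<Sum>i=k'..<k. ?e i) = (\<Sum>i=k'..<k. of_bool (s i = s (Suc i)))"
    by (rule sum.cong) auto
  moreover have "1 \<le> price k f g (Suc k) + slack f s g t' k"
    using f cut[of "Suc k"] \<open>k' \<le> k\<close> by (auto simp: price_def slack_def up1_def)
  ultimately show ?thesis
    using 1 \<open>k' \<le> k\<close> unfolding row_cost_def sum.atMost_Suc by (simp add: of_nat_diff del: sum_of_bool_eq)
qed

text \<open>
A row can disappear only by discrepancies; this is where sign changes become a lower bound for the
number of terms.
\<close>

lemma row_kill:
  assumes "coloured f s" "\<And>i. i \<le> Suc k \<Longrightarrow> g i = 0" "f (Suc k) = 0" "\<exists>i\<le>k. f i \<noteq> 0"
  shows "int k + 2 + (\<Sum>i<k. of_bool (s i = s (Suc i))) \<le> row_cost k f s + (\<Sum>i\<le>Suc k. price k f g i)"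
proof -
  have "row_cost 0 (\<lambda>_. 0) s + int (Suc k - 0) + (\<Sum>i=0..<k. of_bool (s i = s (Suc i)))
    \<le> row_cost k f s + (\<Sum>i\<le>Suc k. price k f (\<lambda>_. 0) i)"
    by (rule row_cut) (use assms in \<open>auto simp: coloured_def\<close>)
  moreover have "(\<Sum>i\<le>Suc k. price k f (\<lambda>_. 0) i) = (\<Sum>i\<le>Suc k. price k f g i)"
    by (rule sum.cong) (use assms(2) in \<open>auto simp: price_def\<close>)
  ultimately show ?thesis by (simp add: row_cost_def lessThan_atLeast0 del: sum_of_bool_eq)
qed

text \<open>
The flags \<open>fl\<close> and \<open>L\<close> say that a nonzero cell occurred already in the old row and in the new row.
Before the first nonzero new cell a zero takes the colour opposite to its right parent, after it
the colour opposite to its left parent; equally coloured neighbouring zeros of the new row then cost no more than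
what the old row has paid.
\<close>

lemma new_step:
  assumes "\<not> z \<Longrightarrow> fl" "\<not> zg \<Longrightarrow> L" "zg \<Longrightarrow> \<not> L \<Longrightarrow> t \<noteq> s" "zg' \<Longrightarrow> L \<Longrightarrow> t' \<noteq> s" "zg' \<Longrightarrow> \<not> L \<Longrightarrow> t' \<noteq> s'"
    "\<not> d \<Longrightarrow> forced z s z' s' zg' t'"
  shows "of_bool zg' + edge zg t zg' t'
      + (if z' then of_bool ((fl \<or> \<not> z') \<or> (L \<or> \<not> zg')) + of_bool ((L \<or> \<not> zg') \<and> zg' \<and> t' \<noteq> s') else of_bool ((L \<or> \<not> zg') \<and> t' \<noteq> s'))
    \<le> of_bool z' + edge z s z' s' + 2 * of_bool d
      + ((if z then of_bool (fl \<or> L) + of_bool (L \<and> zg \<and> t \<noteq> s) else of_bool (L \<and> t \<noteq> s)) :: int)"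
proof (cases zg')
  case True
  then show ?thesis using assms unfolding edge_def forced_def of_bool_def
    by (cases L; cases z) (smt (verit))+
next
  case False
  show ?thesis
  proof (cases d)
    case True
    then show ?thesis using False by (auto simp: edge_def of_bool_def)
  next
    case d: False
    then have "forced z s z' s' False t'" using assms(6) False by simp
    then have "\<not> z \<or> \<not> z'" "\<not> z \<Longrightarrow> z' \<or> s' = s \<Longrightarrow> t' = s" "\<not> z' \<Longrightarrow> z \<or> s' = s \<Longrightarrow> t' = s'"
      by (auto simp: forced_def)
    then show ?thesis using False d assms(2,3)
      by (cases z; cases z'; cases L; cases zg) (auto simp: edge_def)
  qed
qed

lemma new_last:
  assumes "\<not> zg \<Longrightarrow> L" "zg \<Longrightarrow> \<not> L \<Longrightarrow> t \<noteq> s" "zg' \<Longrightarrow> t' \<noteq> s" "L \<or> \<not> zg'"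
    "\<not> d \<Longrightarrow> forced z s True s' zg' t'"
  shows "of_bool zg' + edge zg t zg' t'
    \<le> of_bool d + ((if z then 1 + of_bool (L \<and> zg \<and> t \<noteq> s) else of_bool (L \<and> t \<noteq> s)) :: int)"
proof (cases zg')
  case True
  then show ?thesis using assms unfolding edge_def forced_def of_bool_def
    by (cases L; cases z) (smt (verit))+
next
  case False
  then show ?thesis using assms unfolding edge_def forced_def of_bool_def
    by (cases L; cases z) (smt (verit))+
qed

text \<open>
The colouring for the side of a triangle that advances with every step.  Here the zeros are coloured
against one of their parents, because no triangle of three equally coloured zeros may arise
between the old and the new side.
\<close>

lemma row_new:
  assumes col: "coloured f s" "coloured g t"
    and t: "\<And>i. i \<le> Suc k \<Longrightarrow> g i = 0 \<Longrightarrow> t i = (if i = Suc k \<or> (\<exists>j<i. g j \<noteq> 0) then \<not> s (i - 1) else \<not> s i)"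
    and f: "f (Suc k) = 0" "\<exists>i\<le>k. f i \<noteq> 0" and g: "\<exists>i\<le>Suc k. g i \<noteq> 0"
  shows "row_cost (Suc k) g t \<le> row_cost k f s + (\<Sum>i\<le>Suc k. price k f g i)"
proof -
  define F where "F m = (\<exists>i\<le>m. f i \<noteq> 0)" for m
  define L where "L m = (\<exists>i\<le>m. g i \<noteq> 0)" for m
  define \<phi> :: "nat \<Rightarrow> int" where "\<phi> m = (if f m = 0 then of_bool (F m \<or> L m) + of_bool (L m \<and> g m = 0 \<and> t m \<noteq> s m)
      else of_bool (L m \<and> t m \<noteq> s m))" for m
  have F: "F (Suc m) = (F m \<or> \<not> f (Suc m) = 0)" and L: "L (Suc m) = (L m \<or> \<not> g (Suc m) = 0)" for m
    by (auto simp: F_def L_def le_Suc_eq)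
  have Ll: "(\<exists>j<Suc m. g j \<noteq> 0) = L m" for m by (auto simp: L_def less_Suc_eq_le)
  have F0: "\<not> f m = 0 \<Longrightarrow> F m" and L0: "\<not> g m = 0 \<Longrightarrow> L m" for m by (auto simp: F_def L_def)
  have t0: "\<not> L m \<Longrightarrow> t m \<noteq> s m" if "m \<le> k" for m
    using t[of m] that unfolding L_def by (auto simp: less_imp_le)
  have *: "row_cost m g t + \<phi> m \<le> row_cost m f s + (\<Sum>i\<le>m. price k f g i)" if "m \<le> k" for m
    using that
  proof (induction m)
    case 0
    have "g 0 \<noteq> 0 \<Longrightarrow> t 0 = (g 0 > 0)" "f 0 \<noteq> 0 \<Longrightarrow> s 0 = (f 0 > 0)"
      using col by (auto simp: coloured_def)
    then show ?case
      by (cases "f 0 = 0"; cases "g 0 = 0"; cases "g 0 = f 0") (simp_all add: row_cost_def price_def up1_def \<phi>_def F_def L_def del: sum_of_bool_eq)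
  next
    case (Suc m)
    have "of_bool (g (Suc m) = 0) + edge (g m = 0) (t m) (g (Suc m) = 0) (t (Suc m)) + \<phi> (Suc m)
       \<le> of_bool (f (Suc m) = 0) + edge (f m = 0) (s m) (f (Suc m) = 0) (s (Suc m))
         + 2 * of_bool (g (Suc m) \<noteq> up1 f (Suc m)) + \<phi> m"
      unfolding \<phi>_def F L
    proof (rule new_step)
      show "g (Suc m) = 0 \<Longrightarrow> L m \<Longrightarrow> t (Suc m) \<noteq> s m"
        using t[of "Suc m"] Suc.prems unfolding Ll by simp
      show "g (Suc m) = 0 \<Longrightarrow> \<not> L m \<Longrightarrow> t (Suc m) \<noteq> s (Suc m)"
        using t[of "Suc m"] Suc.prems unfolding Ll by simp
      show "\<not> g (Suc m) \<noteq> up1 f (Suc m) \<Longrightarrow> forced (f m = 0) (s m) (f (Suc m) = 0) (s (Suc m)) (g (Suc m) = 0) (t (Suc m))"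
        using forced_up1[OF col, of m] by simp
    qed (use F0 L0 t0[of m] Suc.prems in simp_all)
    moreover have "price k f g (Suc m) = 2 * of_bool (g (Suc m) \<noteq> up1 f (Suc m))"
      using Suc.prems by (simp add: price_def)
    moreover note Suc.IH[OF Suc_leD[OF Suc.prems]]
    ultimately show ?case
      unfolding sum.atMost_Suc sum.lessThan_Suc row_cost_def by linarith
  qed
  have "\<not> g (Suc k) \<noteq> up1 f (Suc k) \<Longrightarrow> forced (f k = 0) (s k) (f (Suc k) = 0) (s (Suc k)) (g (Suc k) = 0) (t (Suc k))"
    using forced_up1[OF col] by simp
  moreover have "L k \<or> \<not> g (Suc k) = 0" using g L[of k] by (simp add: L_def)
  moreover have "g (Suc k) = 0 \<Longrightarrow> t (Suc k) \<noteq> s k" using t[of "Suc k"] by simp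
  ultimately have "of_bool (g (Suc k) = 0) + edge (g k = 0) (t k) (g (Suc k) = 0) (t (Suc k))
     \<le> of_bool (g (Suc k) \<noteq> up1 f (Suc k)) + (if f k = 0 then 1 + of_bool (L k \<and> g k = 0 \<and> t k \<noteq> s k)
      else of_bool (L k \<and> t k \<noteq> s k))"
    using L0[of k] t0[of k] f(1) by (intro new_last[where s' = "s (Suc k)"]) auto
  moreover have "F k" using f(2) by (simp add: F_def)
  then have "\<phi> k = (if f k = 0 then 1 + of_bool (L k \<and> g k = 0 \<and> t k \<noteq> s k) else of_bool (L k \<and> t k \<noteq> s k))"
    unfolding \<phi>_def by simp
  moreover have "price k f g (Suc k) = of_bool (g (Suc k) \<noteq> up1 f (Suc k))"
    by (simp add: price_def)
  ultimately have "of_bool (g (Suc k) = 0) + edge (g k = 0) (t k) (g (Suc k) = 0) (t (Suc k))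
     \<le> price k f g (Suc k) + \<phi> k" by linarith
  then show ?thesis using *[of k] unfolding row_cost_def sum.atMost_Suc sum.lessThan_Suc by linarith
qed

section \<open>Coloured triangles\<close>

text \<open>
Two neighbouring lines of a triangle form a strip.  Walking along it, an equally coloured pair on \<open>v\<close>
that has no counterpart among the pairs on \<open>u\<close> is made up for by triangles of one colour or
at the ends.
\<close>

lemma strip:
  fixes u v :: "nat \<Rightarrow> bool"
  shows "(\<Sum>i<n. of_bool (v i = v (Suc i))) + 1
    \<le> (\<Sum>i<Suc n. of_bool (u i = u (Suc i))) + of_bool (u 0 = v 0) + of_bool (u (Suc n) = v n)
      + 2 * (\<Sum>i<n. of_bool (v i = v (Suc i) \<and> u (Suc i) = v i) :: int)"
proof (induction n)
  case 0
  show ?case by (cases "u 0"; cases "u (Suc 0)"; cases "v 0") simp_all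
next
  case (Suc n)
  have "of_bool (v n = v (Suc n)) + of_bool (u (Suc n) = v n)
    \<le> of_bool (u (Suc n) = u (Suc (Suc n))) + of_bool (u (Suc (Suc n)) = v (Suc n))
      + 2 * (of_bool (v n = v (Suc n) \<and> u (Suc n) = v n) :: int)"
    by (cases "v n"; cases "v (Suc n)"; cases "u (Suc n)"; cases "u (Suc (Suc n))") simp_all
  moreover have "S + a + 1 \<le> U + c + x + d + 2 * (T + e)"
    if "a + b \<le> c + d + 2 * e" "S + 1 \<le> U + x + b + 2 * T" for a b c d e x S T U :: int
    using that by (simp add: algebra_simps)
  from this[OF calculation Suc.IH] show ?case
    unfolding sum.lessThan_Suc by (simp only: add.assoc)
qed

text \<open>
The three cells are the parents, under \<open>up2\<close>, of the cell \<open>(Suc b, Suc c)\<close>.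
\<close>

definition mono_tri :: "(nat \<Rightarrow> nat \<Rightarrow> bool) \<Rightarrow> nat \<Rightarrow> nat \<Rightarrow> bool" where
  "mono_tri s b c \<longleftrightarrow> s (Suc b) (Suc c) = s b (Suc c) \<and> s b (Suc c) = s (Suc b) c"

definition zero_tri :: "(nat \<Rightarrow> nat \<Rightarrow> real) \<Rightarrow> (nat \<Rightarrow> nat \<Rightarrow> bool) \<Rightarrow> nat \<Rightarrow> nat \<Rightarrow> bool" where
  "zero_tri f s b c \<longleftrightarrow> f (Suc b) (Suc c) = 0 \<and> f b (Suc c) = 0 \<and> f (Suc b) c = 0 \<and> mono_tri s b c"

text \<open>
The potential of the cells \<open>b + c \<le> k\<close>: twice the number of one-coloured triangles of zeros plus the
row costs of the three sides.
\<close>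

definition cost :: "nat \<Rightarrow> (nat \<Rightarrow> nat \<Rightarrow> real) \<Rightarrow> (nat \<Rightarrow> nat \<Rightarrow> bool) \<Rightarrow> int" where
  "cost k f s = 2 * (\<Sum>m<k. \<Sum>i<m. of_bool (zero_tri f s i (m - Suc i)))
     + row_cost k (f 0) (s 0) + row_cost k (\<lambda>b. f b 0) (\<lambda>b. s b 0) + row_cost k (\<lambda>b. f b (k - b)) (\<lambda>b. s b (k - b))"

definition coloured2 :: "(nat \<Rightarrow> nat \<Rightarrow> real) \<Rightarrow> (nat \<Rightarrow> nat \<Rightarrow> bool) \<Rightarrow> bool" where
  "coloured2 f s \<longleftrightarrow> (\<forall>b c. f b c \<noteq> 0 \<longrightarrow> s b c = (f b c > 0))"

definition up2 :: "(nat \<Rightarrow> nat \<Rightarrow> real) \<Rightarrow> nat \<Rightarrow> nat \<Rightarrow> real" where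
  "up2 f b c = f b c + (if b = 0 then 0 else f (b - 1) c) + (if c = 0 then 0 else f b (c - 1))"

definition same_line :: "(nat \<Rightarrow> nat \<Rightarrow> bool) \<Rightarrow> nat \<Rightarrow> int" where
  "same_line s m = (\<Sum>i<m. of_bool (s i (m - i) = s (Suc i) (m - Suc i)))"

lemma same_line_Suc:
  "same_line s m + 1 \<le> same_line s (Suc m) + of_bool (s 0 m = s 0 (Suc m)) + of_bool (s m 0 = s (Suc m) 0)
     + 2 * (\<Sum>i<m. of_bool (mono_tri s i (m - Suc i)))"
proof -
  have "(\<Sum>i<m. of_bool (s i (m - i) = s (Suc i) (m - Suc i) \<and> s (Suc i) (Suc m - Suc i) = s i (m - i)) :: int)
     = (\<Sum>i<m. of_bool (mono_tri s i (m - Suc i)))"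
    by (rule sum.cong) (auto simp: mono_tri_def Suc_diff_Suc)
  then show ?thesis
    using strip[where n = m and v = "\<lambda>i. s i (m - i)" and u = "\<lambda>i. s i (Suc m - i)"]
    unfolding same_line_def by (simp add: eq_commute del: sum_of_bool_eq)
qed

lemma same_line_le:
  assumes "k' \<le> k"
  shows "same_line s k' + int (k - k') \<le> same_line s k + (\<Sum>c=k'..<k. of_bool (s 0 c = s 0 (Suc c)))
     + (\<Sum>b=k'..<k. of_bool (s b 0 = s (Suc b) 0)) + 2 * (\<Sum>m=k'..<k. \<Sum>i<m. of_bool (mono_tri s i (m - Suc i)))"
  using assms
proof (induction k rule: dec_induct)
  case base
  show ?case by simp
next
  case (step m)
  have "\<And>f :: nat \<Rightarrow> int. (\<Sum>c=k'..<Suc m. f c) = (\<Sum>c=k'..<m. f c) + f m"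
    using step.hyps by simp
  then show ?case
    using step same_line_Suc[of s m] by (simp add: of_nat_diff del: sum_of_bool_eq)
qed

text \<open>
Coefficients of equal sign cannot cancel.  So a one-coloured triangle that yields a zero of the
next form consists of zeros, unless there is a term at that cell; this is how colours detect terms.
\<close>

lemma mono_tri_cancel:
  assumes "coloured2 f s" "mono_tri s b c" "up2 f (Suc b) (Suc c) = 0"
  shows "zero_tri f s b c"
proof -
  have "f (Suc b) (Suc c) + f b (Suc c) + f (Suc b) c = 0" using assms(3) by (simp add: up2_def)
  moreover have "f (Suc b) (Suc c) \<noteq> 0 \<longrightarrow> s (Suc b) (Suc c) = (f (Suc b) (Suc c) > 0)"
    "f b (Suc c) \<noteq> 0 \<longrightarrow> s b (Suc c) = (f b (Suc c) > 0)" "f (Suc b) c \<noteq> 0 \<longrightarrow> s (Suc b) c = (f (Suc b) c > 0)"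
    using assms(1) by (auto simp: coloured2_def)
  ultimately show ?thesis using assms(2) unfolding zero_tri_def mono_tri_def by (smt (verit))
qed

lemma sum_ends:
  fixes e :: "nat \<Rightarrow> int"
  shows "(\<Sum>i\<le>Suc m. e i) = e 0 + (\<Sum>i<m. e (Suc i)) + e (Suc m)"
  by (induction m) simp_all

text \<open>
A corner lies on two sides with weight one each, another boundary cell on one side with weight two.
\<close>

lemma card_triangle:
  fixes d :: "nat \<Rightarrow> nat \<Rightarrow> bool" and k :: nat
  defines "w \<equiv> \<lambda>i. if i = 0 \<or> i = Suc k then 1 else 2 :: int"
  shows "2 * int (card {(b, c). b + c \<le> Suc k \<and> d b c})
    = (\<Sum>i\<le>Suc k. w i * of_bool (d 0 i)) + (\<Sum>i\<le>Suc k. w i * of_bool (d i 0))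
      + (\<Sum>i\<le>Suc k. w i * of_bool (d i (Suc k - i))) + 2 * (\<Sum>m<k. \<Sum>i<m. of_bool (d (Suc i) (m - i)))"
proof -
  have ends: "(\<Sum>i\<le>Suc k. w i * e i) = e 0 + 2 * (\<Sum>i<k. e (Suc i)) + e (Suc k)" for e
  proof -
    have "(\<Sum>i<k. w (Suc i) * e (Suc i)) = (\<Sum>i<k. 2 * e (Suc i))"
      by (rule sum.cong) (simp_all add: w_def)
    then show ?thesis unfolding sum_ends by (simp add: w_def sum_distrib_left)
  qed
  let ?T = "{(b, c). b + c \<le> Suc k \<and> d b c}"
  let ?S = "SIGMA m:{..Suc k}. {i. i \<le> m \<and> d i (m - i)}"
  have "bij_betw (\<lambda>(m, i). (i, m - i)) ?S ?T"
    by (rule bij_betw_byWitness[where f' = "\<lambda>(b, c). (b + c, b)"]) auto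
  then have "card ?T = card ?S" by (simp add: bij_betw_same_card)
  also have "\<dots> = (\<Sum>m\<le>Suc k. card {i. i \<le> m \<and> d i (m - i)})"
    by (rule card_SigmaI) auto
  finally have "int (card ?T) = (\<Sum>m\<le>Suc k. int (card {i. i \<le> m \<and> d i (m - i)}))"
    by (simp only: of_nat_sum)
  also have "\<dots> = (\<Sum>m\<le>Suc k. \<Sum>i\<le>m. of_bool (d i (m - i)))"
    by (rule sum.cong) (simp_all add: Collect_conj_eq atMost_def)
  also have "\<dots> = of_bool (d 0 0) + (\<Sum>m<k. \<Sum>i\<le>Suc m. of_bool (d i (Suc m - i)))
      + (\<Sum>i\<le>Suc k. of_bool (d i (Suc k - i)))"
    unfolding sum_ends[where e = "\<lambda>m. \<Sum>i\<le>m. of_bool (d i (m - i))"] by (simp del: sum_of_bool_eq)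
  also have "(\<Sum>m<k. \<Sum>i\<le>Suc m. of_bool (d i (Suc m - i)) :: int)
    = (\<Sum>m<k. of_bool (d 0 (Suc m)) + (\<Sum>i<m. of_bool (d (Suc i) (m - i))) + of_bool (d (Suc m) 0))"
    unfolding sum_ends by (simp del: sum_of_bool_eq)
  finally show ?thesis
    unfolding ends sum_ends[where m = k] sum.distrib by (simp del: sum_of_bool_eq)
qed

lemma card_terms:
  assumes "\<And>b c. k < b + c \<Longrightarrow> f b c = 0"
  shows "2 * int (card {(b, c). b + c \<le> Suc k \<and> g b c \<noteq> up2 f b c})
    = (\<Sum>i\<le>Suc k. price k (f 0) (g 0) i) + (\<Sum>i\<le>Suc k. price k (\<lambda>b. f b 0) (\<lambda>b. g b 0) i)
      + (\<Sum>i\<le>Suc k. price k (\<lambda>b. f b (k - b)) (\<lambda>b. g b (Suc k - b)) i)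
      + 2 * (\<Sum>m<k. \<Sum>i<m. of_bool (g (Suc i) (m - i) \<noteq> up2 f (Suc i) (m - i)))"
proof -
  have "up2 f b (Suc k - b) = up1 (\<lambda>b. f b (k - b)) b" if "b \<le> Suc k" for b
    using that assms[of b "Suc k - b"] assms[of "Suc k" 0]
    by (cases "b = Suc k") (auto simp: up2_def up1_def Suc_diff_le)
  moreover have "up2 f 0 c = up1 (f 0) c" "up2 f c 0 = up1 (\<lambda>b. f b 0) c" for c
    by (simp_all add: up2_def up1_def)
  moreover have "(\<Sum>i\<le>Suc k. (if i = 0 \<or> i = Suc k then 1 else 2) * of_bool (g i (Suc k - i) \<noteq> up2 f i (Suc k - i)))
      = (\<Sum>i\<le>Suc k. price k (\<lambda>b. f b (k - b)) (\<lambda>b. g b (Suc k - b)) i)"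
    by (rule sum.cong) (simp_all add: price_def calculation(1) del: mult_eq_0_iff)
  ultimately show ?thesis
    unfolding card_triangle by (simp add: price_def del: sum_of_bool_eq sum.atMost_Suc)
qed

text \<open>
With zeros only, the cost would be larger by one.  A nonzero cell saves the unit for a zero, which
pays for a possible sign change before it, and before the first nonzero cell there is none.
\<close>

lemma row_cost_le:
  assumes "\<And>i. i \<le> n \<Longrightarrow> g i = 0 \<Longrightarrow> t i = s i" "\<exists>i\<le>n. g i \<noteq> 0"
  shows "row_cost n g t \<le> int n + (\<Sum>i<n. of_bool (s i = s (Suc i)))"
proof -
  have *: "row_cost m g t \<le> int m + (\<Sum>i<m. of_bool (s i = s (Suc i))) + of_bool (\<forall>i\<le>m. g i = 0)" if "m \<le> n" for m
    using that
  proof (induction m)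
    case 0
    show ?case by (simp add: row_cost_def)
  next
    case (Suc m)
    have "of_bool (g (Suc m) = 0) + edge (g m = 0) (t m) (g (Suc m) = 0) (t (Suc m)) + of_bool (\<forall>i\<le>m. g i = 0)
      \<le> 1 + of_bool (s m = s (Suc m)) + (of_bool (\<forall>i\<le>Suc m. g i = 0) :: int)"
      using assms(1)[of m] assms(1)[of "Suc m"] Suc.prems
      by (cases "g m = 0"; cases "g (Suc m) = 0") (auto simp: edge_def le_Suc_eq)
    then show ?case using Suc.IH Suc.prems unfolding row_cost_def sum.atMost_Suc sum.lessThan_Suc
      by (simp del: sum_of_bool_eq)
  qed
  have "of_bool (\<forall>i\<le>n. g i = 0) = (0 :: int)" using assms(2) by simp
  then show ?thesis using *[of n] by linarith
qed

lemma coloured_lines: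
  assumes "coloured2 f s"
  shows "coloured (f 0) (s 0)" "coloured (\<lambda>b. f b 0) (\<lambda>b. s b 0)" "coloured (\<lambda>b. f b (k - b)) (\<lambda>b. s b (k - b))"
  using assms by (auto simp: coloured_def coloured2_def)

lemma zero_tri_le:
  assumes "coloured2 f s" "g (Suc b) (Suc c) = 0 \<Longrightarrow> t (Suc b) (Suc c) = s (Suc b) (Suc c)"
    "g b (Suc c) = 0 \<Longrightarrow> t b (Suc c) = s b (Suc c)" "g (Suc b) c = 0 \<Longrightarrow> t (Suc b) c = s (Suc b) c"
  shows "of_bool (zero_tri g t b c) \<le> of_bool (zero_tri f s b c) + (of_bool (g (Suc b) (Suc c) \<noteq> up2 f (Suc b) (Suc c)) :: int)"
proof (cases "zero_tri g t b c \<and> g (Suc b) (Suc c) = up2 f (Suc b) (Suc c)")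
  case True
  then have "mono_tri s b c" "up2 f (Suc b) (Suc c) = 0" using assms(2-4) by (simp_all add: zero_tri_def mono_tri_def)
  then show ?thesis using mono_tri_cancel[OF assms(1)] by simp
qed auto

lemma mono_tri_le:
  assumes "coloured2 f s" "g (Suc b) (Suc c) = 0"
  shows "of_bool (mono_tri s b c) \<le> of_bool (zero_tri f s b c) + (of_bool (g (Suc b) (Suc c) \<noteq> up2 f (Suc b) (Suc c)) :: int)"
  using mono_tri_cancel[OF assms(1)] assms(2) by (cases "mono_tri s b c") fastforce+

text \<open>
One step of the recursion when the side \<open>b + c = k\<close> advances by one: the other two sides grow at one end,
and the potential rises by at most two for each term.
\<close>

lemma step_same:
  assumes col: "coloured2 f s" and out: "\<And>b c. k < b + c \<Longrightarrow> f b c = 0"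
    and sides: "\<exists>c\<le>k. f 0 c \<noteq> 0" "\<exists>b\<le>k. f b 0 \<noteq> 0" "\<exists>b\<le>k. f b (k - b) \<noteq> 0"
    and g: "\<exists>b\<le>Suc k. g b (Suc k - b) \<noteq> 0"
  shows "\<exists>t. coloured2 g t \<and> cost (Suc k) g t
    \<le> cost k f s + 2 * int (card {(b, c). b + c \<le> Suc k \<and> g b c \<noteq> up2 f b c})"
proof -
  define t where "t b c = (if g b c \<noteq> 0 then g b c > 0 else if b + c \<le> k then s b c
      else if c = 0 \<or> (\<exists>j<b. g j (Suc k - j) \<noteq> 0) then \<not> s (b - 1) c else \<not> s b (c - 1))" for b c
  have colt: "coloured2 g t" by (auto simp: coloured2_def t_def)
  have y: "row_cost (Suc k) (g 0) (t 0) \<le> row_cost k (f 0) (s 0) + (\<Sum>i\<le>Suc k. price k (f 0) (g 0) i)"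
    by (rule row_grow[OF coloured_lines(1)[OF col] coloured_lines(1)[OF colt]])
      (use out sides(1) in \<open>auto simp: t_def\<close>)
  have z: "row_cost (Suc k) (\<lambda>b. g b 0) (\<lambda>b. t b 0) \<le> row_cost k (\<lambda>b. f b 0) (\<lambda>b. s b 0)
      + (\<Sum>i\<le>Suc k. price k (\<lambda>b. f b 0) (\<lambda>b. g b 0) i)"
    by (rule row_grow[OF coloured_lines(2)[OF col] coloured_lines(2)[OF colt]])
      (use out sides(2) in \<open>auto simp: t_def\<close>)
  have x: "row_cost (Suc k) (\<lambda>b. g b (Suc k - b)) (\<lambda>b. t b (Suc k - b)) \<le> row_cost k (\<lambda>b. f b (k - b)) (\<lambda>b. s b (k - b))
      + (\<Sum>i\<le>Suc k. price k (\<lambda>b. f b (k - b)) (\<lambda>b. g b (Suc k - b)) i)"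
  proof (rule row_new[OF coloured_lines(3)[OF col] coloured_lines(3)[OF colt]])
    show "t i (Suc k - i) = (if i = Suc k \<or> (\<exists>j<i. g j (Suc k - j) \<noteq> 0) then \<not> s (i - 1) (k - (i - 1)) else \<not> s i (k - i))"
      if "i \<le> Suc k" "g i (Suc k - i) = 0" for i
      using that by (cases "i = Suc k"; cases i) (auto simp: t_def Suc_diff_le)
  qed (use out sides(3) g in auto)
  have "(\<Sum>m<Suc k. \<Sum>i<m. of_bool (zero_tri g t i (m - Suc i))) \<le>
      (\<Sum>m<k. \<Sum>i<m. of_bool (zero_tri f s i (m - Suc i)) + of_bool (g (Suc i) (m - i) \<noteq> up2 f (Suc i) (m - i)) :: int)"
  proof -
    have no: "\<not> zero_tri g t i (k - Suc i)" if "i < k" for i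
    proof -
      have "Suc (k - Suc i) = k - i" using that by simp
      then show ?thesis using that unfolding zero_tri_def mono_tri_def t_def by (auto split: if_splits)
    qed
    moreover have "of_bool (zero_tri g t i (m - Suc i)) \<le> of_bool (zero_tri f s i (m - Suc i))
         + (of_bool (g (Suc i) (m - i) \<noteq> up2 f (Suc i) (m - i)) :: int)" if "m < k" "i < m" for m i
      using zero_tri_le[OF col, of g i "m - Suc i" t] that by (auto simp: t_def Suc_diff_Suc)
    moreover have "(\<Sum>i<k. of_bool (zero_tri g t i (k - Suc i))) = (0 :: int)"
      by (rule sum.neutral) (simp add: no)
    ultimately show ?thesis
      unfolding sum.lessThan_Suc by (simp only: add_0_right) (intro sum_mono; simp)
  qed
  then have "cost (Suc k) g t \<le> cost k f s + 2 * int (card {(b, c). b + c \<le> Suc k \<and> g b c \<noteq> up2 f b c})"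
    using x y z card_terms[of k f g, OF out] unfolding cost_def sum.distrib by linarith
  then show ?thesis using colt by blast
qed

text \<open>
If the outermost lines of the new triangle vanish, it is cut back to size \<open>k'\<close>, and the cut releases
four units per line.  The cells keep their colours; the new side consists of old colours, and strips
compare its pairs of equal colours with those of the old side.
\<close>

lemma step_cut:
  assumes col: "coloured2 f s" and out: "\<And>b c. k < b + c \<Longrightarrow> f b c = 0"
    and sides: "\<exists>c\<le>k. f 0 c \<noteq> 0" "\<exists>b\<le>k. f b 0 \<noteq> 0" "\<exists>b\<le>k. f b (k - b) \<noteq> 0"
    and k': "k' \<le> k" and cut: "\<And>b c. k' < b + c \<Longrightarrow> g b c = 0" and g: "\<exists>b\<le>k'. g b (k' - b) \<noteq> 0"
  shows "\<exists>t. coloured2 g t \<and> cost k' g t + 4 * int (Suc k - k')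
    \<le> cost k f s + 2 * int (card {(b, c). b + c \<le> Suc k \<and> g b c \<noteq> up2 f b c})"
proof -
  define t where "t b c = (if g b c \<noteq> 0 then g b c > 0 else s b c)" for b c
  have colt: "coloured2 g t" by (auto simp: coloured2_def t_def)
  have y: "row_cost k' (g 0) (t 0) + int (Suc k - k') + (\<Sum>i=k'..<k. of_bool (s 0 i = s 0 (Suc i)))
      \<le> row_cost k (f 0) (s 0) + (\<Sum>i\<le>Suc k. price k (f 0) (g 0) i)"
    by (rule row_cut[OF coloured_lines(1)[OF col] coloured_lines(1)[OF colt]])
      (use out sides(1) k' cut in \<open>auto simp: t_def\<close>)
  have z: "row_cost k' (\<lambda>b. g b 0) (\<lambda>b. t b 0) + int (Suc k - k') + (\<Sum>i=k'..<k. of_bool (s i 0 = s (Suc i) 0))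
      \<le> row_cost k (\<lambda>b. f b 0) (\<lambda>b. s b 0) + (\<Sum>i\<le>Suc k. price k (\<lambda>b. f b 0) (\<lambda>b. g b 0) i)"
    by (rule row_cut[OF coloured_lines(2)[OF col] coloured_lines(2)[OF colt]])
      (use out sides(2) k' cut in \<open>auto simp: t_def\<close>)
  have x: "int k + 2 + same_line s k \<le> row_cost k (\<lambda>b. f b (k - b)) (\<lambda>b. s b (k - b))
      + (\<Sum>i\<le>Suc k. price k (\<lambda>b. f b (k - b)) (\<lambda>b. g b (Suc k - b)) i)"
    unfolding same_line_def
    by (rule row_kill[OF coloured_lines(3)[OF col]]) (use out sides(3) k' cut in auto)
  have x': "row_cost k' (\<lambda>b. g b (k' - b)) (\<lambda>b. t b (k' - b)) \<le> int k' + same_line s k'"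
    unfolding same_line_def by (rule row_cost_le) (use g in \<open>auto simp: t_def\<close>)
  have "(\<Sum>m<k'. \<Sum>i<m. of_bool (zero_tri g t i (m - Suc i))) + (\<Sum>m=k'..<k. \<Sum>i<m. of_bool (mono_tri s i (m - Suc i))) \<le>
      (\<Sum>m<k. \<Sum>i<m. of_bool (zero_tri f s i (m - Suc i)) + of_bool (g (Suc i) (m - i) \<noteq> up2 f (Suc i) (m - i)) :: int)"
  proof -
    have "of_bool (zero_tri g t i (m - Suc i)) \<le> of_bool (zero_tri f s i (m - Suc i))
         + (of_bool (g (Suc i) (m - i) \<noteq> up2 f (Suc i) (m - i)) :: int)" if "m < k'" "i < m" for m i
      using zero_tri_le[OF col, of g i "m - Suc i" t] that by (auto simp: t_def Suc_diff_Suc)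
    moreover have "of_bool (mono_tri s i (m - Suc i)) \<le> of_bool (zero_tri f s i (m - Suc i))
         + (of_bool (g (Suc i) (m - i) \<noteq> up2 f (Suc i) (m - i)) :: int)" if "m \<in> {k'..<k}" "i < m" for m i
      using mono_tri_le[OF col, of g i "m - Suc i"] that cut by (auto simp: Suc_diff_Suc)
    moreover have eq: "{..<k} = {..<k'} \<union> {k'..<k}" using k' by auto
    have "(\<Sum>m<k. F m) = (\<Sum>m<k'. F m) + (\<Sum>m=k'..<k. F m)" for F :: "nat \<Rightarrow> int"
      unfolding eq by (rule sum.union_disjoint) auto
    ultimately show ?thesis
      by (simp only:) (intro add_mono sum_mono; simp)
  qed
  moreover have "int (Suc k - k') = int k + 1 - int k'" "int (k - k') = int k - int k'"
    using k' by (simp_all add: of_nat_diff)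
  ultimately have "cost k' g t + 4 * int (Suc k - k') \<le> cost k f s + 2 * int (card {(b, c). b + c \<le> Suc k \<and> g b c \<noteq> up2 f b c})"
    using x y z x' same_line_le[OF k', of s] k' card_terms[of k f g, OF out] unfolding cost_def sum.distrib distrib_left
    by linarith
  then show ?thesis using colt by blast
qed

text \<open>
If the new triangle is zero altogether, the terms of the last step must pay for the full size of the old one.
\<close>

lemma step_kill:
  assumes col: "coloured2 f s" and out: "\<And>b c. k < b + c \<Longrightarrow> f b c = 0"
    and sides: "\<exists>c\<le>k. f 0 c \<noteq> 0" "\<exists>b\<le>k. f b 0 \<noteq> 0" "\<exists>b\<le>k. f b (k - b) \<noteq> 0"
  shows "4 * int k + 6 \<le> cost k f s + 2 * int (card {(b, c). b + c \<le> Suc k \<and> 0 \<noteq> up2 f b c})"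
proof -
  let ?g = "\<lambda>b c :: nat. 0 :: real"
  have y: "int k + 2 + (\<Sum>i<k. of_bool (s 0 i = s 0 (Suc i))) \<le> row_cost k (f 0) (s 0) + (\<Sum>i\<le>Suc k. price k (f 0) (?g 0) i)"
    by (rule row_kill[OF coloured_lines(1)[OF col]]) (use out sides(1) in auto)
  have z: "int k + 2 + (\<Sum>i<k. of_bool (s i 0 = s (Suc i) 0)) \<le> row_cost k (\<lambda>b. f b 0) (\<lambda>b. s b 0) + (\<Sum>i\<le>Suc k. price k (\<lambda>b. f b 0) (\<lambda>b. ?g b 0) i)"
    by (rule row_kill[OF coloured_lines(2)[OF col]]) (use out sides(2) in auto)
  have x: "int k + 2 + same_line s k \<le> row_cost k (\<lambda>b. f b (k - b)) (\<lambda>b. s b (k - b))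
      + (\<Sum>i\<le>Suc k. price k (\<lambda>b. f b (k - b)) (\<lambda>b. ?g b (Suc k - b)) i)"
    unfolding same_line_def
    by (rule row_kill[OF coloured_lines(3)[OF col]]) (use out sides(3) in auto)
  have "of_bool (mono_tri s i (m - Suc i)) \<le> of_bool (zero_tri f s i (m - Suc i))
         + (of_bool (0 \<noteq> up2 f (Suc i) (m - i)) :: int)" if "m < k" "i < m" for m i
      using mono_tri_le[OF col, of ?g i "m - Suc i"] that by (auto simp: Suc_diff_Suc)
  then have "(\<Sum>m<k. \<Sum>i<m. of_bool (mono_tri s i (m - Suc i))) \<le>
      (\<Sum>m<k. \<Sum>i<m. of_bool (zero_tri f s i (m - Suc i)) + of_bool (0 \<noteq> up2 f (Suc i) (m - i)) :: int)"
    by (intro sum_mono) simp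
  moreover have "int k \<le> same_line s k + (\<Sum>c<k. of_bool (s 0 c = s 0 (Suc c)))
     + (\<Sum>b<k. of_bool (s b 0 = s (Suc b) 0)) + 2 * (\<Sum>m<k. \<Sum>i<m. of_bool (mono_tri s i (m - Suc i)))"
    using same_line_le[of 0 k s] unfolding lessThan_atLeast0 same_line_def[of s 0] by (simp del: sum_of_bool_eq)
  ultimately show ?thesis
    using x y z card_terms[of k f ?g] out unfolding cost_def sum.distrib
    by (simp del: sum_of_bool_eq sum.atMost_Suc)
qed

section \<open>The triangle potential along a sequence of rows\<close>

lemma row_cost_shrink:
  fixes u :: "nat \<Rightarrow> bool"
  shows "row_cost n v \<tau> \<le> int n + (\<Sum>i<Suc n. of_bool (u i = u (Suc i))) + of_bool (v 0 = 0 \<and> u 0 = \<tau> 0)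
     + of_bool (v n = 0 \<and> u (Suc n) = \<tau> n)
     + 2 * (\<Sum>i<n. of_bool (v i = 0 \<and> v (Suc i) = 0 \<and> \<tau> i = \<tau> (Suc i) \<and> u (Suc i) = \<tau> i))"
proof (induction n)
  case 0
  show ?case by (cases "u 0"; cases "u (Suc 0)"; cases "\<tau> 0"; cases "v 0 = 0") (simp_all add: row_cost_def)
next
  case (Suc n)
  have *: "of_bool (v (Suc n) = 0) + edge (v n = 0) (\<tau> n) (v (Suc n) = 0) (\<tau> (Suc n)) + of_bool (v n = 0 \<and> u (Suc n) = \<tau> n)
    \<le> 1 + of_bool (u (Suc n) = u (Suc (Suc n))) + of_bool (v (Suc n) = 0 \<and> u (Suc (Suc n)) = \<tau> (Suc n))
      + 2 * (of_bool (v n = 0 \<and> v (Suc n) = 0 \<and> \<tau> n = \<tau> (Suc n) \<and> u (Suc n) = \<tau> n) :: int)"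
    by (cases "v n = 0"; cases "v (Suc n) = 0"; cases "\<tau> n"; cases "\<tau> (Suc n)"; cases "u (Suc n)"; cases "u (Suc (Suc n))")
      (simp_all add: edge_def)
  have "int (Suc n) = int n + 1" by simp
  then show ?case using Suc *
    unfolding sum.lessThan_Suc[of _ "Suc n"] sum.lessThan_Suc[where n = n and g = "\<lambda>i. of_bool (_ i)"] row_cost_def sum.atMost_Suc distrib_left
      sum.lessThan_Suc
    by linarith
qed

text \<open>
A side on which all coefficients vanish costs enough to pay for the next line as a side
and four units more.
\<close>

lemma cost_shrink:
  assumes "\<And>b. b \<le> Suc n \<Longrightarrow> f b 0 = 0"
  shows "cost n (\<lambda>b c. f b (Suc c)) (\<lambda>b c. s b (Suc c)) + 4 \<le> cost (Suc n) f s"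
proof -
  have "row_cost (Suc n) (\<lambda>b. f b 0) (\<lambda>b. s b 0) = (\<Sum>i\<le>Suc n. 1) + (\<Sum>i<Suc n. of_bool (s i 0 = s (Suc i) 0))"
    unfolding row_cost_def by (rule arg_cong2[of _ _ _ _ "(+)"]; rule sum.cong) (use assms in \<open>auto simp: edge_def\<close>)
  then have z: "row_cost (Suc n) (\<lambda>b. f b 0) (\<lambda>b. s b 0) = int n + 2 + (\<Sum>i<Suc n. of_bool (s i 0 = s (Suc i) 0))"
    by (simp del: sum_of_bool_eq)
  have y: "row_cost n (\<lambda>c. f 0 (Suc c)) (\<lambda>c. s 0 (Suc c)) + 1 + of_bool (f 0 (Suc 0) = 0 \<and> s 0 0 = s 0 (Suc 0)) \<le> row_cost (Suc n) (f 0) (s 0)"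
    unfolding row_cost_def sum.atMost_Suc_shift sum.lessThan_Suc_shift using assms[of 0]
    by (simp add: edge_def del: sum_of_bool_eq)
  have "row_cost n (\<lambda>b. f b (Suc n - b)) (\<lambda>b. s b (Suc n - b)) = row_cost n (\<lambda>b. f b (Suc (n - b))) (\<lambda>b. s b (Suc (n - b)))"
    unfolding row_cost_def
  proof (rule arg_cong2[of _ _ _ _ "(+)"]; rule sum.cong)
    fix i assume "i \<in> {..<n}"
    then have "Suc n - i = Suc (n - i)" "Suc n - Suc i = Suc (n - Suc i)" by auto
    then show "edge (f i (Suc n - i) = 0) (s i (Suc n - i)) (f (Suc i) (Suc n - Suc i) = 0) (s (Suc i) (Suc n - Suc i))
      = edge (f i (Suc (n - i)) = 0) (s i (Suc (n - i))) (f (Suc i) (Suc (n - Suc i)) = 0) (s (Suc i) (Suc (n - Suc i)))"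
      by (simp only:)
  qed (auto simp: Suc_diff_le)
  then have x: "row_cost n (\<lambda>b. f b (Suc (n - b))) (\<lambda>b. s b (Suc (n - b))) + 1 + of_bool (f n (Suc 0) = 0 \<and> s n (Suc 0) = s (Suc n) 0)
      \<le> row_cost (Suc n) (\<lambda>b. f b (Suc n - b)) (\<lambda>b. s b (Suc n - b))"
    using assms[of "Suc n"] unfolding row_cost_def by (simp add: edge_def del: sum_of_bool_eq)
  have Z: "(\<Sum>m<Suc n. \<Sum>i<m. of_bool (zero_tri f s i (m - Suc i)) :: int)
    = (\<Sum>m<n. \<Sum>i<m. of_bool (zero_tri (\<lambda>b c. f b (Suc c)) (\<lambda>b c. s b (Suc c)) i (m - Suc i))) + (\<Sum>m<n. of_bool (zero_tri f s m 0))"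
  proof -
    have "(\<Sum>i<m. of_bool (zero_tri f s i (Suc m - Suc i)) :: int) = (\<Sum>i<m. of_bool (zero_tri (\<lambda>b c. f b (Suc c)) (\<lambda>b c. s b (Suc c)) i (m - Suc i)))" for m
    proof (rule sum.cong)
      fix i assume "i \<in> {..<m}"
      then have "Suc m - Suc i = Suc (m - Suc i)" by auto
      then show "(of_bool (zero_tri f s i (Suc m - Suc i)) :: int) = of_bool (zero_tri (\<lambda>b c. f b (Suc c)) (\<lambda>b c. s b (Suc c)) i (m - Suc i))"
        by (simp only: zero_tri_def mono_tri_def)
    qed simp
    then show ?thesis
      unfolding sum.lessThan_Suc_shift[where n = n] by (simp add: sum.distrib del: sum_of_bool_eq)
  qed
  have "(\<Sum>m<n. of_bool (zero_tri f s m 0) :: int)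
     = (\<Sum>i<n. of_bool (f i (Suc 0) = 0 \<and> f (Suc i) (Suc 0) = 0 \<and> s i (Suc 0) = s (Suc i) (Suc 0) \<and> s (Suc i) 0 = s i (Suc 0)))"
  proof (rule sum.cong)
    fix i assume "i \<in> {..<n}"
    then have "f (Suc i) 0 = 0" using assms by simp
    then have "zero_tri f s i 0 \<longleftrightarrow> f i (Suc 0) = 0 \<and> f (Suc i) (Suc 0) = 0 \<and> s i (Suc 0) = s (Suc i) (Suc 0) \<and> s (Suc i) 0 = s i (Suc 0)"
      unfolding zero_tri_def mono_tri_def by blast
    then show "(of_bool (zero_tri f s i 0) :: int) = of_bool (f i (Suc 0) = 0 \<and> f (Suc i) (Suc 0) = 0 \<and> s i (Suc 0) = s (Suc i) (Suc 0) \<and> s (Suc i) 0 = s i (Suc 0))"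
      by simp
  qed simp
  then have "row_cost n (\<lambda>b. f b (Suc 0)) (\<lambda>b. s b (Suc 0)) \<le> int n + (\<Sum>i<Suc n. of_bool (s i 0 = s (Suc i) 0))
     + of_bool (f 0 (Suc 0) = 0 \<and> s 0 0 = s 0 (Suc 0)) + of_bool (f n (Suc 0) = 0 \<and> s (Suc n) 0 = s n (Suc 0))
     + 2 * (\<Sum>m<n. of_bool (zero_tri f s m 0))"
    using row_cost_shrink[of n "\<lambda>b. f b (Suc 0)" "\<lambda>b. s b (Suc 0)" "\<lambda>b. s b 0"] by (simp only:)
  moreover have "(s n (Suc 0) = s (Suc n) 0) \<longleftrightarrow> (s (Suc n) 0 = s n (Suc 0))" by blast
  ultimately show ?thesis
    using x y z Z unfolding cost_def distrib_left by simp
qed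

lemma cost_shrinks:
  assumes "\<And>b c. c < x \<Longrightarrow> f b c = 0" "x \<le> k"
  shows "cost (k - x) (\<lambda>b c. f b (c + x)) (\<lambda>b c. s b (c + x)) + 4 * int x \<le> cost k f s"
  using assms
proof (induction x)
  case (Suc x)
  have "Suc (k - Suc x) = k - x" using Suc.prems by simp
  then have "cost (k - Suc x) (\<lambda>b c. f b (Suc c + x)) (\<lambda>b c. s b (Suc c + x)) + 4 \<le> cost (k - x) (\<lambda>b c. f b (c + x)) (\<lambda>b c. s b (c + x))"
    using cost_shrink[of "k - Suc x" "\<lambda>b c. f b (c + x)" "\<lambda>b c. s b (c + x)"] Suc.prems by simp
  then show ?case using Suc by simp
qed simp

lemma row_cost_rev: "row_cost k (\<lambda>i. f (k - i)) (\<lambda>i. s (k - i)) = row_cost k f s"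
proof -
  have "(\<Sum>i\<le>k. of_bool (f (k - i) = 0) :: int) = (\<Sum>i\<le>k. of_bool (f i = 0))"
    by (rule sum.reindex_bij_witness[of _ "\<lambda>i. k - i" "\<lambda>i. k - i"]) auto
  moreover have "(\<Sum>i<k. edge (f (k - i) = 0) (s (k - i)) (f (k - Suc i) = 0) (s (k - Suc i)))
      = (\<Sum>i<k. edge (f i = 0) (s i) (f (Suc i) = 0) (s (Suc i)))"
    by (rule sum.reindex_bij_witness[of _ "\<lambda>i. k - Suc i" "\<lambda>i. k - Suc i"]) (auto simp: edge_def Suc_diff_Suc)
  ultimately show ?thesis by (simp add: row_cost_def)
qed

lemma cost_swap: "cost k (\<lambda>b c. f c b) (\<lambda>b c. s c b) = cost k f s"
proof -
  have "(\<Sum>i<m. of_bool (zero_tri (\<lambda>b c. f c b) (\<lambda>b c. s c b) i (m - Suc i)) :: int) = (\<Sum>i<m. of_bool (zero_tri f s i (m - Suc i)))" for m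
    by (rule sum.reindex_bij_witness[of _ "\<lambda>i. m - Suc i" "\<lambda>i. m - Suc i"]) (auto simp: zero_tri_def mono_tri_def)
  moreover have "row_cost k (\<lambda>b. f (k - b) b) (\<lambda>b. s (k - b) b) = row_cost k (\<lambda>b. f b (k - b)) (\<lambda>b. s b (k - b))"
  proof -
    have "row_cost k (\<lambda>b. f (k - b) b) (\<lambda>b. s (k - b) b) = row_cost k (\<lambda>b. f (k - b) (k - (k - b))) (\<lambda>b. s (k - b) (k - (k - b)))"
      unfolding row_cost_def by (rule arg_cong2[of _ _ _ _ "(+)"]; rule sum.cong) auto
    also have "\<dots> = row_cost k (\<lambda>b. f b (k - b)) (\<lambda>b. s b (k - b))"
      by (rule row_cost_rev[where f = "\<lambda>b. f b (k - b)" and s = "\<lambda>b. s b (k - b)"])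
    finally show ?thesis .
  qed
  ultimately show ?thesis by (simp add: cost_def)
qed

text \<open>
Colouring the zeros by the parity of \<open>b + c\<close> excludes one-coloured triangles of zeros.
\<close>

lemma cost_start:
  assumes "\<exists>c\<le>k. f 0 c \<noteq> 0" "\<exists>b\<le>k. f b 0 \<noteq> 0" "\<exists>b\<le>k. f b (k - b) \<noteq> 0"
  shows "\<exists>s. coloured2 f s \<and> cost k f s \<le> 4 * int k"
proof -
  define s where "s b c = (if f b c = 0 then even (b + c) else f b c > 0)" for b c
  have "\<not> zero_tri f s b c" for b c
    by (auto simp: zero_tri_def mono_tri_def s_def)
  moreover have "row_cost k (f 0) (s 0) \<le> int k + (\<Sum>i<k. of_bool (even i = even (Suc i)))"
    by (rule row_cost_le) (use assms(1) in \<open>auto simp: s_def\<close>)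
  moreover have "row_cost k (\<lambda>b. f b 0) (\<lambda>b. s b 0) \<le> int k + (\<Sum>i<k. of_bool (even i = even (Suc i)))"
    by (rule row_cost_le) (use assms(2) in \<open>auto simp: s_def\<close>)
  moreover have "row_cost k (\<lambda>b. f b (k - b)) (\<lambda>b. s b (k - b)) \<le> int k + (\<Sum>i<k. of_bool (even k = even k))"
    by (rule row_cost_le[where s = "\<lambda>_. even k"]) (use assms(3) in \<open>auto simp: s_def\<close>)
  ultimately have "cost k f s \<le> 4 * int k"
    by (simp add: cost_def)
  moreover have "coloured2 f s" by (auto simp: coloured2_def s_def)
  ultimately show ?thesis by blast
qed

definition terms2 :: "(nat \<Rightarrow> nat \<Rightarrow> nat \<Rightarrow> real) \<Rightarrow> nat \<Rightarrow> (nat \<times> nat) set" where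
  "terms2 R m = {(b, c). b + c \<le> Suc m \<and> R (Suc m) b c \<noteq> up2 (R m) b c}"

text \<open>
\<open>A\<close>, \<open>B\<close>, \<open>C\<close> are the smallest exponents of the three variables in the form of degree \<open>m\<close> with coefficients
\<open>f b c\<close>, where the first exponent \<open>m - b - c\<close> is implicit.
\<close>

definition tight :: "(nat \<Rightarrow> nat \<Rightarrow> real) \<Rightarrow> nat \<Rightarrow> nat \<Rightarrow> nat \<Rightarrow> nat \<Rightarrow> bool" where
  "tight f m A B C \<longleftrightarrow> (\<forall>b c. f b c \<noteq> 0 \<longrightarrow> B \<le> b \<and> C \<le> c \<and> b + c + A \<le> m)
     \<and> (\<exists>c. f B c \<noteq> 0) \<and> (\<exists>b. f b C \<noteq> 0) \<and> (\<exists>b c. f b c \<noteq> 0 \<and> b + c + A = m)"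

lemma tight_exists:
  assumes "f b0 c0 \<noteq> 0" "\<And>b c. f b c \<noteq> 0 \<Longrightarrow> b + c \<le> m"
  shows "\<exists>A B C. tight f m A B C"
proof -
  let ?B = "LEAST b. \<exists>c. f b c \<noteq> 0" and ?C = "LEAST c. \<exists>b. f b c \<noteq> 0"
    and ?A = "LEAST a. \<exists>b c. f b c \<noteq> 0 \<and> b + c + a = m"
  have "\<exists>c. f ?B c \<noteq> 0" by (rule LeastI[of _ b0]) (use assms in auto)
  moreover have "\<exists>b. f b ?C \<noteq> 0" by (rule LeastI[of _ c0]) (use assms in auto)
  moreover have "f b0 c0 \<noteq> 0 \<and> b0 + c0 + (m - b0 - c0) = m" using assms by fastforce
  then have "\<exists>b c. f b c \<noteq> 0 \<and> b + c + ?A = m" 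
    by (rule LeastI[of "\<lambda>a. \<exists>b c. f b c \<noteq> 0 \<and> b + c + a = m", OF exI, OF exI])
  moreover have "?B \<le> b \<and> ?C \<le> c \<and> b + c + ?A \<le> m" if "f b c \<noteq> 0" for b c
  proof (intro conjI)
    show "?B \<le> b" "?C \<le> c" using that by (auto intro: Least_le)
    have "?A \<le> m - b - c" using that assms(2)[OF that] by (intro Least_le exI[of _ b] exI[of _ c]) auto
    then show "b + c + ?A \<le> m" using assms(2)[OF that] by simp
  qed
  ultimately show ?thesis unfolding tight_def by blast
qed

lemma tight_sides:
  assumes "tight f m A B C"
  defines "k \<equiv> m - A - B - C"
  shows "A + B + C \<le> m" "\<And>b c. k < b + c \<Longrightarrow> f (b + B) (c + C) = 0"
    "\<exists>c\<le>k. f (0 + B) (c + C) \<noteq> 0" "\<exists>b\<le>k. f (b + B) (0 + C) \<noteq> 0" "\<exists>b\<le>k. f (b + B) (k - b + C) \<noteq> 0"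
proof -
  have le: "\<And>b c. f b c \<noteq> 0 \<Longrightarrow> B \<le> b \<and> C \<le> c \<and> b + c + A \<le> m" using assms by (simp add: tight_def)
  obtain c1 b1 b2 c2 where n: "f B c1 \<noteq> 0" "f b1 C \<noteq> 0" "f b2 c2 \<noteq> 0" "b2 + c2 + A = m"
    using assms by (auto simp: tight_def)
  show "A + B + C \<le> m" using le[OF n(1)] by simp
  show "f (b + B) (c + C) = 0" if "k < b + c" for b c
    using le[of "b + B" "c + C"] that by (force simp: k_def)
  show "\<exists>c\<le>k. f (0 + B) (c + C) \<noteq> 0" using le[OF n(1)] n(1) by (intro exI[of _ "c1 - C"]) (auto simp: k_def)
  show "\<exists>b\<le>k. f (b + B) (0 + C) \<noteq> 0" using le[OF n(2)] n(2) by (intro exI[of _ "b1 - B"]) (auto simp: k_def)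
  have "k - (b2 - B) + C = c2" using le[OF n(3)] n(4) by (auto simp: k_def)
  then show "\<exists>b\<le>k. f (b + B) (k - b + C) \<noteq> 0" using le[OF n(3)] n(3,4) by (intro exI[of _ "b2 - B"]) (auto simp: k_def)
qed

lemma up2_shift:
  assumes "tight f m A B C"
  shows "up2 (\<lambda>b c. f (b + B) (c + C)) b c = up2 f (b + B) (c + C)"
proof -
  have "\<And>b c. f b c \<noteq> 0 \<Longrightarrow> B \<le> b \<and> C \<le> c" using assms by (simp add: tight_def)
  then have "B \<noteq> 0 \<Longrightarrow> f (B - 1) (c + C) = 0" "C \<noteq> 0 \<Longrightarrow> f (b + B) (C - 1) = 0"
    by (metis One_nat_def Suc_n_not_le_n Suc_pred neq0_conv)+
  then show ?thesis by (cases b; cases c) (auto simp: up2_def)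
qed

lemma card_shift:
  assumes "tight (R m) m A B C"
  defines "k \<equiv> m - A - B - C" and "f \<equiv> \<lambda>b c. R m (b + B) (c + C)" and "g \<equiv> \<lambda>b c. R (Suc m) (b + B) (c + C)"
  shows "card {(b, c). b + c \<le> Suc k \<and> g b c \<noteq> up2 f b c} \<le> card (terms2 R m)"
proof (rule card_inj_on_le[where f = "\<lambda>(b, c). (b + B, c + C)"])
  show "finite (terms2 R m)"
    by (rule finite_subset[of _ "{..Suc m} \<times> {..Suc m}"]) (auto simp: terms2_def)
  show "(\<lambda>(b, c). (b + B, c + C)) ` {(b, c). b + c \<le> Suc k \<and> g b c \<noteq> up2 f b c} \<subseteq> terms2 R m"
    using tight_sides(1)[OF assms(1)] up2_shift[OF assms(1)]
    by (auto simp: terms2_def k_def f_def g_def)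
qed (auto simp: inj_on_def)

text \<open>
The case of three variables.  Each form is restricted to the smallest triangle that contains its
support; by \<open>low\<close> these triangles are compatible.  With size \<open>k\<close> and potential at most
\<open>4 * k\<close> at the beginning, the bound \<open>cost + 4 * j \<le> 4 * k + 2 * terms\<close> persists: a step raises \<open>k\<close> by one and the
potential by at most twice the number of terms, and every line that is removed releases four units.  The last step needs
\<open>4 * k + 6\<close>, which leaves \<open>4 * (r - 1) + 6 \<le> 2 * terms\<close>.
\<close>

theorem triangle_rows:
  fixes R :: "nat \<Rightarrow> nat \<Rightarrow> nat \<Rightarrow> real"
  assumes deg: "\<And>m b c. R m b c \<noteq> 0 \<Longrightarrow> b + c \<le> m"
    and ne: "\<And>m. \<delta> \<le> m \<Longrightarrow> m < \<delta> + r \<Longrightarrow> \<exists>b c. R m b c \<noteq> 0"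
    and zero: "\<And>b c. R (\<delta> + r) b c = 0" and "r > 0"
    and low: "\<And>m b c A B C. \<delta> \<le> m \<Longrightarrow> tight (R m) m A B C \<Longrightarrow> R (Suc m) b c \<noteq> 0 \<Longrightarrow> B \<le> b \<and> C \<le> c \<and> b + c + A \<le> Suc m"
  shows "2 * r + 1 \<le> (\<Sum>m=\<delta>..<\<delta> + r. card (terms2 R m))"
proof -
  have pot: "\<exists>s. coloured2 (\<lambda>b c. R (\<delta> + j) (b + B) (c + C)) s \<and>
      cost (\<delta> + j - A - B - C) (\<lambda>b c. R (\<delta> + j) (b + B) (c + C)) s + 4 * int j
      \<le> 4 * int (\<delta> + j - A - B - C) + 2 * int (\<Sum>m=\<delta>..<\<delta> + j. card (terms2 R m))"
    if "tight (R (\<delta> + j)) (\<delta> + j) A B C" "j < r" for j A B C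
    using that
  proof (induction j arbitrary: A B C)
    case 0
    then show ?case using cost_start[OF tight_sides(3-5)[OF 0(1)]] by simp
  next
    case (Suc j)
    let ?m = "\<delta> + j"
    obtain b1 c1 where "R ?m b1 c1 \<noteq> 0"
      using ne[of ?m] Suc.prems(2) by auto
    then obtain A0 B0 C0 where t0: "tight (R ?m) ?m A0 B0 C0"
      using tight_exists[of "R ?m"] deg by blast
    define k where "k = ?m - A0 - B0 - C0"
    define f where "f = (\<lambda>b c. R ?m (b + B0) (c + C0))"
    define g where "g = (\<lambda>b c. R (Suc ?m) (b + B0) (c + C0))"
    note sides = tight_sides[OF t0, folded k_def]
    obtain s where s: "coloured2 f s" "cost k f s + 4 * int j
      \<le> 4 * int k + 2 * int (\<Sum>m=\<delta>..<?m. card (terms2 R m))"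
      using Suc.IH[OF t0 Suc_lessD[OF Suc.prems(2)]] unfolding k_def f_def by blast
    have t1: "tight (R (Suc ?m)) (Suc ?m) A B C" using Suc.prems(1) by simp
    have le1: "B \<le> b \<and> C \<le> c \<and> b + c + A \<le> Suc ?m" if "R (Suc ?m) b c \<noteq> 0" for b c
      using t1 that by (simp add: tight_def)
    obtain b2 c2 b3 c3 where n: "R (Suc ?m) B c3 \<noteq> 0" "R (Suc ?m) b3 C \<noteq> 0" "R (Suc ?m) b2 c2 \<noteq> 0" "b2 + c2 + A = Suc ?m"
      using t1 by (auto simp: tight_def)
    have B0: "B0 \<le> B" and C0: "C0 \<le> C" and A0: "A0 \<le> A"
      using low[OF _ t0 n(1)] low[OF _ t0 n(2)] low[OF _ t0 n(3)] n(4) by auto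
    \<comment> \<open>the side opposite to the implicit variable is cut first; the other two sides are then removed line by line\<close>
    define k' where "k' = Suc ?m - A - B0 - C0"
    have kk': "k' + (A - A0) = Suc k"
      using sides(1) le1[OF n(3)] A0 B0 C0 by (simp add: k'_def k_def)
    have cut: "g b c = 0" if "k' < b + c" for b c
      using le1[of "b + B0" "c + C0"] that unfolding g_def k'_def by force
    have line: "\<exists>b\<le>k'. g b (k' - b) \<noteq> 0"
    proof -
      have "k' - (b2 - B0) + C0 = c2" "b2 - B0 \<le> k'"
        using le1[OF n(3)] n(4) B0 C0 by (auto simp: k'_def)
      then show ?thesis using le1[OF n(3)] n(3) B0 by (intro exI[of _ "b2 - B0"]) (auto simp: g_def)
    qed
    let ?D = "{(b, c). b + c \<le> Suc k \<and> g b c \<noteq> up2 f b c}"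
    have "\<exists>t. coloured2 g t \<and> cost k' g t + 4 * int (Suc k - k') \<le> cost k f s + 2 * int (card ?D)"
    proof (cases "A = A0")
      case True
      then have "k' = Suc k" using kk' by simp
      then show ?thesis using step_same[OF s(1)] sides line unfolding f_def by simp
    next
      case False
      then have "k' \<le> k" using kk' A0 by simp
      then show ?thesis using step_cut[OF s(1)] sides line cut unfolding f_def by simp
    qed
    then obtain t where t: "coloured2 g t" "cost k' g t + 4 * int (Suc k - k') \<le> cost k f s + 2 * int (card ?D)"
      by blast
    have D: "card ?D \<le> card (terms2 R ?m)"
      using card_shift[of R ?m, OF t0] unfolding k_def f_def g_def by simp
    define x y where "x = C - C0" and "y = B - B0"
    have xy: "k' - x - y = Suc ?m - A - B - C" "x + y \<le> k'" and x: "C0 + x = C" and y: "B0 + y = B"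
      using le1[OF n(1)] le1[OF n(2)] le1[OF n(3)] B0 C0 tight_sides(1)[OF t1] by (auto simp: x_def y_def k'_def)
    have c1: "cost (k' - x) (\<lambda>b c. g b (c + x)) (\<lambda>b c. t b (c + x)) + 4 * int x \<le> cost k' g t"
    proof (rule cost_shrinks)
      show "g b c = 0" if "c < x" for b c
        using le1[of "b + B0" "c + C0"] that x unfolding g_def by force
    qed (use xy in simp)
    have "cost (k' - x - y) (\<lambda>b c. g (c + y) (b + x)) (\<lambda>b c. t (c + y) (b + x)) + 4 * int y
        \<le> cost (k' - x) (\<lambda>b c. g c (b + x)) (\<lambda>b c. t c (b + x))"
    proof (rule cost_shrinks)
      show "g c (b + x) = 0" if "c < y" for b c
        using le1[of "c + B0" "b + x + C0"] that y unfolding g_def by force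
    qed (use xy in simp)
    then have c2: "cost (k' - x - y) (\<lambda>b c. g (b + y) (c + x)) (\<lambda>b c. t (b + y) (c + x)) + 4 * int y
        \<le> cost (k' - x) (\<lambda>b c. g b (c + x)) (\<lambda>b c. t b (c + x))"
      using cost_swap[of "k' - x - y" "\<lambda>b c. g (b + y) (c + x)" "\<lambda>b c. t (b + y) (c + x)"]
        cost_swap[of "k' - x" "\<lambda>b c. g b (c + x)" "\<lambda>b c. t b (c + x)"] by simp
    have shift: "(\<lambda>b c. g (b + y) (c + x)) = (\<lambda>b c. R (\<delta> + Suc j) (b + B) (c + C))"
      using x y by (auto simp: g_def add_ac)
    have "int k' + int (Suc k - k') = int k + 1" "int (k' - x - y) + int x + int y = int k'"
      using kk' xy(2) by linarith+
    then have "cost (k' - x - y) (\<lambda>b c. g (b + y) (c + x)) (\<lambda>b c. t (b + y) (c + x)) + 4 * int (Suc j)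
      \<le> 4 * int (k' - x - y) + 2 * int (\<Sum>m=\<delta>..<\<delta> + Suc j. card (terms2 R m))"
      using c1 c2 t(2) s(2) D by simp
    moreover have "coloured2 (\<lambda>b c. g (b + y) (c + x)) (\<lambda>b c. t (b + y) (c + x))"
      using t(1) by (simp add: coloured2_def)
    ultimately show ?case unfolding shift xy(1) by auto
  qed
  define j where "j = r - 1"
  have r: "r = Suc j" using \<open>r > 0\<close> by (simp add: j_def)
  obtain b c where "R (\<delta> + j) b c \<noteq> 0" using ne[of "\<delta> + j"] r by auto
  then obtain A B C where t: "tight (R (\<delta> + j)) (\<delta> + j) A B C"
    using tight_exists[of "R (\<delta> + j)"] deg by blast
  define k where "k = \<delta> + j - A - B - C"
  define f where "f = (\<lambda>b c. R (\<delta> + j) (b + B) (c + C))"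
  obtain s where s: "coloured2 f s" "cost k f s + 4 * int j
      \<le> 4 * int k + 2 * int (\<Sum>m=\<delta>..<\<delta> + j. card (terms2 R m))"
    using pot[OF t] r unfolding k_def f_def by blast
  have "4 * int k + 6 \<le> cost k f s + 2 * int (card {(b, c). b + c \<le> Suc k \<and> 0 \<noteq> up2 f b c})"
    using step_kill[OF s(1)] tight_sides[OF t, folded k_def] unfolding f_def by simp
  moreover have "card {(b, c). b + c \<le> Suc k \<and> 0 \<noteq> up2 f b c} \<le> card (terms2 R (\<delta> + j))"
    using card_shift[of R "\<delta> + j", OF t] zero r unfolding k_def f_def by simp
  moreover have "(\<Sum>m=\<delta>..<\<delta> + r. card (terms2 R m)) = (\<Sum>m=\<delta>..<\<delta> + j. card (terms2 R m)) + card (terms2 R (\<delta> + j))"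
    by (simp add: r)
  ultimately show ?thesis using s(2) r by linarith
qed

section \<open>Runs of homogeneous forms\<close>

definition dg :: "nat \<Rightarrow> (nat \<Rightarrow> nat) \<Rightarrow> nat" where
  "dg n \<alpha> = (\<Sum>i<n. \<alpha> i)"

definition expo :: "nat \<Rightarrow> (nat \<Rightarrow> nat) set" where
  "expo n = {\<alpha>. \<forall>i\<ge>n. \<alpha> i = 0}"

definition up :: "nat \<Rightarrow> ((nat \<Rightarrow> nat) \<Rightarrow> real) \<Rightarrow> (nat \<Rightarrow> nat) \<Rightarrow> real" where
  "up n Q \<alpha> = (\<Sum>i<n. if \<alpha> i = 0 then 0 else Q (\<alpha>(i := \<alpha> i - 1)))"

text \<open>
The coefficients of \<open>r\<close> consecutive forms, of degrees \<open>\<delta>\<close> to \<open>\<delta> + r - 1\<close>, kept in one function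
because the degree of an exponent tells to which form it belongs.  Each form is at most \<open>s\<close> times
the previous one, coefficient by coefficient, where \<open>s\<close> is the sum of the variables.  The last
condition says that the last form is not zero.
\<close>

definition run :: "nat \<Rightarrow> ((nat \<Rightarrow> nat) \<Rightarrow> real) \<Rightarrow> nat \<Rightarrow> nat \<Rightarrow> bool" where
  "run n Q \<delta> r \<longleftrightarrow>
     (\<forall>\<alpha>. Q \<alpha> \<noteq> 0 \<longrightarrow> \<alpha> \<in> expo n \<and> \<delta> \<le> dg n \<alpha> \<and> dg n \<alpha> < \<delta> + r)
     \<and> (\<forall>\<alpha>. \<alpha> \<in> expo n \<longrightarrow> \<delta> < dg n \<alpha> \<longrightarrow> Q \<alpha> \<le> up n Q \<alpha>)
     \<and> (\<exists>\<alpha>\<in>expo n. dg n \<alpha> = \<delta> + r \<and> up n Q \<alpha> \<noteq> 0)"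

text \<open>
The discrepancies between consecutive forms; in the application these are the monomials of degree \<open>k + 1\<close> of the polynomial.
\<close>

definition terms_at :: "nat \<Rightarrow> ((nat \<Rightarrow> nat) \<Rightarrow> real) \<Rightarrow> nat \<Rightarrow> (nat \<Rightarrow> nat) set" where
  "terms_at n Q k = {\<alpha> \<in> expo n. dg n \<alpha> = Suc k \<and> up n Q \<alpha> \<noteq> Q \<alpha>}"

definition low :: "nat \<Rightarrow> ((nat \<Rightarrow> nat) \<Rightarrow> real) \<Rightarrow> nat \<Rightarrow> nat \<Rightarrow> nat" where
  "low n Q z k = (LEAST e. \<exists>\<alpha>. Q \<alpha> \<noteq> 0 \<and> dg n \<alpha> = k \<and> \<alpha> z = e)"

lemma runD:
  assumes "run n Q \<delta> r"
  shows "Q \<alpha> \<noteq> 0 \<Longrightarrow> \<alpha> \<in> expo n" "Q \<alpha> \<noteq> 0 \<Longrightarrow> \<delta> \<le> dg n \<alpha>" "Q \<alpha> \<noteq> 0 \<Longrightarrow> dg n \<alpha> < \<delta> + r"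
    "\<alpha> \<in> expo n \<Longrightarrow> \<delta> < dg n \<alpha> \<Longrightarrow> Q \<alpha> \<le> up n Q \<alpha>"
  using assms unfolding run_def by blast+

lemma finite_expo: "finite {\<alpha> \<in> expo n. dg n \<alpha> = k}"
proof -
  have "\<alpha> i \<le> dg n \<alpha>" if "i < n" for \<alpha> i
    unfolding dg_def using that by (intro member_le_sum) auto
  then have "{\<alpha> \<in> expo n. dg n \<alpha> = k} \<subseteq> {\<alpha>. \<forall>i. (i \<in> {..<n} \<longrightarrow> \<alpha> i \<in> {..k}) \<and> (i \<notin> {..<n} \<longrightarrow> \<alpha> i = 0)}"
    by (auto simp: expo_def)
  then show ?thesis
    by (rule finite_subset) (rule finite_set_of_finite_funs; simp)
qed

lemma finite_terms_at: "finite (terms_at n Q k)"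
  by (rule finite_subset[OF _ finite_expo[of n "Suc k"]]) (auto simp: terms_at_def)

lemma dg_fun_upd: "i < n \<Longrightarrow> dg n (\<alpha>(i := x)) + \<alpha> i = dg n \<alpha> + x"
  by (simp add: dg_def sum.remove[of "{..<n}" i])

lemma dg_dec: "i < n \<Longrightarrow> \<alpha> i \<noteq> 0 \<Longrightarrow> Suc (dg n (\<alpha>(i := \<alpha> i - 1))) = dg n \<alpha>"
  using dg_fun_upd[of i n \<alpha> "\<alpha> i - 1"] by simp

lemma dg_inc: "i < n \<Longrightarrow> dg n (\<alpha>(i := Suc (\<alpha> i))) = Suc (dg n \<alpha>)"
  using dg_fun_upd[of i n \<alpha> "Suc (\<alpha> i)"] by simp

lemma expo_upd: "i < n \<Longrightarrow> \<alpha> \<in> expo n \<Longrightarrow> \<alpha>(i := x) \<in> expo n"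
  by (auto simp: expo_def)

lemma up_nonpos:
  assumes "\<And>i. i < n \<Longrightarrow> \<alpha> i \<noteq> 0 \<Longrightarrow> Q (\<alpha>(i := \<alpha> i - 1)) \<le> 0"
  shows "up n Q \<alpha> \<le> 0" "i < n \<Longrightarrow> \<alpha> i \<noteq> 0 \<Longrightarrow> up n Q \<alpha> = 0 \<Longrightarrow> Q (\<alpha>(i := \<alpha> i - 1)) = 0"
proof -
  show "up n Q \<alpha> \<le> 0" unfolding up_def by (rule sum_nonpos) (use assms in auto)
  assume i: "i < n" "\<alpha> i \<noteq> 0" and "up n Q \<alpha> = 0"
  then have "(\<Sum>i<n. - (if \<alpha> i = 0 then 0 else Q (\<alpha>(i := \<alpha> i - 1)))) = 0"
    by (simp add: up_def sum_negf)
  then have "\<forall>i\<in>{..<n}. - (if \<alpha> i = 0 then 0 else Q (\<alpha>(i := \<alpha> i - 1))) = 0"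
    by (subst (asm) sum_nonneg_eq_0_iff) (use assms in auto)
  then have "- (if \<alpha> i = 0 then 0 else Q (\<alpha>(i := \<alpha> i - 1))) = 0" using i by blast
  then show "Q (\<alpha>(i := \<alpha> i - 1)) = 0" using i by simp
qed

lemma up_zero:
  assumes "\<And>i. i < n \<Longrightarrow> \<alpha> i \<noteq> 0 \<Longrightarrow> Q (\<alpha>(i := \<alpha> i - 1)) = 0"
  shows "up n Q \<alpha> = 0"
  unfolding up_def by (rule sum.neutral) (use assms in auto)

text \<open>
Multiplication by the sum of the variables is injective, even when one looks only at a set
of exponents that is closed under raising the exponent of one variable and under lowering exponents:
a nonzero coefficient with the largest possible power of \<open>x_i\<close> survives when multiplied by \<open>x_i\<close>.
\<close>

lemma up_injective:
  assumes i: "i < n" and fin: "\<And>\<beta>. Q \<beta> \<noteq> 0 \<Longrightarrow> \<beta> \<in> expo n"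
    and C: "\<And>\<beta>. C \<beta> \<Longrightarrow> C (\<beta>(i := Suc (\<beta> i)))" "\<And>\<beta> j. C \<beta> \<Longrightarrow> C (\<beta>(j := \<beta> j - 1))"
    and zero: "\<And>\<alpha>. \<alpha> \<in> expo n \<Longrightarrow> dg n \<alpha> = Suc k \<Longrightarrow> C \<alpha> \<Longrightarrow> up n Q \<alpha> = 0"
    and \<beta>: "dg n \<beta> = k" "C \<beta>"
  shows "Q \<beta> = 0"
proof (rule ccontr)
  assume "Q \<beta> \<noteq> 0"
  let ?S = "{\<beta>. Q \<beta> \<noteq> 0 \<and> dg n \<beta> = k \<and> C \<beta>}"
  have "finite ?S" by (rule finite_subset[OF _ finite_expo[of n k]]) (use fin in auto)
  moreover have "\<beta> \<in> ?S" using \<beta> \<open>Q \<beta> \<noteq> 0\<close> by simp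
  ultimately have "Max ((\<lambda>\<eta>. \<eta> i) ` ?S) \<in> (\<lambda>\<eta>. \<eta> i) ` ?S" by (intro Max_in) auto
  then obtain \<gamma> where \<gamma>: "\<gamma> \<in> ?S" "\<gamma> i = Max ((\<lambda>\<eta>. \<eta> i) ` ?S)" by auto
  have max: "\<eta> i \<le> \<gamma> i" if "\<eta> \<in> ?S" for \<eta>
    unfolding \<gamma>(2) by (rule Max_ge) (use that \<open>finite ?S\<close> in auto)
  define \<alpha> where "\<alpha> = \<gamma>(i := Suc (\<gamma> i))"
  have \<alpha>: "\<alpha> \<in> expo n" "dg n \<alpha> = Suc k" "C \<alpha>" "\<alpha> i \<noteq> 0" "\<alpha>(i := \<alpha> i - 1) = \<gamma>"
    using \<gamma>(1) fin i C(1) by (auto simp: \<alpha>_def dg_inc expo_upd)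
  have "Q (\<alpha>(j := \<alpha> j - 1)) = 0" if "j < n" "\<alpha> j \<noteq> 0" "j \<noteq> i" for j
  proof (rule ccontr)
    assume "Q (\<alpha>(j := \<alpha> j - 1)) \<noteq> 0"
    moreover have "dg n (\<alpha>(j := \<alpha> j - 1)) = k" using dg_dec[of j n \<alpha>] that \<alpha>(2) by simp
    ultimately have "\<alpha>(j := \<alpha> j - 1) \<in> ?S" using C(2)[OF \<alpha>(3)] by simp
    from max[OF this] that show False by (simp add: \<alpha>_def)
  qed
  then have "up n Q \<alpha> = (\<Sum>j<n. if j = i then Q \<gamma> else 0)"
    unfolding up_def using \<alpha>(4,5) by (intro sum.cong) auto
  then show False using zero[OF \<alpha>(1-3)] \<gamma>(1) i by simp
qed

text \<open>
Where the exponent of \<open>z\<close> is below \<open>e\<close>, the forms after the degree \<open>k\<close> have no positive coefficients, by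
induction on the degree.  Because a run ends with zero, these coefficients and the terms among
them then vanish backwards by injectivity; there is another variable along which to raise exponents.
\<close>

lemma run_low_persists:
  assumes run: "run n Q \<delta> r" and "n \<ge> 2" "z < n" "\<delta> \<le> k"
    and k: "\<And>\<alpha>. Q \<alpha> \<noteq> 0 \<Longrightarrow> dg n \<alpha> = k \<Longrightarrow> e \<le> \<alpha> z"
    and \<alpha>: "\<alpha> \<in> expo n" "k < dg n \<alpha>" "Q \<alpha> \<noteq> 0 \<or> up n Q \<alpha> \<noteq> 0"
  shows "e \<le> \<alpha> z"
proof (rule ccontr)
  assume "\<not> e \<le> \<alpha> z"
  note D = runD[OF run]
  have neg: "Q \<beta> \<le> 0" if "k \<le> dg n \<beta>" "\<beta> z < e" for \<beta>
    using that
  proof (induction "dg n \<beta>" arbitrary: \<beta> rule: less_induct)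
    case less
    show ?case
    proof (cases "dg n \<beta> = k \<or> \<beta> \<notin> expo n")
      case True
      then show ?thesis using k[of \<beta>] D(1)[of \<beta>] less.prems by fastforce
    next
      case False
      have "up n Q \<beta> \<le> 0"
      proof (rule up_nonpos(1))
        fix i assume i: "i < n" "\<beta> i \<noteq> 0"
        show "Q (\<beta>(i := \<beta> i - 1)) \<le> 0"
          by (rule less.hyps) (use dg_dec[of i n \<beta>] i less.prems False in auto)
      qed
      then show ?thesis using D(4)[of \<beta>] False less.prems \<open>\<delta> \<le> k\<close> by fastforce
    qed
  qed
  obtain i where i: "i < n" "i \<noteq> z"
    by (rule that[of "if z = 0 then 1 else 0"]) (use \<open>n \<ge> 2\<close> in auto)
  have zero: "Q \<beta> = 0" if "k \<le> dg n \<beta>" "\<beta> z < e" for \<beta>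
    using that
  proof (induction "\<delta> + r - dg n \<beta>" arbitrary: \<beta> rule: less_induct)
    case less
    show ?case
    proof (cases "\<beta> \<in> expo n \<and> dg n \<beta> < \<delta> + r")
      case True
      define \<gamma> where "\<gamma> = \<beta>(i := Suc (\<beta> i))"
      have \<gamma>: "dg n \<gamma> = Suc (dg n \<beta>)" "\<gamma> z < e" "\<gamma> \<in> expo n" "\<gamma> i \<noteq> 0" "\<gamma>(i := \<gamma> i - 1) = \<beta>"
        using i less.prems True by (auto simp: \<gamma>_def dg_inc expo_upd)
      have np: "Q (\<gamma>(j := \<gamma> j - 1)) \<le> 0" if "j < n" "\<gamma> j \<noteq> 0" for j
        by (rule neg) (use dg_dec[of j n \<gamma>] that \<gamma> less.prems in auto)
      have "\<delta> + r - dg n \<gamma> < \<delta> + r - dg n \<beta>" using True \<gamma>(1) by linarith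
      then have "Q \<gamma> = 0" using less.hyps[of \<gamma>] \<gamma> less.prems by simp
      moreover have "Q \<gamma> \<le> up n Q \<gamma>" using D(4)[OF \<gamma>(3)] \<gamma>(1) less.prems \<open>\<delta> \<le> k\<close> by simp
      ultimately have "up n Q \<gamma> = 0" using up_nonpos(1)[of n \<gamma> Q] np by fastforce
      then show ?thesis using up_nonpos(2)[of n \<gamma> Q i] np i \<gamma>(4,5) by simp
    next
      case False
      then show ?thesis using D(1,3)[of \<beta>] by blast
    qed
  qed
  have "up n Q \<alpha> = 0"
  proof (rule up_zero)
    fix j assume j: "j < n" "\<alpha> j \<noteq> 0"
    show "Q (\<alpha>(j := \<alpha> j - 1)) = 0"
      by (rule zero) (use dg_dec[of j n \<alpha>] j \<alpha>(2) \<open>\<not> e \<le> \<alpha> z\<close> in auto)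
  qed
  then show False using \<alpha>(2,3) zero[of \<alpha>] \<open>\<not> e \<le> \<alpha> z\<close> by simp
qed

lemma run_row_nonzero:
  assumes run: "run n Q \<delta> r" and "n \<ge> 2" "\<delta> \<le> k" "k < \<delta> + r"
  shows "\<exists>\<alpha>. Q \<alpha> \<noteq> 0 \<and> dg n \<alpha> = k"
proof (rule ccontr)
  assume *: "\<not> ?thesis"
  obtain \<alpha> where \<alpha>: "\<alpha> \<in> expo n" "dg n \<alpha> = \<delta> + r" "up n Q \<alpha> \<noteq> 0" using run by (auto simp: run_def)
  have "Suc (\<alpha> 0) \<le> \<alpha> 0"
    by (rule run_low_persists[OF run \<open>n \<ge> 2\<close> _ \<open>\<delta> \<le> k\<close> _ \<alpha>(1)]) (use * \<alpha> assms in auto)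
  then show False by simp
qed

lemma low_le: "Q \<alpha> \<noteq> 0 \<Longrightarrow> low n Q z (dg n \<alpha>) \<le> \<alpha> z"
  unfolding low_def by (rule Least_le) blast

lemma low_attained:
  assumes "run n Q \<delta> r" "n \<ge> 2" "\<delta> \<le> k" "k < \<delta> + r"
  shows "\<exists>\<alpha>. Q \<alpha> \<noteq> 0 \<and> dg n \<alpha> = k \<and> \<alpha> z = low n Q z k"
proof -
  obtain \<alpha> where "Q \<alpha> \<noteq> 0" "dg n \<alpha> = k" using run_row_nonzero[OF assms] by blast
  then show ?thesis
    unfolding low_def by (rule_tac LeastI[of "\<lambda>e. \<exists>\<alpha>. Q \<alpha> \<noteq> 0 \<and> dg n \<alpha> = k \<and> \<alpha> z = e" "\<alpha> z"]) blast
qed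

lemma low_le_later:
  assumes "run n Q \<delta> r" "n \<ge> 2" "z < n" "\<delta> \<le> k" "\<alpha> \<in> expo n" "k < dg n \<alpha>" "Q \<alpha> \<noteq> 0 \<or> up n Q \<alpha> \<noteq> 0"
  shows "low n Q z k \<le> \<alpha> z"
  by (rule run_low_persists[OF assms(1-4) _ assms(5-7)]) (use low_le in auto)

lemma low_mono:
  assumes "run n Q \<delta> r" "n \<ge> 2" "z < n" "\<delta> \<le> k" "k \<le> k'" "k' < \<delta> + r"
  shows "low n Q z k \<le> low n Q z k'"
proof (cases "k = k'")
  case False
  obtain \<alpha> where "Q \<alpha> \<noteq> 0" "dg n \<alpha> = k'" "\<alpha> z = low n Q z k'"
    using low_attained[OF assms(1,2), of k'] assms by fastforce
  then show ?thesis using low_le_later[OF assms(1-4), of \<alpha>] runD(1)[OF assms(1)] assms False by fastforce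
qed simp

lemma low_le_term:
  assumes "run n Q \<delta> r" "n \<ge> 2" "z < n" "\<delta> \<le> k" "\<alpha> \<in> terms_at n Q k'" "k \<le> k'"
  shows "low n Q z k \<le> \<alpha> z"
  by (rule low_le_later[OF assms(1-4)]) (use assms(5,6) in \<open>auto simp: terms_at_def\<close>)

text \<open>
Coefficients can vanish at the end of the run only by way of terms, so exponents that no
later term has do not occur in the forms either.
\<close>

lemma low_ge:
  assumes run: "run n Q \<delta> r" and "n \<ge> 2" "z < n" "\<delta> \<le> k" "k < \<delta> + r"
    and terms: "\<And>k' \<alpha>. k \<le> k' \<Longrightarrow> \<alpha> \<in> terms_at n Q k' \<Longrightarrow> e \<le> \<alpha> z"
  shows "e \<le> low n Q z k"
proof -
  note D = runD[OF run]
  obtain i where i: "i < n" "i \<noteq> z"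
    by (rule that[of "if z = 0 then 1 else 0"]) (use \<open>n \<ge> 2\<close> in auto)
  have zero: "Q \<beta> = 0" if "k \<le> dg n \<beta>" "\<beta> z < e" for \<beta>
    using that
  proof (induction "\<delta> + r - dg n \<beta>" arbitrary: \<beta> rule: less_induct)
    case less
    show ?case
    proof (cases "dg n \<beta> < \<delta> + r")
      case True
      show ?thesis
      proof (rule up_injective[OF i(1), where Q = Q and \<beta> = \<beta> and C = "\<lambda>\<beta>. \<beta> z < e" and k = "dg n \<beta>"])
        fix \<alpha> assume \<alpha>: "\<alpha> \<in> expo n" "dg n \<alpha> = Suc (dg n \<beta>)" "\<alpha> z < e"
        have "\<delta> + r - dg n \<alpha> < \<delta> + r - dg n \<beta>" using True \<alpha>(2) by linarith
        then have "Q \<alpha> = 0" using less.hyps[of \<alpha>] \<alpha> less.prems by simp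
        moreover have "\<alpha> \<notin> terms_at n Q (dg n \<beta>)" using terms[of "dg n \<beta>" \<alpha>] \<alpha>(3) less.prems by force
        ultimately show "up n Q \<alpha> = 0" using \<alpha> by (simp add: terms_at_def)
      qed (use i D(1) less.prems in auto)
    next
      case False
      then show ?thesis using D(3)[of \<beta>] by blast
    qed
  qed
  obtain \<alpha> where "Q \<alpha> \<noteq> 0" "dg n \<alpha> = k" "\<alpha> z = low n Q z k"
    using low_attained[OF run \<open>n \<ge> 2\<close> \<open>\<delta> \<le> k\<close> \<open>k < \<delta> + r\<close>] by blast
  then show ?thesis using zero[of \<alpha>] by (metis not_le order_refl)
qed

text \<open>
The coefficient forms of \<open>x_n ^ m\<close> in the degrees from \<open>k0\<close> to \<open>k1 - 1\<close>.
\<close>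

definition slice :: "nat \<Rightarrow> ((nat \<Rightarrow> nat) \<Rightarrow> real) \<Rightarrow> nat \<Rightarrow> nat \<Rightarrow> nat \<Rightarrow> (nat \<Rightarrow> nat) \<Rightarrow> real" where
  "slice n Q m k0 k1 \<beta> = (if \<beta> \<in> expo n \<and> k0 \<le> dg n \<beta> + m \<and> dg n \<beta> + m < k1 then Q (\<beta>(n := m)) else 0)"

lemma expo_Suc_upd: "\<beta> \<in> expo n \<Longrightarrow> \<beta>(n := m) \<in> expo (Suc n)"
  by (auto simp: expo_def)

lemma dg_Suc_upd: "dg (Suc n) (\<beta>(n := m)) = dg n \<beta> + m"
  by (simp add: dg_def)

text \<open>
While the lowest exponent \<open>m\<close> of the last variable is constant, nothing arrives from below, so the
slice at \<open>m\<close> is again a run, with one variable less.  It ends where the lowest exponent jumps.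
\<close>

lemma slice_run:
  assumes run: "run (Suc n) Q \<delta> r" and n: "n \<ge> 1" and k: "\<delta> \<le> k0" "k0 < k1" "k1 \<le> \<delta> + r"
    and const: "\<And>k. k0 \<le> k \<Longrightarrow> k < k1 \<Longrightarrow> low (Suc n) Q n k = m"
    and jump: "k1 < \<delta> + r \<Longrightarrow> low (Suc n) Q n k1 \<noteq> m"
  shows "run n (slice n Q m k0 k1) (k0 - m) (k1 - k0)"
    "m \<le> k0"
    "\<And>k. k0 \<le> k \<Longrightarrow> k < k1 \<Longrightarrow> (\<lambda>\<beta>. \<beta>(n := m)) ` terms_at n (slice n Q m k0 k1) (k - m)
        \<subseteq> {\<alpha> \<in> terms_at (Suc n) Q k. \<alpha> n = m}"
proof -
  note D = runD[OF run]
  define Q' where "Q' = slice n Q m k0 k1"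
  have n2: "Suc n \<ge> 2" using n by simp
  have att: "\<exists>\<alpha>. Q \<alpha> \<noteq> 0 \<and> dg (Suc n) \<alpha> = k \<and> \<alpha> n = m" if "k0 \<le> k" "k < k1" for k
    using low_attained[OF run n2, of k n] const[OF that] that k by simp
  then obtain \<alpha>0 where "dg (Suc n) \<alpha>0 = k0" "\<alpha>0 n = m" using k by blast
  then show m: "m \<le> k0" by (auto simp: dg_def)
  have below: "Q \<alpha> = 0" if "k0 \<le> dg (Suc n) \<alpha>" "dg (Suc n) \<alpha> < k1" "\<alpha> n < m" for \<alpha>
    using low_le[of Q \<alpha> "Suc n" n] const[OF that(1,2)] that(3) by force
  have top: "Q \<alpha> = 0" if "dg (Suc n) \<alpha> = k1" "\<alpha> n = m" for \<alpha>
  proof (cases "k1 < \<delta> + r")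
    case True
    have "m \<le> low (Suc n) Q n k1"
      using low_mono[OF run n2, of n "k1 - 1" k1] const[of "k1 - 1"] k True by simp
    then show ?thesis using low_le[of Q \<alpha> "Suc n" n] jump[OF True] that by force
  next
    case False
    then show ?thesis using D(3)[of \<alpha>] that k by force
  qed
  have up: "up n Q' \<beta> = up (Suc n) Q (\<beta>(n := m))" if \<beta>: "\<beta> \<in> expo n" "k0 < dg n \<beta> + m" "dg n \<beta> + m \<le> k1" for \<beta>
  proof -
    have "m = 0 \<or> Q (\<beta>(n := m - 1)) = 0"
      using below[of "\<beta>(n := m - 1)"] \<beta> by (cases m) (auto simp: dg_Suc_upd)
    moreover have "Q' (\<beta>(i := \<beta> i - 1)) = Q (\<beta>(i := \<beta> i - 1, n := m))" if i: "i < n" "\<beta> i \<noteq> 0" for i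
      using dg_dec[of i n \<beta>] i \<beta> expo_upd[of i n \<beta>] by (auto simp: Q'_def slice_def)
    moreover have "\<beta>(n := m, i := \<beta> i - 1) = \<beta>(i := \<beta> i - 1, n := m)" if "i < n" for i
      using that by (auto simp: fun_eq_iff)
    ultimately have "(\<Sum>i<n. if \<beta> i = 0 then 0 else Q' (\<beta>(i := \<beta> i - 1)))
       = (\<Sum>i<n. if (\<beta>(n := m)) i = 0 then 0 else Q (\<beta>(n := m, i := (\<beta>(n := m)) i - 1)))"
      by (intro sum.cong) auto
    then show ?thesis using \<open>m = 0 \<or> Q (\<beta>(n := m - 1)) = 0\<close> by (auto simp: up_def)
  qed
  have val: "Q' \<beta> = Q (\<beta>(n := m))" if \<beta>: "\<beta> \<in> expo n" "k0 \<le> dg n \<beta> + m" "dg n \<beta> + m \<le> k1" for \<beta>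
    using top[of "\<beta>(n := m)"] \<beta> by (auto simp: Q'_def slice_def dg_Suc_upd)
  have "run n Q' (k0 - m) (k1 - k0)"
    unfolding run_def
  proof (intro conjI allI impI)
    fix \<beta>
    show "Q' \<beta> \<noteq> 0 \<Longrightarrow> \<beta> \<in> expo n" "Q' \<beta> \<noteq> 0 \<Longrightarrow> k0 - m \<le> dg n \<beta>" "Q' \<beta> \<noteq> 0 \<Longrightarrow> dg n \<beta> < k0 - m + (k1 - k0)"
      using m by (auto simp: Q'_def slice_def split: if_splits)
    assume \<beta>: "\<beta> \<in> expo n" "k0 - m < dg n \<beta>"
    show "Q' \<beta> \<le> up n Q' \<beta>"
    proof (cases "dg n \<beta> + m \<le> k1")
      case True
      then show ?thesis
        using up[of \<beta>] val[of \<beta>] \<beta> m D(4)[OF expo_Suc_upd[OF \<beta>(1), of m]] k by (simp add: dg_Suc_upd)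
    next
      case False
      have "up n Q' \<beta> = 0"
      proof (rule up_zero)
        fix i assume i: "i < n" "\<beta> i \<noteq> 0"
        then show "Q' (\<beta>(i := \<beta> i - 1)) = 0" using dg_dec[of i n \<beta>] False by (auto simp: Q'_def slice_def)
      qed
      then show ?thesis using False by (auto simp: Q'_def slice_def)
    qed
  next
    obtain \<alpha> where \<alpha>: "Q \<alpha> \<noteq> 0" "dg (Suc n) \<alpha> = k1 - 1" "\<alpha> n = m" using att[of "k1 - 1"] k by fastforce
    define \<beta> where "\<beta> = \<alpha>(n := 0)"
    have ab: "\<beta>(n := m) = \<alpha>" using \<alpha>(3) by (auto simp: \<beta>_def)
    have \<beta>: "\<beta> \<in> expo n" using D(1)[OF \<alpha>(1)] unfolding expo_def \<beta>_def by (auto simp: Suc_le_eq)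
    have dg: "dg n \<beta> + m = k1 - 1" using dg_Suc_upd[of n \<beta> m] ab \<alpha>(2) by simp
    then have "Q' \<beta> \<noteq> 0" using val[of \<beta>] ab \<beta> \<alpha>(1) k by simp
    show "\<exists>\<alpha>\<in>expo n. dg n \<alpha> = k0 - m + (k1 - k0) \<and> up n Q' \<alpha> \<noteq> 0"
    proof (rule ccontr)
      assume "\<not> ?thesis"
      then have "Q' \<beta> = 0"
        using up_injective[where n = n and i = 0 and Q = Q' and C = "\<lambda>_. True" and k = "dg n \<beta>" and \<beta> = \<beta>] n dg m k
        by (auto simp: Q'_def slice_def split: if_splits)
      then show False using \<open>Q' \<beta> \<noteq> 0\<close> by simp
    qed
  qed
  then show "run n (slice n Q m k0 k1) (k0 - m) (k1 - k0)" by (simp add: Q'_def)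
  fix k assume kk: "k0 \<le> k" "k < k1"
  show "(\<lambda>\<beta>. \<beta>(n := m)) ` terms_at n (slice n Q m k0 k1) (k - m) \<subseteq> {\<alpha> \<in> terms_at (Suc n) Q k. \<alpha> n = m}"
  proof clarsimp
    fix \<beta> assume "\<beta> \<in> terms_at n (slice n Q m k0 k1) (k - m)"
    then have \<beta>: "\<beta> \<in> expo n" "dg n \<beta> = Suc (k - m)" "up n Q' \<beta> \<noteq> Q' \<beta>" by (auto simp: terms_at_def Q'_def)
    then show "\<beta>(n := m) \<in> terms_at (Suc n) Q k"
      using up[of \<beta>] val[of \<beta>] m kk by (simp add: terms_at_def expo_Suc_upd dg_Suc_upd)
  qed
qed

text \<open>
Adds up a bound over the maximal intervals on which \<open>M\<close> is constant; every jump of \<open>M\<close> opens a new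
interval and contributes the additive constant \<open>d\<close> once more.
\<close>

lemma intervals:
  fixes M :: "nat \<Rightarrow> nat" and F :: "nat \<Rightarrow> nat"
  assumes "a < b"
    and step: "\<And>k0 k1. a \<le> k0 \<Longrightarrow> k0 < k1 \<Longrightarrow> k1 \<le> b \<Longrightarrow> (\<And>k. k0 \<le> k \<Longrightarrow> k < k1 \<Longrightarrow> M k = M k0)
       \<Longrightarrow> (k1 < b \<Longrightarrow> M k1 \<noteq> M k0) \<Longrightarrow> c * (k1 - k0) + d \<le> (\<Sum>k=k0..<k1. F k)"
  shows "c * (b - a) + d * Suc (card {k \<in> {a<..<b}. M k \<noteq> M (k - 1)}) \<le> (\<Sum>k=a..<b. F k)"
  using assms
proof (induction "b - a" arbitrary: a rule: less_induct)
  case less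
  define k1 where "k1 = (LEAST k. a < k \<and> (k = b \<or> M k \<noteq> M a))"
  have k1: "a < k1 \<and> (k1 = b \<or> M k1 \<noteq> M a)"
    unfolding k1_def by (rule LeastI[of "\<lambda>k. a < k \<and> (k = b \<or> M k \<noteq> M a)" b]) (use less.prems(1) in auto)
  have least: "k1 \<le> k" if "a < k" "k = b \<or> M k \<noteq> M a" for k
    unfolding k1_def by (rule Least_le) (use that in auto)
  have "k1 \<le> b" by (rule least) (use less.prems(1) in simp_all)
  have const: "M k = M a" if "a \<le> k" "k < k1" for k
    using least[of k] that by (cases "k = a") auto
  have 1: "c * (k1 - a) + d \<le> (\<Sum>k=a..<k1. F k)"
  proof (rule less.prems(2))
    show "a < k1" "k1 < b \<Longrightarrow> M k1 \<noteq> M a" using k1 by auto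
    show "M k = M a" if "a \<le> k" "k < k1" for k by (rule const[OF that])
  qed (use \<open>k1 \<le> b\<close> in simp_all)
  show ?case
  proof (cases "k1 = b")
    case True
    have "M k = M (k - 1)" if "k \<in> {a<..<b}" for k
    proof -
      have "M k = M a" "M (k - 1) = M a" by (rule const; use that True in auto)+
      then show ?thesis by simp
    qed
    then have empty: "{k \<in> {a<..<b}. M k \<noteq> M (k - 1)} = {}" by blast
    show ?thesis using 1 unfolding empty True by simp
  next
    case False
    then have lt: "k1 < b" using \<open>k1 \<le> b\<close> by simp
    have IH: "c * (b - k1) + d * Suc (card {k \<in> {k1<..<b}. M k \<noteq> M (k - 1)}) \<le> (\<Sum>k=k1..<b. F k)"
    proof (rule less.hyps)
      show "c * (l1 - l0) + d \<le> (\<Sum>k=l0..<l1. F k)"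
        if "k1 \<le> l0" "l0 < l1" "l1 \<le> b" "\<And>k. l0 \<le> k \<Longrightarrow> k < l1 \<Longrightarrow> M k = M l0" "l1 < b \<Longrightarrow> M l1 \<noteq> M l0" for l0 l1
      proof (rule less.prems(2))
        show "a \<le> l0" using that(1) k1 by simp
      qed (fact that)+
      show "b - k1 < b - a" using lt k1 by linarith
    qed (rule lt)
    have "{k \<in> {a<..<b}. M k \<noteq> M (k - 1)} \<subseteq> insert k1 {k \<in> {k1<..<b}. M k \<noteq> M (k - 1)}"
    proof
      fix k assume k: "k \<in> {k \<in> {a<..<b}. M k \<noteq> M (k - 1)}"
      have "\<not> k < k1"
      proof
        assume "k < k1"
        then have "M k = M a" "M (k - 1) = M a" by (intro const; use k in auto)+
        then show False using k by simp
      qed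
      then show "k \<in> insert k1 {k \<in> {k1<..<b}. M k \<noteq> M (k - 1)}" using k by auto
    qed
    then have "card {k \<in> {a<..<b}. M k \<noteq> M (k - 1)} \<le> card (insert k1 {k \<in> {k1<..<b}. M k \<noteq> M (k - 1)})"
      by (intro card_mono) simp_all
    also have "\<dots> \<le> Suc (card {k \<in> {k1<..<b}. M k \<noteq> M (k - 1)})"
      by (simp add: card_insert_if)
    finally have "card {k \<in> {a<..<b}. M k \<noteq> M (k - 1)} \<le> Suc (card {k \<in> {k1<..<b}. M k \<noteq> M (k - 1)})" .
    then have "d * Suc (card {k \<in> {a<..<b}. M k \<noteq> M (k - 1)}) \<le> d * Suc (Suc (card {k \<in> {k1<..<b}. M k \<noteq> M (k - 1)}))"
      by (intro mult_le_mono2) (rule Suc_le_mono[THEN iffD2])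
    moreover have "(\<Sum>k=a..<b. F k) = (\<Sum>k=a..<k1. F k) + (\<Sum>k=k1..<b. F k)"
      using k1 lt by (simp add: sum.atLeastLessThan_concat)
    moreover have "c * (b - a) = c * (k1 - a) + c * (b - k1)"
      using k1 lt by (simp flip: add_mult_distrib2)
    ultimately show ?thesis using 1 IH by simp
  qed
qed

section \<open>Fronts\<close>

lemma row_cost_cut_right:
  assumes "\<And>i. n < i \<Longrightarrow> i \<le> n + y \<Longrightarrow> f i = 0"
  shows "row_cost n f s + int y \<le> row_cost (n + y) f s"
  using assms
proof (induction y)
  case (Suc y)
  have "row_cost (n + Suc y) f s = row_cost (n + y) f s + of_bool (f (Suc (n + y)) = 0)
      + edge (f (n + y) = 0) (s (n + y)) (f (Suc (n + y)) = 0) (s (Suc (n + y)))"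
    by (simp add: row_cost_def)
  moreover have "0 \<le> edge (f (n + y) = 0) (s (n + y)) (f (Suc (n + y)) = 0) (s (Suc (n + y)))"
    by (simp add: edge_def)
  ultimately show ?case using Suc by simp
qed simp

lemma row_cost_cut_left:
  assumes "\<And>i. i < x \<Longrightarrow> f i = 0"
  shows "row_cost n (\<lambda>i. f (i + x)) (\<lambda>i. s (i + x)) + int x \<le> row_cost (n + x) f s"
  using assms
proof (induction x arbitrary: f s)
  case (Suc x)
  have "row_cost (Suc (n + x)) f s = of_bool (f 0 = 0) + edge (f 0 = 0) (s 0) (f (Suc 0) = 0) (s (Suc 0))
     + row_cost (n + x) (\<lambda>i. f (Suc i)) (\<lambda>i. s (Suc i))"
    unfolding row_cost_def sum.atMost_Suc_shift sum.lessThan_Suc_shift by simp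
  moreover have "0 \<le> edge (f 0 = 0) (s 0) (f (Suc 0) = 0) (s (Suc 0))"
    by (simp add: edge_def)
  moreover have "row_cost n (\<lambda>i. f (Suc (i + x))) (\<lambda>i. s (Suc (i + x))) + int x \<le> row_cost (n + x) (\<lambda>i. f (Suc i)) (\<lambda>i. s (Suc i))"
    by (rule Suc.IH[where f = "\<lambda>i. f (Suc i)"]) (use Suc.prems in simp)
  ultimately show ?case using Suc.prems by simp
qed simp

text \<open>
The cells of the row \<open>f k\<close> lie between \<open>\<mu> k\<close> and \<open>D k - \<nu> k\<close>.  In contrast to \<open>price\<close> a term at the lower end costs
nothing; this is affordable because the coefficients at this end decrease and stay nonnegative.
\<close>

definition front_weight :: "(nat \<Rightarrow> nat \<Rightarrow> real) \<Rightarrow> (nat \<Rightarrow> nat) \<Rightarrow> (nat \<Rightarrow> nat) \<Rightarrow> (nat \<Rightarrow> nat) \<Rightarrow> nat \<Rightarrow> nat \<Rightarrow> int" where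
  "front_weight f \<mu> \<nu> D k c = (if f (Suc k) c \<noteq> up1 (f k) c
     then (if c = \<mu> k then 0 else if c + \<nu> k = Suc (D k) then 1 else 2) else 0)"

lemma front_step:
  assumes supp: "\<And>c. f k c \<noteq> 0 \<Longrightarrow> \<mu> k \<le> c \<and> c + \<nu> k \<le> D k" and ne: "\<exists>c. f k c \<noteq> 0"
    and sign: "0 \<le> f (Suc k) (\<mu> k)" "f (Suc k) (\<mu> k) \<le> f k (\<mu> k)"
    and \<kappa>: "\<kappa> + \<mu> k + \<nu> k = D k" and col: "coloured (\<lambda>i. f k (i + \<mu> k)) s"
  shows "\<exists>t. coloured (\<lambda>i. f (Suc k) (i + \<mu> k)) t \<and>
      row_cost (Suc \<kappa>) (\<lambda>i. f (Suc k) (i + \<mu> k)) t - of_bool (f (Suc k) (\<mu> k) = 0)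
      \<le> row_cost \<kappa> (\<lambda>i. f k (i + \<mu> k)) s - of_bool (f k (\<mu> k) = 0) + (\<Sum>c\<le>Suc (D k). front_weight f \<mu> \<nu> D k c)"
    "(\<And>c. f (Suc k) c = 0) \<Longrightarrow> int \<kappa> + 1 \<le> row_cost \<kappa> (\<lambda>i. f k (i + \<mu> k)) s - of_bool (f k (\<mu> k) = 0)
       + (\<Sum>c\<le>Suc (D k). front_weight f \<mu> \<nu> D k c)"
proof -
  define F where "F = (\<lambda>i. f k (i + \<mu> k))"
  define G where "G = (\<lambda>i. f (Suc k) (i + \<mu> k))"
  \<comment> \<open>a decrease at the corner that leaves it positive changes no sign, so it is undone and only the vanishing of the corner is charged\<close>
  define H where "H = G(0 := if G 0 = 0 then 0 else F 0)"
  have FG: "0 \<le> G 0" "G 0 \<le> F 0" using sign by (simp_all add: F_def G_def)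
  have colF: "coloured F s" using col by (simp add: F_def)
  have Fout: "F (Suc \<kappa>) = 0" "\<exists>i\<le>\<kappa>. F i \<noteq> 0"
  proof -
    show "F (Suc \<kappa>) = 0" using supp[of "Suc \<kappa> + \<mu> k"] \<kappa> by (auto simp: F_def)
    obtain c where "f k c \<noteq> 0" using ne by blast
    then show "\<exists>i\<le>\<kappa>. F i \<noteq> 0" using supp[of c] \<kappa> by (intro exI[of _ "c - \<mu> k"]) (auto simp: F_def)
  qed
  have upF: "up1 F i = up1 (f k) (i + \<mu> k)" for i
    using supp[of "\<mu> k - 1"] by (cases i; cases "\<mu> k") (auto simp: up1_def F_def)
  have wnn: "0 \<le> front_weight f \<mu> \<nu> D k c" for c by (simp add: front_weight_def)
  have pcs: "(\<Sum>i\<le>Suc \<kappa>. price \<kappa> F H i) \<le> of_bool (G 0 = 0 \<and> F 0 \<noteq> 0) + (\<Sum>c\<le>Suc (D k). front_weight f \<mu> \<nu> D k c)"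
  proof -
    have "(\<Sum>i\<le>\<kappa>. price \<kappa> F H (Suc i)) = (\<Sum>i\<le>\<kappa>. front_weight f \<mu> \<nu> D k (Suc i + \<mu> k))"
      by (rule sum.cong) (use \<kappa> upF in \<open>auto simp: price_def front_weight_def H_def G_def\<close>)
    also have "\<dots> = (\<Sum>c\<in>(\<lambda>i. Suc i + \<mu> k) ` {..\<kappa>}. front_weight f \<mu> \<nu> D k c)"
      by (subst sum.reindex) (auto simp: inj_on_def)
    also have "\<dots> \<le> (\<Sum>c\<le>Suc (D k). front_weight f \<mu> \<nu> D k c)"
      by (rule sum_mono2) (use \<kappa> wnn in auto)
    finally have "(\<Sum>i\<le>\<kappa>. price \<kappa> F H (Suc i)) \<le> (\<Sum>c\<le>Suc (D k). front_weight f \<mu> \<nu> D k c)" .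
    moreover have "price \<kappa> F H 0 \<le> of_bool (G 0 = 0 \<and> F 0 \<noteq> 0)"
      by (auto simp: price_def up1_def H_def)
    ultimately show ?thesis unfolding sum.atMost_Suc_shift by simp
  qed
  define t where "t i = (if H i \<noteq> 0 then H i > 0 else if i \<le> \<kappa> then s i else \<not> s \<kappa>)" for i
  have colH: "coloured H t" by (auto simp: coloured_def t_def)
  have HG: "(H i = 0) = (G i = 0)" "(H i > 0) = (G i > 0)" for i
    using FG by (auto simp: H_def)
  have "row_cost (Suc \<kappa>) H t \<le> row_cost \<kappa> F s + (\<Sum>i\<le>Suc \<kappa>. price \<kappa> F H i)"
    by (rule row_grow[OF colF colH]) (use Fout in \<open>auto simp: t_def\<close>)
  moreover have "row_cost (Suc \<kappa>) H t = row_cost (Suc \<kappa>) G t" by (simp add: row_cost_def HG)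
  ultimately have "row_cost (Suc \<kappa>) G t - of_bool (G 0 = 0) \<le> row_cost \<kappa> F s - of_bool (F 0 = 0) + (\<Sum>c\<le>Suc (D k). front_weight f \<mu> \<nu> D k c)"
    using pcs FG by (cases "G 0 = 0"; cases "F 0 = 0") auto
  moreover have "coloured G t" using colH HG by (simp add: coloured_def)
  ultimately show "\<exists>t. coloured (\<lambda>i. f (Suc k) (i + \<mu> k)) t \<and>
      row_cost (Suc \<kappa>) (\<lambda>i. f (Suc k) (i + \<mu> k)) t - of_bool (f (Suc k) (\<mu> k) = 0)
      \<le> row_cost \<kappa> (\<lambda>i. f k (i + \<mu> k)) s - of_bool (f k (\<mu> k) = 0) + (\<Sum>c\<le>Suc (D k). front_weight f \<mu> \<nu> D k c)"
    unfolding F_def G_def by auto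
  assume z: "\<And>c. f (Suc k) c = 0"
  then have "int \<kappa> + 2 + (\<Sum>i<\<kappa>. of_bool (s i = s (Suc i))) \<le> row_cost \<kappa> F s + (\<Sum>i\<le>Suc \<kappa>. price \<kappa> F H i)"
    by (intro row_kill[OF colF]) (use Fout in \<open>auto simp: H_def G_def\<close>)
  moreover have "0 \<le> (\<Sum>i<\<kappa>. of_bool (s i = s (Suc i)) :: int)" by (rule sum_nonneg) simp
  ultimately have "int \<kappa> + 2 \<le> row_cost \<kappa> F s + of_bool (F 0 \<noteq> 0) + (\<Sum>c\<le>Suc (D k). front_weight f \<mu> \<nu> D k c)"
    using pcs z by (simp add: G_def del: sum.atMost_Suc sum_of_bool_eq)
  then show "int \<kappa> + 1 \<le> row_cost \<kappa> (\<lambda>i. f k (i + \<mu> k)) s - of_bool (f k (\<mu> k) = 0)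
       + (\<Sum>c\<le>Suc (D k). front_weight f \<mu> \<nu> D k c)"
    by (cases "F 0 = 0") (simp_all add: F_def)
qed

text \<open>
The analogue of Descartes' rule for a row that grows until it disappears: at the end all cells have
to be paid for.  When the lower end moves, one unit is lost, which is what the jumps of \<open>\<mu>\<close> stand for.
\<close>

lemma front_bound:
  assumes "k0 < k1" and D: "\<And>k. k0 \<le> k \<Longrightarrow> D (Suc k) = Suc (D k)"
    and supp: "\<And>k c. k0 \<le> k \<Longrightarrow> k < k1 \<Longrightarrow> f k c \<noteq> 0 \<Longrightarrow> \<mu> k \<le> c \<and> c + \<nu> k \<le> D k"
    and ne: "\<And>k. k0 \<le> k \<Longrightarrow> k < k1 \<Longrightarrow> \<exists>c. f k c \<noteq> 0"
    and last: "\<And>c. f k1 c = 0"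
    and mono: "\<And>k. k0 \<le> k \<Longrightarrow> Suc k < k1 \<Longrightarrow> \<mu> k \<le> \<mu> (Suc k) \<and> \<nu> k \<le> \<nu> (Suc k)"
    and sign: "\<And>k. k0 \<le> k \<Longrightarrow> k < k1 \<Longrightarrow> 0 \<le> f (Suc k) (\<mu> k) \<and> f (Suc k) (\<mu> k) \<le> f k (\<mu> k)"
  shows "int (k1 - k0) \<le> (\<Sum>k=k0..<k1. \<Sum>c\<le>Suc (D k). front_weight f \<mu> \<nu> D k c)
     + (\<Sum>k=Suc k0..<k1. of_bool (\<mu> k \<noteq> \<mu> (k - 1)))"
proof -
  define w where "w k = (\<Sum>c\<le>Suc (D k). front_weight f \<mu> \<nu> D k c)" for k
  define \<kappa> where "\<kappa> k = D k - \<mu> k - \<nu> k" for k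
  have \<kappa>: "\<kappa> k + \<mu> k + \<nu> k = D k" if "k0 \<le> k" "k < k1" for k
    using ne[OF that] supp[OF that] by (force simp: \<kappa>_def)
  have inv: "\<exists>s. coloured (\<lambda>i. f (k0 + j) (i + \<mu> (k0 + j))) s \<and>
      row_cost (\<kappa> (k0 + j)) (\<lambda>i. f (k0 + j) (i + \<mu> (k0 + j))) s - of_bool (f (k0 + j) (\<mu> (k0 + j)) = 0) + int j
      \<le> int (\<kappa> (k0 + j)) + (\<Sum>k=k0..<k0 + j. w k) + (\<Sum>k=Suc k0..<Suc (k0 + j). of_bool (\<mu> k \<noteq> \<mu> (k - 1)))"
    if "k0 + j < k1" for j
    using that
  proof (induction j)
    case 0
    define s where "s i = (if f k0 (i + \<mu> k0) \<noteq> 0 then f k0 (i + \<mu> k0) > 0 else even i)" for i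
    have "\<exists>i\<le>\<kappa> k0. f k0 (i + \<mu> k0) \<noteq> 0"
    proof -
      obtain c where "f k0 c \<noteq> 0" using ne[of k0] \<open>k0 < k1\<close> by blast
      then show ?thesis using supp[of k0 c] \<kappa>[of k0] \<open>k0 < k1\<close> by (intro exI[of _ "c - \<mu> k0"]) auto
    qed
    then have "row_cost (\<kappa> k0) (\<lambda>i. f k0 (i + \<mu> k0)) s \<le> int (\<kappa> k0) + (\<Sum>i<\<kappa> k0. of_bool (even i = even (Suc i)))"
      by (intro row_cost_le) (auto simp: s_def)
    moreover have "coloured (\<lambda>i. f k0 (i + \<mu> k0)) s" by (auto simp: coloured_def s_def)
    ultimately show ?case by auto
  next
    case (Suc j)
    define k where "k = k0 + j"
    have k: "k0 \<le> k" "Suc k < k1" "k < k1" using Suc.prems by (simp_all add: k_def)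
    obtain s where s: "coloured (\<lambda>i. f k (i + \<mu> k)) s"
      "row_cost (\<kappa> k) (\<lambda>i. f k (i + \<mu> k)) s - of_bool (f k (\<mu> k) = 0) + int j
      \<le> int (\<kappa> k) + (\<Sum>k=k0..<k. w k) + (\<Sum>k=Suc k0..<Suc k. of_bool (\<mu> k \<noteq> \<mu> (k - 1)))"
      using Suc.IH Suc.prems unfolding k_def by auto
    obtain t where t: "coloured (\<lambda>i. f (Suc k) (i + \<mu> k)) t"
      "row_cost (Suc (\<kappa> k)) (\<lambda>i. f (Suc k) (i + \<mu> k)) t - of_bool (f (Suc k) (\<mu> k) = 0)
      \<le> row_cost (\<kappa> k) (\<lambda>i. f k (i + \<mu> k)) s - of_bool (f k (\<mu> k) = 0) + w k"
      using front_step(1)[of f k \<mu> \<nu> D "\<kappa> k" s] supp[OF k(1,3)] ne[OF k(1,3)] \<kappa>[OF k(1,3)] s(1) sign[OF k(1,3)]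
      unfolding w_def by blast
    define x y where "x = \<mu> (Suc k) - \<mu> k" and "y = \<nu> (Suc k) - \<nu> k"
    have xy: "\<mu> k + x = \<mu> (Suc k)" "\<nu> k + y = \<nu> (Suc k)" using mono[OF k(1,2)] by (auto simp: x_def y_def)
    have \<kappa>': "Suc (\<kappa> k) = \<kappa> (Suc k) + x + y"
      using \<kappa>[OF k(1,3)] \<kappa>[of "Suc k"] k D[OF k(1)] xy by simp
    define G where "G = (\<lambda>i. f (Suc k) (i + \<mu> k))"
    have Gs: "G i = 0" if "i < x \<or> \<kappa> (Suc k) + x < i" for i
      using supp[of "Suc k" "i + \<mu> k"] k that xy \<kappa>[of "Suc k"] by (force simp: G_def)
    have "row_cost (\<kappa> (Suc k)) (\<lambda>i. G (i + x)) (\<lambda>i. t (i + x)) + int x \<le> row_cost (\<kappa> (Suc k) + x) G t"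
      by (rule row_cost_cut_left) (use Gs in auto)
    moreover have "row_cost (\<kappa> (Suc k) + x) G t + int y \<le> row_cost (\<kappa> (Suc k) + x + y) G t"
      by (rule row_cost_cut_right) (use Gs in auto)
    moreover have Gx: "(\<lambda>i. G (i + x)) = (\<lambda>i. f (Suc k) (i + \<mu> (Suc k)))" using xy(1) by (auto simp: G_def add_ac)
    ultimately have Wk: "row_cost (\<kappa> (Suc k)) (\<lambda>i. f (Suc k) (i + \<mu> (Suc k))) (\<lambda>i. t (i + x)) + int x + int y \<le> row_cost (Suc (\<kappa> k)) G t"
      unfolding \<kappa>' by simp
    have bk: "of_bool (f (Suc k) (\<mu> k) = 0) \<le> of_bool (f (Suc k) (\<mu> (Suc k)) = 0) + (of_bool (\<mu> (Suc k) \<noteq> \<mu> k) :: int)"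
      by auto
    have "int (Suc (\<kappa> k)) = int (\<kappa> (Suc k)) + int x + int y" unfolding \<kappa>' by simp
    then have "row_cost (\<kappa> (Suc k)) (\<lambda>i. f (Suc k) (i + \<mu> (Suc k))) (\<lambda>i. t (i + x)) - of_bool (f (Suc k) (\<mu> (Suc k)) = 0) + int (Suc j)
      \<le> int (\<kappa> (Suc k)) + (\<Sum>k=k0..<Suc k. w k) + (\<Sum>k=Suc k0..<Suc (Suc k). of_bool (\<mu> k \<noteq> \<mu> (k - 1)))"
      using Wk bk s(2) t(2) k(1) unfolding G_def by (simp del: sum_of_bool_eq)
    moreover have "coloured (\<lambda>i. f (Suc k) (i + \<mu> (Suc k))) (\<lambda>i. t (i + x))"
      using t(1) unfolding Gx[symmetric] G_def by (simp add: coloured_def)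
    moreover have eq: "k0 + Suc j = Suc k" by (simp add: k_def)
    ultimately show ?case unfolding eq by blast
  qed
  define j where "j = k1 - k0 - 1"
  define k where "k = k0 + j"
  have k: "k0 \<le> k" "k < k1" "Suc k = k1" using \<open>k0 < k1\<close> by (auto simp: j_def k_def)
  obtain s where s: "coloured (\<lambda>i. f k (i + \<mu> k)) s"
    "row_cost (\<kappa> k) (\<lambda>i. f k (i + \<mu> k)) s - of_bool (f k (\<mu> k) = 0) + int j
      \<le> int (\<kappa> k) + (\<Sum>k=k0..<k. w k) + (\<Sum>k=Suc k0..<Suc k. of_bool (\<mu> k \<noteq> \<mu> (k - 1)))"
    using inv[of j] k unfolding k_def by auto
  have "int (\<kappa> k) + 1 \<le> row_cost (\<kappa> k) (\<lambda>i. f k (i + \<mu> k)) s - of_bool (f k (\<mu> k) = 0) + w k"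
    unfolding w_def
    by (rule front_step(2)) (use supp[OF k(1,2)] ne[OF k(1,2)] \<kappa>[OF k(1,2)] s(1) sign[OF k(1,2)] last k(3) in simp_all)
  moreover have "(\<Sum>k=k0..<k1. w k) = (\<Sum>k=k0..<k. w k) + w k"
    unfolding k(3)[symmetric] using k(1) by simp
  moreover have "int (k1 - k0) = int j + 1" using \<open>k0 < k1\<close> by (simp add: j_def)
  ultimately show ?thesis using s(2) unfolding w_def k(3) by linarith
qed

lemma up_single:
  assumes "h < n" "\<alpha> h \<noteq> 0" "\<And>i. i < n \<Longrightarrow> i \<noteq> h \<Longrightarrow> \<alpha> i \<noteq> 0 \<Longrightarrow> Q (\<alpha>(i := \<alpha> i - 1)) = 0"
  shows "up n Q \<alpha> = Q (\<alpha>(h := \<alpha> h - 1))"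
proof -
  have "up n Q \<alpha> = (\<Sum>i<n. if i = h then Q (\<alpha>(h := \<alpha> h - 1)) else 0)"
    unfolding up_def by (rule sum.cong) (use assms in auto)
  then show ?thesis using assms(1) by simp
qed

lemma below_low:
  assumes "dg n \<alpha> = k" "\<alpha> z < low n Q z k"
  shows "Q \<alpha> = 0"
  using low_le[of Q \<alpha> n z] assms by force

text \<open>
If all exponents except that of \<open>h\<close> are lowest possible, the only parent is the one in the direction \<open>h\<close>.
\<close>

lemma corner_le:
  assumes run: "run n Q \<delta> r" and h: "h < n" and \<alpha>: "\<alpha> \<in> expo n" "\<delta> \<le> dg n \<alpha>"
    and low: "\<And>i. i < n \<Longrightarrow> i \<noteq> h \<Longrightarrow> \<alpha> i \<le> low n Q i (dg n \<alpha>)"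
  shows "Q (\<alpha>(h := Suc (\<alpha> h))) \<le> Q \<alpha>"
    "up n Q (\<alpha>(h := Suc (\<alpha> h))) = Q \<alpha>"
proof -
  let ?\<beta> = "\<alpha>(h := Suc (\<alpha> h))"
  have "up n Q ?\<beta> = Q (?\<beta>(h := ?\<beta> h - 1))"
  proof (rule up_single)
    fix i assume i: "i < n" "i \<noteq> h" "?\<beta> i \<noteq> 0"
    show "Q (?\<beta>(i := ?\<beta> i - 1)) = 0"
    proof (rule below_low[where Q = Q and n = n and z = i and k = "dg n \<alpha>"])
      show "dg n (?\<beta>(i := ?\<beta> i - 1)) = dg n \<alpha>" using dg_dec[of i n ?\<beta>] i h by (simp add: dg_inc)
      show "(?\<beta>(i := ?\<beta> i - 1)) i < low n Q i (dg n \<alpha>)" using low[OF i(1,2)] i by simp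
    qed
  qed (use h in simp_all)
  then show "up n Q ?\<beta> = Q \<alpha>" by simp
  then show "Q ?\<beta> \<le> Q \<alpha>"
    using runD(4)[OF run, of ?\<beta>] \<alpha> h by (simp add: expo_upd dg_inc)
qed

text \<open>
Along the direction \<open>h\<close> the coefficients decrease, and they end with zero.
\<close>

lemma corner_nonneg:
  assumes run: "run n Q \<delta> r" and n: "n \<ge> 2" and h: "h < n" and \<alpha>: "\<alpha> \<in> expo n" "\<delta> \<le> dg n \<alpha>"
    and low: "\<And>i. i < n \<Longrightarrow> i \<noteq> h \<Longrightarrow> \<alpha> i \<le> low n Q i (dg n \<alpha>)"
  shows "0 \<le> Q \<alpha>"
  using \<alpha> low
proof (induction "\<delta> + r - dg n \<alpha>" arbitrary: \<alpha> rule: less_induct)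
  case less
  let ?\<beta> = "\<alpha>(h := Suc (\<alpha> h))"
  show ?case
  proof (cases "dg n \<alpha> < \<delta> + r")
    case True
    have dg: "dg n ?\<beta> = Suc (dg n \<alpha>)" using h by (simp add: dg_inc)
    have "0 \<le> Q ?\<beta>"
    proof (cases "Suc (dg n \<alpha>) < \<delta> + r")
      case True
      show ?thesis
      proof (rule less.hyps)
        show "\<delta> + r - dg n ?\<beta> < \<delta> + r - dg n \<alpha>" using True dg by linarith
        show "?\<beta> \<in> expo n" using less.prems(1) h by (simp add: expo_upd)
        show "\<delta> \<le> dg n ?\<beta>" using less.prems(2) dg by simp
        fix i assume i: "i < n" "i \<noteq> h"
        have "low n Q i (dg n \<alpha>) \<le> low n Q i (Suc (dg n \<alpha>))"
          by (rule low_mono[OF run n i(1) less.prems(2)]) (use True in auto)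
        then show "?\<beta> i \<le> low n Q i (dg n ?\<beta>)" using less.prems(3)[OF i] i dg by simp
      qed
    next
      case False
      then show ?thesis using runD(3)[OF run, of ?\<beta>] dg by force
    qed
    then show ?thesis using corner_le(1)[OF run h less.prems] by simp
  next
    case False
    then show ?thesis using runD(3)[OF run, of \<alpha>] by force
  qed
qed

lemma run_pos: "run n Q \<delta> r \<Longrightarrow> r > 0"
proof (rule ccontr)
  assume run: "run n Q \<delta> r" and "\<not> r > 0"
  then have "Q \<alpha> = 0" for \<alpha> using runD(2,3)[OF run, of \<alpha>] by force
  then have "up n Q \<alpha> = 0" for \<alpha> by (intro up_zero) auto
  then show False using run by (auto simp: run_def)
qed

definition vec3 :: "nat \<Rightarrow> nat \<Rightarrow> nat \<Rightarrow> nat \<Rightarrow> nat" where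
  "vec3 a b c i = (if i = 0 then a else if i = 1 then b else if i = 2 then c else 0)"

lemma vec3_simps [simp]: "vec3 a b c 0 = a" "vec3 a b c (Suc 0) = b" "vec3 a b c 2 = c" "vec3 a b c \<in> expo 3"
  "dg 3 (vec3 a b c) = a + b + c"
  by (auto simp: vec3_def expo_def dg_def eval_nat_numeral)

lemma vec3_upd: "(vec3 a b c)(0 := x) = vec3 x b c" "(vec3 a b c)(Suc 0 := x) = vec3 a x c" "(vec3 a b c)(2 := x) = vec3 a b x"
  by (auto simp: vec3_def fun_eq_iff)

lemma expo3_eq: "\<alpha> \<in> expo 3 \<Longrightarrow> \<alpha> = vec3 (\<alpha> 0) (\<alpha> 1) (\<alpha> 2)"
  by (auto simp: vec3_def fun_eq_iff expo_def)

lemma up_vec3: "up 3 Q (vec3 a b c) = (if a = 0 then 0 else Q (vec3 (a - 1) b c))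
    + (if b = 0 then 0 else Q (vec3 a (b - 1) c)) + (if c = 0 then 0 else Q (vec3 a b (c - 1)))"
proof -
  have "{..<3::nat} = {0, Suc 0, 2}" by auto
  then show ?thesis by (simp add: up_def vec3_upd)
qed

theorem run3_terms:
  assumes run: "run 3 Q \<delta> r"
  shows "2 * r + 1 \<le> (\<Sum>k=\<delta>..<\<delta> + r. card (terms_at 3 Q k))"
proof -
  define R where "R m b c = (if b + c \<le> m then Q (vec3 (m - b - c) b c) else 0)" for m b c
  note D = runD[OF run]
  have row: "\<exists>b c. R m b c \<noteq> 0" if m: "\<delta> \<le> m" "m < \<delta> + r" for m
  proof -
    obtain \<alpha> where \<alpha>: "Q \<alpha> \<noteq> 0" "dg 3 \<alpha> = m" using run_row_nonzero[OF run _ m] by auto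
    have "\<alpha> = vec3 (\<alpha> 0) (\<alpha> 1) (\<alpha> 2)" using D(1)[OF \<alpha>(1)] by (rule expo3_eq)
    moreover from this have "\<alpha> 0 + \<alpha> 1 + \<alpha> 2 = m" using \<alpha>(2) by (metis vec3_simps(5))
    ultimately have "R m (\<alpha> 1) (\<alpha> 2) \<noteq> 0" using \<alpha>(1) by (auto simp: R_def)
    then show ?thesis by blast
  qed
  have "2 * r + 1 \<le> (\<Sum>m=\<delta>..<\<delta> + r. card (terms2 R m))"
  proof (rule triangle_rows)
    show "b + c \<le> m" if "R m b c \<noteq> 0" for m b c using that by (auto simp: R_def split: if_splits)
    show "R (\<delta> + r) b c = 0" for b c
      using D(3)[of "vec3 (\<delta> + r - b - c) b c"] by (cases "b + c \<le> \<delta> + r") (force simp: R_def)+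
    show "r > 0" by (rule run_pos[OF run])
    fix m b c A B C
    assume m: "\<delta> \<le> m" and t: "tight (R m) m A B C" and nz: "R (Suc m) b c \<noteq> 0"
    define \<alpha> where "\<alpha> = vec3 (Suc m - b - c) b c"
    have \<alpha>: "b + c \<le> Suc m" "Q \<alpha> \<noteq> 0" using nz by (auto simp: R_def \<alpha>_def split: if_splits)
    have cells: "A \<le> \<beta> 0 \<and> B \<le> \<beta> 1 \<and> C \<le> \<beta> 2" if "Q \<beta> \<noteq> 0" "dg 3 \<beta> = m" for \<beta>
    proof -
      have eq: "\<beta> = vec3 (\<beta> 0) (\<beta> 1) (\<beta> 2)" using D(1)[OF that(1)] by (rule expo3_eq)
      then have sum: "\<beta> 0 + \<beta> 1 + \<beta> 2 = m" using that(2) by (metis vec3_simps(5))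
      then have "R m (\<beta> 1) (\<beta> 2) \<noteq> 0" using that(1) eq by (auto simp: R_def)
      then show ?thesis using t sum unfolding tight_def by force
    qed
    have *: "e \<le> \<alpha> z" if "z < 3" "\<And>\<beta>. Q \<beta> \<noteq> 0 \<Longrightarrow> dg 3 \<beta> = m \<Longrightarrow> e \<le> \<beta> z" for e z
      by (rule run_low_persists[OF run, where k = m and z = z and \<alpha> = \<alpha> and e = e])
        (use that m \<alpha> in \<open>auto simp: \<alpha>_def\<close>)
    have "A \<le> \<alpha> 0" "B \<le> \<alpha> 1" "C \<le> \<alpha> 2" by (rule *; use cells in simp)+
    then show "B \<le> b \<and> C \<le> c \<and> b + c + A \<le> Suc m" using \<alpha>(1) by (simp add: \<alpha>_def)
  qed (rule row)
  also have "\<dots> \<le> (\<Sum>k=\<delta>..<\<delta> + r. card (terms_at 3 Q k))"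
  proof (rule sum_mono)
    fix m
    have "inj_on (\<lambda>(b, c). vec3 (Suc m - b - c) b c) (terms2 R m)"
      by (auto simp: inj_on_def) (metis vec3_simps(2,3))+
    moreover have "(\<lambda>(b, c). vec3 (Suc m - b - c) b c) ` terms2 R m \<subseteq> terms_at 3 Q m"
    proof clarify
      fix b c assume "(b, c) \<in> terms2 R m"
      then have bc: "b + c \<le> Suc m" "R (Suc m) b c \<noteq> up2 (R m) b c" by (auto simp: terms2_def)
      have "up2 (R m) b c = up 3 Q (vec3 (Suc m - b - c) b c)"
        using bc(1) unfolding up_vec3 up2_def R_def by (auto simp: Suc_diff_le)
      then show "vec3 (Suc m - b - c) b c \<in> terms_at 3 Q m" using bc by (simp add: terms_at_def R_def)
    qed
    ultimately show "card (terms2 R m) \<le> card (terms_at 3 Q m)"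
      using card_inj_on_le finite_terms_at by blast
  qed
  finally show ?thesis .
qed

lemma sum_if_card: "finite A \<Longrightarrow> (\<Sum>k\<in>A. if P k then 1 else 0) = card {k \<in> A. P k}"
  by (simp add: sum.If_cases Int_def)

text \<open>
How often the lowest exponent of \<open>z\<close> changes within the run.
\<close>

definition jumps :: "nat \<Rightarrow> ((nat \<Rightarrow> nat) \<Rightarrow> real) \<Rightarrow> nat \<Rightarrow> nat \<Rightarrow> nat \<Rightarrow> nat" where
  "jumps n Q \<delta> r z = card {k \<in> {\<delta><..<\<delta> + r}. low n Q z k \<noteq> low n Q z (k - 1)}"

text \<open>
The cells of the front of the variable \<open>j < 2\<close>, on which its exponent is \<open>m\<close>, in the coordinate \<open>c\<close>
given by the exponent of the third variable.
\<close>

definition cellv :: "nat \<Rightarrow> nat \<Rightarrow> nat \<Rightarrow> nat \<Rightarrow> nat \<Rightarrow> nat" where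
  "cellv j m k c = (if j = 0 then vec3 m (k - m - c) c else vec3 (k - m - c) m c)"

text \<open>
The value of \<open>front_weight\<close> in terms of exponents.
\<close>

definition side_weight :: "((nat \<Rightarrow> nat) \<Rightarrow> real) \<Rightarrow> nat \<Rightarrow> nat \<Rightarrow> (nat \<Rightarrow> nat) \<Rightarrow> nat" where
  "side_weight Q j k \<alpha> = (if \<alpha> 2 = low 3 Q 2 k then 0 else if \<alpha> (1 - j) = low 3 Q (1 - j) k then 1 else 2)"

lemma cellv_simps:
  assumes "j < 2"
  shows "cellv j m k c 2 = c" "cellv j m k c j = m" "cellv j m k c (1 - j) = k - m - c" "cellv j m k c \<in> expo 3"
    "m + c \<le> k \<Longrightarrow> dg 3 (cellv j m k c) = k"
proof -
  have "j = 0 \<or> j = 1" using assms by auto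
  then show "cellv j m k c 2 = c" "cellv j m k c j = m" "cellv j m k c (1 - j) = k - m - c" "cellv j m k c \<in> expo 3"
    "m + c \<le> k \<Longrightarrow> dg 3 (cellv j m k c) = k"
    by (auto simp: cellv_def)
qed

lemma expo3_cellv: "j < 2 \<Longrightarrow> \<alpha> \<in> expo 3 \<Longrightarrow> \<alpha> = cellv j (\<alpha> j) (dg 3 \<alpha>) (\<alpha> 2) \<and> \<alpha> j + \<alpha> 2 + \<alpha> (1 - j) = dg 3 \<alpha>"
proof -
  assume j: "j < 2" and "\<alpha> \<in> expo 3"
  then obtain a b c where "\<alpha> = vec3 a b c" using expo3_eq by blast
  then show ?thesis using j by (cases "j = 0") (auto simp: cellv_def less_2_cases_iff)
qed

text \<open>
The front of \<open>j\<close>, while its lowest exponent is constant, is a row to which \<open>front_bound\<close> applies, with the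
lower end at the lowest exponent of the third variable.
\<close>

lemma front3_step:
  assumes run: "run 3 Q \<delta> r" and j: "j < 2"
    and k: "\<delta> \<le> k0" "k0 < k1" "k1 \<le> \<delta> + r"
    and const: "\<And>k. k0 \<le> k \<Longrightarrow> k < k1 \<Longrightarrow> low 3 Q j k = m"
    and jump: "k1 < \<delta> + r \<Longrightarrow> low 3 Q j k1 \<noteq> m"
  shows "k1 - k0 \<le> (\<Sum>k=k0..<k1. \<Sum>\<alpha>\<in>{\<alpha> \<in> terms_at 3 Q k. \<alpha> j = low 3 Q j k}. side_weight Q j k \<alpha>)
     + (\<Sum>k=Suc k0..<k1. if low 3 Q 2 k \<noteq> low 3 Q 2 (k - 1) then 1 else 0)"
proof -
  define h where "h = 1 - j"
  have h: "h < 3" "h \<noteq> j" "h \<noteq> 2" "j < 3" "j \<noteq> 2" "1 - j = h" using j unfolding h_def less_2_cases_iff by auto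
  note D = runD[OF run]
  define f where "f k c = (if k < k1 \<and> m + c \<le> k then Q (cellv j m k c) else 0)" for k c
  define \<mu> where "\<mu> = low 3 Q 2"
  define \<nu> where "\<nu> = low 3 Q h"
  define d where "d k = k - m" for k
  have att: "\<exists>c. Q (cellv j m k c) \<noteq> 0 \<and> m + c \<le> k" if kk: "k0 \<le> k" "k < k1" for k
  proof -
    obtain \<alpha> where \<alpha>: "Q \<alpha> \<noteq> 0" "dg 3 \<alpha> = k" "\<alpha> j = m"
      using low_attained[OF run, of k j] const[OF kk] kk k by auto
    then show ?thesis using expo3_cellv[OF j D(1)[OF \<alpha>(1)]] by (intro exI[of _ "\<alpha> 2"]) auto
  qed
  have m: "m \<le> k0" using att[of k0] k by auto
  have supp: "\<mu> k \<le> c \<and> m + c + \<nu> k \<le> k" if "Q (cellv j m k c) \<noteq> 0" "m + c \<le> k" for k c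
    using low_le[of Q "cellv j m k c" 3 2] low_le[of Q "cellv j m k c" 3 h] cellv_simps(1-4)[OF j, of m k c] cellv_simps(5)[OF j that(2)] that h
    unfolding \<mu>_def \<nu>_def by auto
  have corner: "m + \<mu> k \<le> k" if "k0 \<le> k" "k < k1" for k
    using att[OF that] supp by force
  have mono: "low 3 Q i k \<le> low 3 Q i (Suc k)" if "k0 \<le> k" "Suc k < k1" "i < 3" for i k
    by (rule low_mono[OF run]) (use that k in auto)
  have inc: "cellv j m (Suc k) c = (cellv j m k c)(h := Suc (cellv j m k c h))" if "m + c \<le> k" for k c
    using j that h by (auto simp: cellv_def vec3_upd h_def Suc_diff_le less_2_cases_iff)
  have sgn: "0 \<le> Q (cellv j m k (\<mu> k'))" if "k0 \<le> k'" "k' \<le> k" "k < k1" for k k'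
  proof (rule corner_nonneg[OF run _ h(1)])
    have le: "m + \<mu> k' \<le> k" using corner[of k'] that by auto
    show "\<delta> \<le> dg 3 (cellv j m k (\<mu> k'))" using cellv_simps(5)[OF j le] that k by simp
    fix i assume i: "i < 3" "i \<noteq> h"
    have "i = j \<or> i = 2" using i j by (auto simp: h_def)
    moreover have "\<mu> k' \<le> low 3 Q 2 k" unfolding \<mu>_def by (rule low_mono[OF run]) (use that k in auto)
    moreover have "low 3 Q j k = m" using const that by simp
    ultimately show "cellv j m k (\<mu> k') i \<le> low 3 Q i (dg 3 (cellv j m k (\<mu> k')))"
      using cellv_simps[OF j] le by auto
  qed (use cellv_simps(4)[OF j] in auto)
  have top: "Q \<alpha> = 0" if "dg 3 \<alpha> = k1" "\<alpha> j = m" for \<alpha>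
  proof (cases "k1 < \<delta> + r")
    case True
    have "m \<le> low 3 Q j k1"
      using low_mono[OF run, of j "k1 - 1" k1] const[of "k1 - 1"] k True h by simp
    then show ?thesis using low_le[of Q \<alpha> 3 j] jump[OF True] that by force
  next
    case False
    then show ?thesis using D(3)[of \<alpha>] that k by force
  qed
  have fval: "f (Suc k) c = Q (cellv j m (Suc k) c)" if "k0 \<le> k" "k < k1" "m + c \<le> Suc k" for k c
  proof (cases "Suc k < k1")
    case False
    then have "Suc k = k1" using that by simp
    then show ?thesis using top[of "cellv j m (Suc k) c"] cellv_simps[OF j] that by (simp add: f_def)
  qed (use that in \<open>simp add: f_def\<close>)
  have fup: "up1 (f k) c = up 3 Q (cellv j m (Suc k) c)" if kk: "k0 \<le> k" "k < k1" "m + c \<le> Suc k" for k c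
  proof -
    have below: "m \<noteq> 0 \<longrightarrow> Q (cellv j (m - 1) k c) = 0"
      using below_low[where n = 3 and Q = Q and z = j and k = k and \<alpha> = "cellv j (m - 1) k c"]
        cellv_simps(1-4)[OF j, of "m - 1" k c] cellv_simps(5)[OF j, of "m - 1" c k] const[OF kk(1,2)] kk(3) by auto
    show ?thesis
    proof (cases "j = 0")
      case True
      then show ?thesis using below kk unfolding up1_def f_def cellv_def
        by (cases m; cases c) (auto simp: up_vec3 Suc_diff_le)
    next
      case False
      then show ?thesis using below kk unfolding up1_def f_def cellv_def
        by (cases m; cases c) (auto simp: up_vec3 Suc_diff_le)
    qed
  qed
  have "int (k1 - k0) \<le> (\<Sum>k=k0..<k1. \<Sum>c\<le>Suc (d k). front_weight f \<mu> \<nu> d k c)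
     + (\<Sum>k=Suc k0..<k1. of_bool (\<mu> k \<noteq> \<mu> (k - 1)))"
  proof (rule front_bound[OF k(2)])
    show "d (Suc k) = Suc (d k)" if "k0 \<le> k" for k using that m by (simp add: d_def)
    show "\<mu> k \<le> c \<and> c + \<nu> k \<le> d k" if "f k c \<noteq> 0" for k c
      using that supp[of k c] by (auto simp: f_def d_def split: if_splits)
    show "\<exists>c. f k c \<noteq> 0" if "k0 \<le> k" "k < k1" for k using att[OF that] that by (auto simp: f_def)
    show "f k1 c = 0" for c by (simp add: f_def)
    show "\<mu> k \<le> \<mu> (Suc k) \<and> \<nu> k \<le> \<nu> (Suc k)" if "k0 \<le> k" "Suc k < k1" for k
      using mono[OF that] h by (simp add: \<mu>_def \<nu>_def)
    show "0 \<le> f (Suc k) (\<mu> k) \<and> f (Suc k) (\<mu> k) \<le> f k (\<mu> k)" if kk: "k0 \<le> k" "k < k1" for k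
    proof -
      let ?c = "cellv j m k (\<mu> k)"
      have "Q (?c(h := Suc (?c h))) \<le> Q ?c"
      proof (rule corner_le(1)[OF run h(1)])
        show "?c \<in> expo 3" "\<delta> \<le> dg 3 ?c" using cellv_simps[OF j] corner[OF kk] kk k by auto
        fix i assume "i < 3" "i \<noteq> h"
        then have "i = j \<or> i = 2" using j by (auto simp: h_def)
        then show "?c i \<le> low 3 Q i (dg 3 ?c)"
          using cellv_simps[OF j] corner[OF kk] const[OF kk] by (auto simp: \<mu>_def)
      qed
      then show ?thesis
        using sgn[of k k] sgn[of k "Suc k"] kk corner[OF kk] inc[OF corner[OF kk]] by (auto simp: f_def)
    qed
  qed
  also have "(\<Sum>k=k0..<k1. \<Sum>c\<le>Suc (d k). front_weight f \<mu> \<nu> d k c)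
    \<le> (\<Sum>k=k0..<k1. int (\<Sum>\<alpha>\<in>{\<alpha> \<in> terms_at 3 Q k. \<alpha> j = low 3 Q j k}. side_weight Q j k \<alpha>))"
  proof (rule sum_mono)
    fix k assume "k \<in> {k0..<k1}"
    then have kk: "k0 \<le> k" "k < k1" by auto
    let ?C = "{c. c \<le> Suc (d k) \<and> f (Suc k) c \<noteq> up1 (f k) c}"
    let ?A = "{\<alpha> \<in> terms_at 3 Q k. \<alpha> j = low 3 Q j k}"
    have inj: "inj_on (cellv j m (Suc k)) ?C"
      using cellv_simps(1)[OF j] by (metis inj_onI)
    have im: "cellv j m (Suc k) ` ?C \<subseteq> ?A"
    proof clarify
      fix c assume c: "c \<le> Suc (d k)" "f (Suc k) c \<noteq> up1 (f k) c"
      then have "m + c \<le> Suc k" using kk m by (simp add: d_def)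
      then show "cellv j m (Suc k) c \<in> terms_at 3 Q k \<and> cellv j m (Suc k) c j = low 3 Q j k"
        using c(2) fval[OF kk] fup[OF kk] cellv_simps[OF j] const[OF kk] by (auto simp: terms_at_def)
    qed
    have "(\<Sum>c\<le>Suc (d k). front_weight f \<mu> \<nu> d k c) = (\<Sum>c\<in>?C. front_weight f \<mu> \<nu> d k c)"
      by (rule sum.mono_neutral_right) (auto simp: front_weight_def)
    also have "\<dots> = (\<Sum>c\<in>?C. int (side_weight Q j k (cellv j m (Suc k) c)))"
    proof (rule sum.cong)
      fix c assume c: "c \<in> ?C"
      have "Suc k - m - c = low 3 Q h k \<longleftrightarrow> c + \<nu> k = Suc (d k)"
        using c kk m by (auto simp: d_def \<nu>_def)
      then show "front_weight f \<mu> \<nu> d k c = int (side_weight Q j k (cellv j m (Suc k) c))"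
        using c cellv_simps[OF j] h(6) by (auto simp: front_weight_def side_weight_def \<mu>_def)
    qed simp
    also have "\<dots> = (\<Sum>\<alpha>\<in>cellv j m (Suc k) ` ?C. int (side_weight Q j k \<alpha>))"
      by (simp add: sum.reindex[OF inj])
    also have "\<dots> \<le> (\<Sum>\<alpha>\<in>?A. int (side_weight Q j k \<alpha>))"
      by (rule sum_mono2[OF _ im]) (simp_all add: finite_terms_at)
    finally show "(\<Sum>c\<le>Suc (d k). front_weight f \<mu> \<nu> d k c) \<le> int (\<Sum>\<alpha>\<in>?A. side_weight Q j k \<alpha>)"
      by simp
  qed
  finally have "int (k1 - k0) \<le> int ((\<Sum>k=k0..<k1. \<Sum>\<alpha>\<in>{\<alpha> \<in> terms_at 3 Q k. \<alpha> j = low 3 Q j k}. side_weight Q j k \<alpha>)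
     + (\<Sum>k=Suc k0..<k1. if low 3 Q 2 k \<noteq> low 3 Q 2 (k - 1) then 1 else 0))"
    by (simp add: \<mu>_def of_bool_def if_distrib[where f = int] del: of_nat_diff cong: if_cong)
  then show ?thesis by linarith
qed

lemma front3:
  assumes run: "run 3 Q \<delta> r" and j: "j < 2"
  shows "r \<le> (\<Sum>k=\<delta>..<\<delta> + r. \<Sum>\<alpha>\<in>{\<alpha> \<in> terms_at 3 Q k. \<alpha> j = low 3 Q j k}. side_weight Q j k \<alpha>) + jumps 3 Q \<delta> r 2"
proof -
  let ?S = "\<lambda>k. \<Sum>\<alpha>\<in>{\<alpha> \<in> terms_at 3 Q k. \<alpha> j = low 3 Q j k}. side_weight Q j k \<alpha>"
  let ?J = "\<lambda>k. if \<delta> < k \<and> low 3 Q 2 k \<noteq> low 3 Q 2 (k - 1) then 1 else 0 :: nat"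
  have "1 * (\<delta> + r - \<delta>) + 0 * Suc (card {k \<in> {\<delta><..<\<delta> + r}. low 3 Q j k \<noteq> low 3 Q j (k - 1)})
    \<le> (\<Sum>k=\<delta>..<\<delta> + r. ?S k + ?J k)"
  proof (rule intervals)
    show "\<delta> < \<delta> + r" using run_pos[OF run] by simp
    fix k0 k1 assume k: "\<delta> \<le> k0" "k0 < k1" "k1 \<le> \<delta> + r"
      "\<And>k. k0 \<le> k \<Longrightarrow> k < k1 \<Longrightarrow> low 3 Q j k = low 3 Q j k0" "k1 < \<delta> + r \<Longrightarrow> low 3 Q j k1 \<noteq> low 3 Q j k0"
    have "k1 - k0 \<le> (\<Sum>k=k0..<k1. ?S k) + (\<Sum>k=Suc k0..<k1. if low 3 Q 2 k \<noteq> low 3 Q 2 (k - 1) then 1 else 0)"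
      by (rule front3_step[OF run j k(1-3), where m = "low 3 Q j k0"]) (use k(4,5) in blast)+
    also have "(\<Sum>k=Suc k0..<k1. if low 3 Q 2 k \<noteq> low 3 Q 2 (k - 1) then 1 else 0) = (\<Sum>k=Suc k0..<k1. ?J k)"
      by (rule sum.cong) (use k(1) in auto)
    also have "\<dots> \<le> (\<Sum>k=k0..<k1. ?J k)" by (rule sum_mono2) auto
    finally show "1 * (k1 - k0) + 0 \<le> (\<Sum>k=k0..<k1. ?S k + ?J k)" by (simp add: sum.distrib)
  qed
  moreover have "(\<Sum>k=\<delta>..<\<delta> + r. ?J k) = jumps 3 Q \<delta> r 2"
    unfolding jumps_def by (subst sum_if_card) (auto intro: arg_cong[where f = card])
  ultimately show ?thesis by (simp add: sum.distrib)
qed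

text \<open>
Terms with more than the lowest exponent of the third variable.  Both fronts of the other two
variables see only such terms, and a term has weight at most two in total: if it lies on both
fronts, it has weight one on each.
\<close>

lemma behind3:
  assumes run: "run 3 Q \<delta> r"
  shows "r \<le> (\<Sum>k=\<delta>..<\<delta> + r. card {\<alpha> \<in> terms_at 3 Q k. low 3 Q 2 k < \<alpha> 2}) + jumps 3 Q \<delta> r 2"
proof -
  let ?S = "\<lambda>j k. \<Sum>\<alpha>\<in>{\<alpha> \<in> terms_at 3 Q k. \<alpha> j = low 3 Q j k}. side_weight Q j k \<alpha>"
  have "?S 0 k + ?S 1 k \<le> 2 * card {\<alpha> \<in> terms_at 3 Q k. low 3 Q 2 k < \<alpha> 2}" if "\<delta> \<le> k" for k
  proof -
    let ?T = "terms_at 3 Q k"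
    have "?S j k = (\<Sum>\<alpha>\<in>?T. if \<alpha> j = low 3 Q j k then side_weight Q j k \<alpha> else 0)" for j
      by (simp add: sum.inter_filter finite_terms_at)
    then have "?S 0 k + ?S 1 k = (\<Sum>\<alpha>\<in>?T. (if \<alpha> 0 = low 3 Q 0 k then side_weight Q 0 k \<alpha> else 0)
        + (if \<alpha> 1 = low 3 Q 1 k then side_weight Q 1 k \<alpha> else 0))"
      by (simp add: sum.distrib del: One_nat_def)
    also have "\<dots> \<le> (\<Sum>\<alpha>\<in>?T. 2 * (if low 3 Q 2 k < \<alpha> 2 then 1 else 0))"
    proof (rule sum_mono)
      fix \<alpha> assume "\<alpha> \<in> ?T"
      then have "low 3 Q 2 k \<le> \<alpha> 2" by (intro low_le_term[OF run _ _ that]) auto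
      then show "(if \<alpha> 0 = low 3 Q 0 k then side_weight Q 0 k \<alpha> else 0)
        + (if \<alpha> 1 = low 3 Q 1 k then side_weight Q 1 k \<alpha> else 0) \<le> 2 * (if low 3 Q 2 k < \<alpha> 2 then 1 else 0)"
        by (auto simp: side_weight_def)
    qed
    also have "\<dots> = 2 * card {\<alpha> \<in> ?T. low 3 Q 2 k < \<alpha> 2}"
      unfolding sum_distrib_left[symmetric] by (simp add: sum_if_card finite_terms_at)
    finally show ?thesis .
  qed
  then have "(\<Sum>k=\<delta>..<\<delta> + r. ?S 0 k) + (\<Sum>k=\<delta>..<\<delta> + r. ?S 1 k)
     \<le> 2 * (\<Sum>k=\<delta>..<\<delta> + r. card {\<alpha> \<in> terms_at 3 Q k. low 3 Q 2 k < \<alpha> 2})"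
    unfolding sum_distrib_left sum.distrib[symmetric] by (intro sum_mono) auto
  then show ?thesis using front3[OF run, of 0] front3[OF run, of 1] by simp
qed

section \<open>Merging variables and the bound for at least three variables\<close>

definition push :: "nat \<Rightarrow> nat \<Rightarrow> (nat \<Rightarrow> nat) \<Rightarrow> (nat \<Rightarrow> nat) \<Rightarrow> nat \<Rightarrow> nat" where
  "push n m \<phi> \<alpha> j = (if j < m then \<Sum>i\<in>{i. i < n \<and> \<phi> i = j}. \<alpha> i else 0)"

text \<open>
The weights of the variables that are merged into one sum up to one.
\<close>

definition share :: "nat \<Rightarrow> (nat \<Rightarrow> nat) \<Rightarrow> nat \<Rightarrow> real" where
  "share n \<phi> i = 1 / real (card {i'. i' < n \<and> \<phi> i' = \<phi> i})"

definition wt :: "nat \<Rightarrow> (nat \<Rightarrow> real) \<Rightarrow> (nat \<Rightarrow> nat) \<Rightarrow> real" where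
  "wt n w \<alpha> = (\<Prod>i<n. w i ^ \<alpha> i)"

definition fibre :: "nat \<Rightarrow> nat \<Rightarrow> (nat \<Rightarrow> nat) \<Rightarrow> (nat \<Rightarrow> nat) \<Rightarrow> (nat \<Rightarrow> nat) set" where
  "fibre n m \<phi> \<beta> = {\<alpha> \<in> expo n. push n m \<phi> \<alpha> = \<beta>}"

text \<open>
The substitution \<open>x_i = share i * y_(\<phi> i)\<close> in a polynomial, by coefficients.  It turns the sum
of the variables \<open>x\<close> into the sum of the variables \<open>y\<close>.
\<close>

definition merge :: "nat \<Rightarrow> nat \<Rightarrow> (nat \<Rightarrow> nat) \<Rightarrow> ((nat \<Rightarrow> nat) \<Rightarrow> real) \<Rightarrow> (nat \<Rightarrow> nat) \<Rightarrow> real" where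
  "merge n m \<phi> Q \<beta> = (\<Sum>\<alpha>\<in>fibre n m \<phi> \<beta>. wt n (share n \<phi>) \<alpha> * Q \<alpha>)"

lemma push_expo: "push n m \<phi> \<alpha> \<in> expo m"
  by (simp add: push_def expo_def)

lemma share_pos: "i < n \<Longrightarrow> share n \<phi> i > 0"
  unfolding share_def by (auto simp: card_gt_0_iff)

lemma wt_pos: "wt n (share n \<phi>) \<alpha> > 0"
  unfolding wt_def by (rule prod_pos) (simp add: share_pos)

lemma dg_push:
  assumes "\<And>i. i < n \<Longrightarrow> \<phi> i < m"
  shows "dg m (push n m \<phi> \<alpha>) = dg n \<alpha>"
proof -
  have "(\<Sum>j<m. \<Sum>i\<in>{i \<in> {..<n}. \<phi> i = j}. \<alpha> i) = (\<Sum>i<n. \<alpha> i)"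
    by (rule sum.group) (use assms in auto)
  then show ?thesis by (simp add: dg_def push_def)
qed

lemma finite_fibre:
  assumes "\<And>i. i < n \<Longrightarrow> \<phi> i < m"
  shows "finite (fibre n m \<phi> \<beta>)"
  by (rule finite_subset[OF _ finite_expo[of n "dg m \<beta>"]]) (use dg_push[OF assms] in \<open>auto simp: fibre_def\<close>)

lemma push_upd:
  assumes "i < n" "\<phi> i < m"
  shows "push n m \<phi> (\<alpha>(i := x)) = (push n m \<phi> \<alpha>)(\<phi> i := push n m \<phi> \<alpha> (\<phi> i) - \<alpha> i + x)"
proof
  fix j
  have fin: "finite {i'. i' < n \<and> \<phi> i' = j}" by simp
  show "push n m \<phi> (\<alpha>(i := x)) j = ((push n m \<phi> \<alpha>)(\<phi> i := push n m \<phi> \<alpha> (\<phi> i) - \<alpha> i + x)) j"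
  proof (cases "j = \<phi> i")
    case True
    let ?I = "{i'. i' < n \<and> \<phi> i' = j}"
    have mem: "i \<in> ?I" using True assms by simp
    have "sum \<alpha> ?I = \<alpha> i + sum \<alpha> (?I - {i})" by (rule sum.remove[OF fin mem])
    moreover have "sum (\<alpha>(i := x)) ?I = (\<alpha>(i := x)) i + sum (\<alpha>(i := x)) (?I - {i})"
      by (rule sum.remove[OF fin mem])
    moreover have "sum (\<alpha>(i := x)) (?I - {i}) = sum \<alpha> (?I - {i})" by (rule sum.cong) auto
    ultimately show ?thesis using True assms(2) by (simp add: push_def)
  next
    case False
    then show ?thesis by (auto simp: push_def intro!: sum.cong)
  qed
qed

lemma push_ge: "i < n \<Longrightarrow> \<phi> i < m \<Longrightarrow> \<alpha> i \<le> push n m \<phi> \<alpha> (\<phi> i)"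
  unfolding push_def by (auto intro: member_le_sum)

lemma wt_dec: "i < n \<Longrightarrow> \<alpha> i \<noteq> 0 \<Longrightarrow> wt n w \<alpha> = w i * wt n w (\<alpha>(i := \<alpha> i - 1))"
  by (cases "\<alpha> i") (simp_all add: wt_def prod.remove[of "{..<n}" i])

lemma up_fibre:
  fixes w :: "nat \<Rightarrow> real"
  assumes \<phi>: "\<And>i. i < n \<Longrightarrow> \<phi> i < m"
  shows "(\<Sum>\<alpha>\<in>fibre n m \<phi> \<beta>. wt n w \<alpha> * up n Q \<alpha>)
    = (\<Sum>i<n. w i * (if \<beta> (\<phi> i) = 0 then 0 else \<Sum>\<gamma>\<in>fibre n m \<phi> (\<beta>(\<phi> i := \<beta> (\<phi> i) - 1)). wt n w \<gamma> * Q \<gamma>))"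
proof -
  have one: "(\<Sum>\<alpha>\<in>fibre n m \<phi> \<beta>. wt n w \<alpha> * (if \<alpha> i = 0 then 0 else Q (\<alpha>(i := \<alpha> i - 1))))
      = w i * (if \<beta> (\<phi> i) = 0 then 0 else \<Sum>\<gamma>\<in>fibre n m \<phi> (\<beta>(\<phi> i := \<beta> (\<phi> i) - 1)). wt n w \<gamma> * Q \<gamma>)"
    if i: "i < n" for i
  proof -
    let ?F = "{\<alpha> \<in> fibre n m \<phi> \<beta>. \<alpha> i \<noteq> 0}"
    have "(\<Sum>\<alpha>\<in>fibre n m \<phi> \<beta>. wt n w \<alpha> * (if \<alpha> i = 0 then 0 else Q (\<alpha>(i := \<alpha> i - 1))))
        = (\<Sum>\<alpha>\<in>?F. w i * (wt n w (\<alpha>(i := \<alpha> i - 1)) * Q (\<alpha>(i := \<alpha> i - 1))))"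
      by (rule sum.mono_neutral_cong_right) (use finite_fibre[OF \<phi>] wt_dec[OF i] in auto)
    also have "\<dots> = w i * (if \<beta> (\<phi> i) = 0 then 0 else \<Sum>\<gamma>\<in>fibre n m \<phi> (\<beta>(\<phi> i := \<beta> (\<phi> i) - 1)). wt n w \<gamma> * Q \<gamma>)"
    proof (cases "\<beta> (\<phi> i) = 0")
      case True
      then have "\<alpha> i = 0" if "\<alpha> \<in> fibre n m \<phi> \<beta>" for \<alpha>
        using push_ge[of i n \<phi> m \<alpha>] i \<phi>[OF i] that by (simp add: fibre_def)
      then have empty: "?F = {}" by auto
      show ?thesis unfolding empty True by simp
    next
      case False
      have "(\<Sum>\<alpha>\<in>?F. wt n w (\<alpha>(i := \<alpha> i - 1)) * Q (\<alpha>(i := \<alpha> i - 1)))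
          = (\<Sum>\<gamma>\<in>fibre n m \<phi> (\<beta>(\<phi> i := \<beta> (\<phi> i) - 1)). wt n w \<gamma> * Q \<gamma>)"
      proof (rule sum.reindex_bij_witness[of _ "\<lambda>\<gamma>. \<gamma>(i := Suc (\<gamma> i))" "\<lambda>\<alpha>. \<alpha>(i := \<alpha> i - 1)"])
        fix \<alpha> assume \<alpha>: "\<alpha> \<in> ?F"
        then have "\<alpha> i \<le> \<beta> (\<phi> i)" "push n m \<phi> \<alpha> = \<beta>" using push_ge[of i n \<phi> m \<alpha>] i \<phi>[OF i] by (auto simp: fibre_def)
        then show "\<alpha>(i := \<alpha> i - 1) \<in> fibre n m \<phi> (\<beta>(\<phi> i := \<beta> (\<phi> i) - 1))"
          using \<alpha> i \<phi>[OF i] push_upd[of i n \<phi> m \<alpha> "\<alpha> i - 1"] by (auto simp: fibre_def expo_upd)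
      next
        fix \<gamma> assume \<gamma>: "\<gamma> \<in> fibre n m \<phi> (\<beta>(\<phi> i := \<beta> (\<phi> i) - 1))"
        then have "\<gamma> i \<le> \<beta> (\<phi> i) - 1" "push n m \<phi> \<gamma> = \<beta>(\<phi> i := \<beta> (\<phi> i) - 1)"
          using push_ge[of i n \<phi> m \<gamma>] i \<phi>[OF i] by (auto simp: fibre_def)
        then have "push n m \<phi> (\<gamma>(i := Suc (\<gamma> i))) = \<beta>"
          using i \<phi>[OF i] push_upd[of i n \<phi> m \<gamma> "Suc (\<gamma> i)"] False by auto
        then show "\<gamma>(i := Suc (\<gamma> i)) \<in> ?F" using \<gamma> i by (auto simp: fibre_def expo_upd)
      qed auto
      then show ?thesis using False unfolding sum_distrib_left[symmetric] by simp
    qed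
    finally show ?thesis .
  qed
  have "(\<Sum>\<alpha>\<in>fibre n m \<phi> \<beta>. wt n w \<alpha> * up n Q \<alpha>)
    = (\<Sum>i<n. \<Sum>\<alpha>\<in>fibre n m \<phi> \<beta>. wt n w \<alpha> * (if \<alpha> i = 0 then 0 else Q (\<alpha>(i := \<alpha> i - 1))))"
    unfolding up_def sum_distrib_left by (rule sum.swap)
  also have "\<dots> = (\<Sum>i<n. w i * (if \<beta> (\<phi> i) = 0 then 0 else \<Sum>\<gamma>\<in>fibre n m \<phi> (\<beta>(\<phi> i := \<beta> (\<phi> i) - 1)). wt n w \<gamma> * Q \<gamma>))"
    by (rule sum.cong) (use one in auto)
  finally show ?thesis .
qed

lemma up_merge:
  assumes \<phi>: "\<And>i. i < n \<Longrightarrow> \<phi> i < m" and onto: "\<And>j. j < m \<Longrightarrow> \<exists>i<n. \<phi> i = j"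
  shows "up m (merge n m \<phi> Q) \<beta> = (\<Sum>\<alpha>\<in>fibre n m \<phi> \<beta>. wt n (share n \<phi>) \<alpha> * up n Q \<alpha>)"
proof -
  let ?X = "\<lambda>j. if \<beta> j = 0 then 0 else merge n m \<phi> Q (\<beta>(j := \<beta> j - 1))"
  have "(\<Sum>\<alpha>\<in>fibre n m \<phi> \<beta>. wt n (share n \<phi>) \<alpha> * up n Q \<alpha>) = (\<Sum>i<n. share n \<phi> i * ?X (\<phi> i))"
    unfolding merge_def by (rule up_fibre) (rule \<phi>)
  also have "\<dots> = (\<Sum>j<m. \<Sum>i\<in>{i \<in> {..<n}. \<phi> i = j}. share n \<phi> i * ?X (\<phi> i))"
    by (rule sum.group[symmetric]) (use \<phi> in auto)
  also have "\<dots> = (\<Sum>j<m. ?X j)"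
  proof (rule sum.cong)
    fix j assume j: "j \<in> {..<m}"
    let ?I = "{i \<in> {..<n}. \<phi> i = j}"
    have "?I = {i. i < n \<and> \<phi> i = j}" by auto
    then have "(\<Sum>i\<in>?I. share n \<phi> i * ?X (\<phi> i)) = (\<Sum>i\<in>?I. (1 / real (card ?I)) * ?X j)"
      by (intro sum.cong) (auto simp: share_def)
    also have "\<dots> = ?X j"
    proof -
      have "?I \<noteq> {}" using onto[of j] j by auto
      then have "real (card ?I) \<noteq> 0" by (simp add: card_gt_0_iff)
      then show ?thesis by simp
    qed
    finally show "(\<Sum>i\<in>?I. share n \<phi> i * ?X (\<phi> i)) = ?X j" .
  qed simp
  finally show ?thesis by (simp add: up_def)
qed

lemma merge_diff:
  assumes \<phi>: "\<And>i. i < n \<Longrightarrow> \<phi> i < m" and onto: "\<And>j. j < m \<Longrightarrow> \<exists>i<n. \<phi> i = j"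
  shows "up m (merge n m \<phi> Q) \<beta> - merge n m \<phi> Q \<beta> = (\<Sum>\<alpha>\<in>fibre n m \<phi> \<beta>. wt n (share n \<phi>) \<alpha> * (up n Q \<alpha> - Q \<alpha>))"
  using up_merge[OF assms, of Q \<beta>] by (simp add: merge_def[of n m \<phi> Q \<beta>] right_diff_distrib sum_subtractf)

text \<open>
The discrepancies have nonnegative coefficients and the shares are positive, so terms cannot cancel in a
merge.
\<close>

lemma merge_terms:
  assumes run: "run n Q \<delta> r" and \<phi>: "\<And>i. i < n \<Longrightarrow> \<phi> i < m" and onto: "\<And>j. j < m \<Longrightarrow> \<exists>i<n. \<phi> i = j" and k: "\<delta> \<le> k"
  shows "terms_at m (merge n m \<phi> Q) k = push n m \<phi> ` terms_at n Q k"
proof -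
  note D = runD[OF run]
  have "up m (merge n m \<phi> Q) \<beta> \<noteq> merge n m \<phi> Q \<beta> \<longleftrightarrow> (\<exists>\<alpha>\<in>fibre n m \<phi> \<beta>. up n Q \<alpha> \<noteq> Q \<alpha>)"
    if \<beta>: "\<beta> \<in> expo m" "dg m \<beta> = Suc k" for \<beta>
  proof -
    have nn: "0 \<le> wt n (share n \<phi>) \<alpha> * (up n Q \<alpha> - Q \<alpha>)" if "\<alpha> \<in> fibre n m \<phi> \<beta>" for \<alpha>
    proof -
      have "dg n \<alpha> = Suc k" using that dg_push[of n \<phi> m \<alpha>] \<phi> \<beta> by (auto simp: fibre_def)
      then have "Q \<alpha> \<le> up n Q \<alpha>" using D(4)[of \<alpha>] that k by (simp add: fibre_def)
      then show ?thesis using wt_pos[of n \<phi> \<alpha>] by simp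
    qed
    have "up m (merge n m \<phi> Q) \<beta> = merge n m \<phi> Q \<beta> \<longleftrightarrow> (\<Sum>\<alpha>\<in>fibre n m \<phi> \<beta>. wt n (share n \<phi>) \<alpha> * (up n Q \<alpha> - Q \<alpha>)) = 0"
      using merge_diff[OF \<phi> onto, where Q = Q and \<beta> = \<beta>] by auto
    also have "\<dots> \<longleftrightarrow> (\<forall>\<alpha>\<in>fibre n m \<phi> \<beta>. wt n (share n \<phi>) \<alpha> * (up n Q \<alpha> - Q \<alpha>) = 0)"
      by (rule sum_nonneg_eq_0_iff[OF finite_fibre[OF \<phi>] nn])
    finally show ?thesis using wt_pos[of n \<phi>] by (auto simp: less_le)
  qed
  note iff = this
  have dg: "dg m (push n m \<phi> \<alpha>) = dg n \<alpha>" for \<alpha> by (rule dg_push[OF \<phi>])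
  show ?thesis
  proof (intro equalityI subsetI)
    fix \<beta> assume "\<beta> \<in> terms_at m (merge n m \<phi> Q) k"
    then have \<beta>: "\<beta> \<in> expo m" "dg m \<beta> = Suc k" "up m (merge n m \<phi> Q) \<beta> \<noteq> merge n m \<phi> Q \<beta>"
      by (simp_all add: terms_at_def)
    then obtain \<alpha> where "\<alpha> \<in> fibre n m \<phi> \<beta>" "up n Q \<alpha> \<noteq> Q \<alpha>" using iff[OF \<beta>(1,2)] by blast
    then have "\<alpha> \<in> terms_at n Q k" "push n m \<phi> \<alpha> = \<beta>" using dg[of \<alpha>] \<beta>(2) by (auto simp: fibre_def terms_at_def)
    then show "\<beta> \<in> push n m \<phi> ` terms_at n Q k" by blast
  next
    fix \<beta> assume "\<beta> \<in> push n m \<phi> ` terms_at n Q k"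
    then obtain \<alpha> where \<alpha>: "\<alpha> \<in> terms_at n Q k" "\<beta> = push n m \<phi> \<alpha>" by blast
    then have "\<beta> \<in> expo m" "dg m \<beta> = Suc k" using dg[of \<alpha>] push_expo by (simp_all add: terms_at_def)
    moreover have "\<alpha> \<in> fibre n m \<phi> \<beta>" "up n Q \<alpha> \<noteq> Q \<alpha>" using \<alpha> by (simp_all add: fibre_def terms_at_def)
    ultimately show "\<beta> \<in> terms_at m (merge n m \<phi> Q) k" using iff by (auto simp: terms_at_def)
  qed
qed

lemma merge_run:
  assumes run: "run n Q \<delta> r" and \<phi>: "\<And>i. i < n \<Longrightarrow> \<phi> i < m" and onto: "\<And>j. j < m \<Longrightarrow> \<exists>i<n. \<phi> i = j"
  shows "run m (merge n m \<phi> Q) \<delta> r"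
  unfolding run_def
proof (intro conjI allI impI)
  note D = runD[OF run]
  fix \<beta>
  have ex: "\<exists>\<alpha>. Q \<alpha> \<noteq> 0 \<and> push n m \<phi> \<alpha> = \<beta>" if "merge n m \<phi> Q \<beta> \<noteq> 0"
  proof (rule ccontr)
    assume no: "\<not> ?thesis"
    have "merge n m \<phi> Q \<beta> = 0"
      unfolding merge_def by (rule sum.neutral) (use no in \<open>auto simp: fibre_def\<close>)
    then show False using that by simp
  qed
  have dg: "dg m (push n m \<phi> \<alpha>) = dg n \<alpha>" for \<alpha> by (rule dg_push[OF \<phi>])
  show "merge n m \<phi> Q \<beta> \<noteq> 0 \<Longrightarrow> \<beta> \<in> expo m" "merge n m \<phi> Q \<beta> \<noteq> 0 \<Longrightarrow> \<delta> \<le> dg m \<beta>"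
    "merge n m \<phi> Q \<beta> \<noteq> 0 \<Longrightarrow> dg m \<beta> < \<delta> + r"
    using ex D(1-3) dg push_expo[of n m \<phi>] by force+
  assume \<beta>: "\<beta> \<in> expo m" "\<delta> < dg m \<beta>"
  have "0 \<le> (\<Sum>\<alpha>\<in>fibre n m \<phi> \<beta>. wt n (share n \<phi>) \<alpha> * (up n Q \<alpha> - Q \<alpha>))"
  proof (rule sum_nonneg)
    fix \<alpha> assume "\<alpha> \<in> fibre n m \<phi> \<beta>"
    then have "\<alpha> \<in> expo n" "\<delta> < dg n \<alpha>" using \<beta> dg_push[of n \<phi> m \<alpha>] \<phi> by (auto simp: fibre_def)
    then show "0 \<le> wt n (share n \<phi>) \<alpha> * (up n Q \<alpha> - Q \<alpha>)" using D(4) wt_pos[of n \<phi> \<alpha>] by simp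
  qed
  then show "merge n m \<phi> Q \<beta> \<le> up m (merge n m \<phi> Q) \<beta>"
    using merge_diff[OF \<phi> onto, where Q = Q and \<beta> = \<beta>] by linarith
next
  note D = runD[OF run]
  obtain \<alpha> where \<alpha>: "\<alpha> \<in> expo n" "dg n \<alpha> = \<delta> + r" "up n Q \<alpha> \<noteq> 0" using run by (auto simp: run_def)
  define k where "k = \<delta> + r - 1"
  have k: "\<delta> \<le> k" "Suc k = \<delta> + r" using run_pos[OF run] by (auto simp: k_def)
  have "Q \<alpha> = 0" using D(3)[of \<alpha>] \<alpha>(2) by force
  then have "\<alpha> \<in> terms_at n Q k" using \<alpha> k by (simp add: terms_at_def)
  then have "push n m \<phi> \<alpha> \<in> terms_at m (merge n m \<phi> Q) k" using merge_terms[OF run \<phi> onto k(1)] by blast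
  moreover have "merge n m \<phi> Q (push n m \<phi> \<alpha>) = 0"
    unfolding merge_def
  proof (rule sum.neutral, rule ballI)
    fix \<gamma> assume "\<gamma> \<in> fibre n m \<phi> (push n m \<phi> \<alpha>)"
    then have "dg n \<gamma> = \<delta> + r" using dg_push[of n \<phi> m] \<phi> \<alpha>(2) unfolding fibre_def by (metis (mono_tags, lifting) mem_Collect_eq)
    then show "wt n (share n \<phi>) \<gamma> * Q \<gamma> = 0" using D(3)[of \<gamma>] by force
  qed
  ultimately show "\<exists>\<alpha>\<in>expo m. dg m \<alpha> = \<delta> + r \<and> up m (merge n m \<phi> Q) \<alpha> \<noteq> 0"
    using k by (auto simp: terms_at_def)
qed

text \<open>
Forms may lose coefficients by cancellation, so the lowest exponent of a variable that is merged with no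
other is recovered from the terms, by \<open>low_ge\<close>.
\<close>

lemma merge_low:
  assumes run: "run n Q \<delta> r" and \<phi>: "\<And>i. i < n \<Longrightarrow> \<phi> i < m" and onto: "\<And>j. j < m \<Longrightarrow> \<exists>i<n. \<phi> i = j"
    and n: "n \<ge> 2" "m \<ge> 2" and z: "z < n" "\<And>i. i < n \<Longrightarrow> \<phi> i = \<phi> z \<Longrightarrow> i = z" and k: "\<delta> \<le> k" "k < \<delta> + r"
  shows "low m (merge n m \<phi> Q) (\<phi> z) k = low n Q z k"
proof (rule antisym)
  have push: "push n m \<phi> \<alpha> (\<phi> z) = \<alpha> z" for \<alpha>
  proof -
    have "{i. i < n \<and> \<phi> i = \<phi> z} = {z}" using z by auto
    then show ?thesis using \<phi>[OF z(1)] by (simp add: push_def)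
  qed
  note mrun = merge_run[OF run \<phi> onto]
  show "low m (merge n m \<phi> Q) (\<phi> z) k \<le> low n Q z k"
  proof (rule low_ge[OF run n(1) z(1) k])
    fix k' \<alpha> assume "k \<le> k'" "\<alpha> \<in> terms_at n Q k'"
    then have "push n m \<phi> \<alpha> \<in> terms_at m (merge n m \<phi> Q) k'" using merge_terms[OF run \<phi> onto, of k'] k by auto
    then show "low m (merge n m \<phi> Q) (\<phi> z) k \<le> \<alpha> z"
      using low_le_term[OF mrun n(2) \<phi>[OF z(1)] k(1) _ \<open>k \<le> k'\<close>] push by metis
  qed
  show "low n Q z k \<le> low m (merge n m \<phi> Q) (\<phi> z) k"
  proof (rule low_ge[OF mrun n(2) \<phi>[OF z(1)] k])
    fix k' \<beta> assume "k \<le> k'" "\<beta> \<in> terms_at m (merge n m \<phi> Q) k'"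
    then obtain \<alpha> where "\<alpha> \<in> terms_at n Q k'" "\<beta> = push n m \<phi> \<alpha>" using merge_terms[OF run \<phi> onto, of k'] k by auto
    then show "low n Q z k \<le> \<beta> (\<phi> z)" using low_le_term[OF run n(1) z(1) k(1) _ \<open>k \<le> k'\<close>] push by simp
  qed
qed

text \<open>
Reduction to three variables: the last variable is kept and all others are merged into two.
\<close>

lemma behind:
  assumes run: "run (Suc n) Q \<delta> r" and n: "n \<ge> 2"
  shows "r \<le> (\<Sum>k=\<delta>..<\<delta> + r. card {\<alpha> \<in> terms_at (Suc n) Q k. low (Suc n) Q n k < \<alpha> n}) + jumps (Suc n) Q \<delta> r n"
proof -
  \<comment> \<open>one variable alone, the last one alone, and all others together\<close>
  define \<phi> where "\<phi> i = (if i = 0 then 0 else if i = n then 2 else 1 :: nat)" for i :: nat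
  have \<phi>: "\<phi> i < 3" for i by (simp add: \<phi>_def)
  have onto: "\<exists>i<Suc n. \<phi> i = j" if "j < 3" for j
  proof -
    have "\<phi> 0 = 0" "\<phi> 1 = 1" "\<phi> n = 2" using n by (simp_all add: \<phi>_def)
    moreover have "j = 0 \<or> j = 1 \<or> j = 2" using that by auto
    moreover have "0 < Suc n" "1 < Suc n" "n < Suc n" using n by auto
    ultimately show ?thesis by blast
  qed
  have z: "\<phi> n = 2" "\<And>i. \<phi> i = \<phi> n \<Longrightarrow> i = n" using n by (auto simp: \<phi>_def split: if_splits)
  let ?M = "merge (Suc n) 3 \<phi> Q"
  note mrun = merge_run[OF run \<phi> onto]
  have low: "low 3 ?M 2 k = low (Suc n) Q n k" if "\<delta> \<le> k" "k < \<delta> + r" for k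
    using merge_low[OF run \<phi> onto _ _ _ z(2) that] n z(1) by simp
  have push: "push (Suc n) 3 \<phi> \<alpha> 2 = \<alpha> n" for \<alpha>
  proof -
    have "{i. i < Suc n \<and> \<phi> i = 2} = {n}" using n by (auto simp: \<phi>_def split: if_splits)
    then show ?thesis by (simp add: push_def)
  qed
  have "card {\<beta> \<in> terms_at 3 ?M k. low 3 ?M 2 k < \<beta> 2} \<le> card {\<alpha> \<in> terms_at (Suc n) Q k. low (Suc n) Q n k < \<alpha> n}"
    if k: "\<delta> \<le> k" "k < \<delta> + r" for k
  proof -
    have "{\<beta> \<in> terms_at 3 ?M k. low 3 ?M 2 k < \<beta> 2} \<subseteq> push (Suc n) 3 \<phi> ` {\<alpha> \<in> terms_at (Suc n) Q k. low (Suc n) Q n k < \<alpha> n}"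
      using merge_terms[OF run \<phi> onto k(1)] push low[OF k] by auto
    then have "card {\<beta> \<in> terms_at 3 ?M k. low 3 ?M 2 k < \<beta> 2}
        \<le> card (push (Suc n) 3 \<phi> ` {\<alpha> \<in> terms_at (Suc n) Q k. low (Suc n) Q n k < \<alpha> n})"
      by (rule card_mono[rotated]) (simp add: finite_terms_at)
    also have "\<dots> \<le> card {\<alpha> \<in> terms_at (Suc n) Q k. low (Suc n) Q n k < \<alpha> n}"
      by (rule card_image_le) (simp add: finite_terms_at)
    finally show ?thesis .
  qed
  then have "(\<Sum>k=\<delta>..<\<delta> + r. card {\<beta> \<in> terms_at 3 ?M k. low 3 ?M 2 k < \<beta> 2})
      \<le> (\<Sum>k=\<delta>..<\<delta> + r. card {\<alpha> \<in> terms_at (Suc n) Q k. low (Suc n) Q n k < \<alpha> n})"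
    by (intro sum_mono) simp
  moreover have "jumps 3 ?M \<delta> r 2 = jumps (Suc n) Q \<delta> r n"
    unfolding jumps_def by (rule arg_cong[where f = card]) (use low in auto)
  ultimately show ?thesis
    using behind3[OF mrun] by linarith
qed

text \<open>
Induction on the number of variables.  The terms with the lowest exponent of the last variable belong
to slices, that is, to runs with one variable less, and the additive one in the induction hypothesis counts the
jumps of the lowest exponent.  The other terms supply the missing \<open>r\<close> up to precisely
these jumps.
\<close>

theorem run_terms:
  assumes "run n Q \<delta> r" "n \<ge> 3"
  shows "(n - 1) * r + 1 \<le> (\<Sum>k=\<delta>..<\<delta> + r. card (terms_at n Q k))"
  using assms(2,1)
proof (induction n arbitrary: Q \<delta> r rule: dec_induct)
  case base
  then show ?case using run3_terms by simp
next
  case (step n)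
  note run = step.prems
  let ?F = "\<lambda>k. card {\<alpha> \<in> terms_at (Suc n) Q k. \<alpha> n = low (Suc n) Q n k}"
  let ?B = "\<lambda>k. card {\<alpha> \<in> terms_at (Suc n) Q k. low (Suc n) Q n k < \<alpha> n}"
  have "(n - 1) * (\<delta> + r - \<delta>) + 1 * Suc (card {k \<in> {\<delta><..<\<delta> + r}. low (Suc n) Q n k \<noteq> low (Suc n) Q n (k - 1)})
    \<le> (\<Sum>k=\<delta>..<\<delta> + r. ?F k)"
  proof (rule intervals)
    show "\<delta> < \<delta> + r" using run_pos[OF run] by simp
    fix k0 k1 assume k: "\<delta> \<le> k0" "k0 < k1" "k1 \<le> \<delta> + r"
      "\<And>k. k0 \<le> k \<Longrightarrow> k < k1 \<Longrightarrow> low (Suc n) Q n k = low (Suc n) Q n k0" "k1 < \<delta> + r \<Longrightarrow> low (Suc n) Q n k1 \<noteq> low (Suc n) Q n k0"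
    define m where "m = low (Suc n) Q n k0"
    have n1: "1 \<le> n" using step.hyps by simp
    have const: "low (Suc n) Q n k = m" if "k0 \<le> k" "k < k1" for k using k(4)[OF that] by (simp add: m_def)
    have jump: "k1 < \<delta> + r \<Longrightarrow> low (Suc n) Q n k1 \<noteq> m" using k(5) by (simp add: m_def)
    note S = slice_run[OF run n1 k(1-3) const jump]
    have "(n - 1) * (k1 - k0) + 1 \<le> (\<Sum>k=k0 - m..<k0 - m + (k1 - k0). card (terms_at n (slice n Q m k0 k1) k))"
      by (rule step.IH[OF S(1)])
    also have "\<dots> = (\<Sum>k=k0..<k1. card (terms_at n (slice n Q m k0 k1) (k - m)))"
      by (rule sum.reindex_bij_witness[of _ "\<lambda>k. k - m" "\<lambda>k. k + m"]) (use S(2) k(2) in auto)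
    also have "\<dots> \<le> (\<Sum>k=k0..<k1. ?F k)"
    proof (rule sum_mono)
      fix k assume kk: "k \<in> {k0..<k1}"
      have "inj_on (\<lambda>\<beta>. \<beta>(n := m)) (terms_at n (slice n Q m k0 k1) (k - m))"
      proof (rule inj_onI)
        fix \<beta> \<gamma> assume "\<beta> \<in> terms_at n (slice n Q m k0 k1) (k - m)" "\<gamma> \<in> terms_at n (slice n Q m k0 k1) (k - m)"
          and eq: "\<beta>(n := m) = \<gamma>(n := m)"
        then have "\<beta> n = \<gamma> n" by (simp add: terms_at_def expo_def)
        then show "\<beta> = \<gamma>" using eq by (metis fun_upd_triv fun_upd_upd)
      qed
      then show "card (terms_at n (slice n Q m k0 k1) (k - m)) \<le> ?F k"
        by (rule card_inj_on_le) (use S(3)[of k] kk const[of k] finite_terms_at in auto)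
    qed
    finally show "(n - 1) * (k1 - k0) + 1 \<le> (\<Sum>k=k0..<k1. ?F k)" .
  qed
  moreover have "r \<le> (\<Sum>k=\<delta>..<\<delta> + r. ?B k) + jumps (Suc n) Q \<delta> r n"
    by (rule behind[OF run]) (use step.hyps in simp)
  moreover have "(\<Sum>k=\<delta>..<\<delta> + r. ?F k) + (\<Sum>k=\<delta>..<\<delta> + r. ?B k) \<le> (\<Sum>k=\<delta>..<\<delta> + r. card (terms_at (Suc n) Q k))"
  proof -
    have "?F k + ?B k \<le> card (terms_at (Suc n) Q k)" for k
      by (subst card_Un_disjoint[symmetric]) (auto intro!: card_mono simp: finite_terms_at)
    then show ?thesis unfolding sum.distrib[symmetric] by (intro sum_mono) auto
  qed
  moreover have "(Suc n - 1) * r = (n - 1) * r + r" using step.hyps by (cases n) auto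
  ultimately show ?case unfolding jumps_def by simp
qed

section \<open>The bound for two variables\<close>

lemma last_nonzero:
  fixes h :: "nat \<Rightarrow> real"
  assumes "h 0 \<noteq> 0" "h r = 0"
  shows "\<exists>k<r. h k \<noteq> 0 \<and> h (Suc k) = 0"
proof (rule ccontr)
  assume *: "\<not> ?thesis"
  have "h k \<noteq> 0" if "k \<le> r" for k
    using that by (induction k) (use assms(1) * in \<open>auto simp: Suc_le_eq\<close>)
  then show False using assms(2) by blast
qed

lemma vec2_simps: "vec3 a b 0 \<in> expo 2" "dg 2 (vec3 a b 0) = a + b" "(vec3 a b 0)(0 := x) = vec3 x b 0"
  "(vec3 a b 0)(Suc 0 := x) = vec3 a x 0"
  by (auto simp: vec3_def expo_def dg_def eval_nat_numeral fun_eq_iff)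

lemma expo2_eq: "\<alpha> \<in> expo 2 \<Longrightarrow> \<alpha> = vec3 (\<alpha> 0) (\<alpha> 1) 0 \<and> dg 2 \<alpha> = \<alpha> 0 + \<alpha> 1"
  by (auto simp: vec3_def fun_eq_iff expo_def dg_def eval_nat_numeral)

lemma up_vec2: "up 2 Q (vec3 a b 0) = (if a = 0 then 0 else Q (vec3 (a - 1) b 0))
    + (if b = 0 then 0 else Q (vec3 a (b - 1) 0))"
proof -
  have "{..<2::nat} = {0, Suc 0}" by auto
  then show ?thesis by (simp add: up_def vec2_simps)
qed

text \<open>
Counting with weight two inside and weight one at one end, \<open>front_bound\<close> gives \<open>r\<close>.  The powers of the
first variable have weight zero and those of the second weight one there, and since the form of degree zero is a nonzero
constant, at least one term of either kind occurs.  These supply the missing three.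
\<close>

theorem run2_terms:
  assumes run: "run 2 Q 0 r"
  shows "r + 3 \<le> 2 * (\<Sum>k=0..<r. card (terms_at 2 Q k))"
proof -
  note D = runD[OF run]
  define f where "f k c = (if c \<le> k then Q (vec3 (k - c) c 0) else 0)" for k c
  define z where "z = (\<lambda>k :: nat. 0 :: nat)"
  define d where "d = (\<lambda>k :: nat. k)"
  have cell: "\<exists>c. f k c \<noteq> 0" if k: "k < r" for k
  proof -
    obtain \<alpha> where \<alpha>: "Q \<alpha> \<noteq> 0" "dg 2 \<alpha> = k" using run_row_nonzero[OF run, of k] k by auto
    then show ?thesis using expo2_eq[OF D(1)[OF \<alpha>(1)]] by (intro exI[of _ "\<alpha> 1"]) (auto simp: f_def)
  qed
  have rzero: "f r c = 0" for c using D(3)[of "vec3 (r - c) c 0"] by (force simp: f_def vec2_simps)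
  have sign: "0 \<le> Q (vec3 k 0 0)" "Q (vec3 (Suc k) 0 0) \<le> Q (vec3 k 0 0)" for k
  proof -
    have zero: "vec3 k 0 0 i = 0" if "i \<noteq> 0" for i using that by (simp add: vec3_def)
    show "0 \<le> Q (vec3 k 0 0)"
      by (rule corner_nonneg[OF run, where h = 0]) (simp_all add: vec2_simps zero)
    have "Q ((vec3 k 0 0)(0 := Suc (vec3 k 0 0 0))) \<le> Q (vec3 k 0 0)"
      by (rule corner_le(1)[OF run, where h = 0]) (simp_all add: vec2_simps zero)
    then show "Q (vec3 (Suc k) 0 0) \<le> Q (vec3 k 0 0)" by (simp add: vec2_simps)
  qed
  have "int (r - 0) \<le> (\<Sum>k=0..<r. \<Sum>c\<le>Suc (d k). front_weight f z z d k c) + (\<Sum>k=Suc 0..<r. of_bool (z k \<noteq> z (k - 1)))"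
  proof (rule front_bound)
    show "0 < r" by (rule run_pos[OF run])
    show "z k \<le> c \<and> c + z k \<le> d k" if "f k c \<noteq> 0" for k c using that by (auto simp: f_def z_def d_def split: if_splits)
    show "0 \<le> f (Suc k) (z k) \<and> f (Suc k) (z k) \<le> f k (z k)" for k using sign by (simp add: f_def z_def)
  qed (simp_all add: z_def d_def cell rzero)
  then have 1: "int r \<le> (\<Sum>k=0..<r. \<Sum>c\<le>Suc k. front_weight f z z d k c)" by (simp add: z_def d_def)
  define lo where "lo k = (of_bool (f (Suc k) 0 \<noteq> up1 (f k) 0) :: int)" for k
  define hi where "hi k = (of_bool (f (Suc k) (Suc k) \<noteq> up1 (f k) (Suc k)) :: int)" for k
  have tm: "f (Suc k) c = Q (vec3 (Suc k - c) c 0)" "up1 (f k) c = up 2 Q (vec3 (Suc k - c) c 0)" if "c \<le> Suc k" for k c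
    using that unfolding up_vec2 by (auto simp: f_def up1_def Suc_diff_le)
  have row: "(\<Sum>c\<le>Suc k. front_weight f z z d k c) + 2 * lo k + hi k \<le> 2 * int (card (terms_at 2 Q k))" for k
  proof -
    let ?t = "\<lambda>c. of_bool (f (Suc k) c \<noteq> up1 (f k) c) :: int"
    have "(\<Sum>c\<le>Suc k. front_weight f z z d k c) = (\<Sum>c\<in>{1..k}. 2 * ?t c) + hi k"
    proof -
      have "{..Suc k} = insert 0 (insert (Suc k) {1..k})" by auto
      then have "(\<Sum>c\<le>Suc k. front_weight f z z d k c)
          = front_weight f z z d k 0 + (front_weight f z z d k (Suc k) + (\<Sum>c\<in>{1..k}. front_weight f z z d k c))"
        by simp
      moreover have "(\<Sum>c\<in>{1..k}. front_weight f z z d k c) = (\<Sum>c\<in>{1..k}. 2 * ?t c)"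
        by (rule sum.cong) (auto simp: front_weight_def z_def d_def)
      moreover have "front_weight f z z d k 0 = 0" "front_weight f z z d k (Suc k) = hi k"
        by (simp_all add: front_weight_def z_def d_def hi_def)
      ultimately show ?thesis by linarith
    qed
    moreover have "(\<Sum>c\<le>Suc k. 2 * ?t c) = 2 * lo k + (2 * hi k + (\<Sum>c\<in>{1..k}. 2 * ?t c))"
    proof -
      have "{..Suc k} = insert 0 (insert (Suc k) {1..k})" by auto
      then show ?thesis by (simp add: lo_def hi_def del: sum_of_bool_eq)
    qed
    moreover have "(\<Sum>c\<le>Suc k. ?t c) \<le> int (card (terms_at 2 Q k))"
    proof -
      have "card {c \<in> {..Suc k}. f (Suc k) c \<noteq> up1 (f k) c} \<le> card (terms_at 2 Q k)"
      proof (rule card_inj_on_le[where f = "\<lambda>c. vec3 (Suc k - c) c 0"])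
        show "inj_on (\<lambda>c. vec3 (Suc k - c) c 0) {c \<in> {..Suc k}. f (Suc k) c \<noteq> up1 (f k) c}"
          by (rule inj_onI) (metis vec3_simps(2))
        show "finite (terms_at 2 Q k)" by (rule finite_terms_at)
      qed (use tm in \<open>auto simp: terms_at_def vec2_simps\<close>)
      moreover have "(\<Sum>c\<le>Suc k. ?t c) = int (card {c \<in> {..Suc k}. f (Suc k) c \<noteq> up1 (f k) c})"
        by (simp add: Int_def del: sum.atMost_Suc)
      ultimately show ?thesis by linarith
    qed
    moreover have "(\<Sum>c\<le>Suc k. 2 * ?t c) = 2 * (\<Sum>c\<le>Suc k. ?t c)" by (simp only: sum_distrib_left)
    ultimately show ?thesis by linarith
  qed
  have "f 0 0 \<noteq> 0"
  proof -
    obtain c where "f 0 c \<noteq> 0" using cell[OF run_pos[OF run]] by blast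
    then show ?thesis by (simp add: f_def split: if_splits)
  qed
  have "1 \<le> (\<Sum>k=0..<r. lo k)"
  proof -
    obtain k where "k < r" "f k 0 \<noteq> 0" "f (Suc k) 0 = 0" using last_nonzero[of "\<lambda>k. f k 0" r] \<open>f 0 0 \<noteq> 0\<close> rzero by blast
    then have "lo k = 1" by (simp add: lo_def up1_def)
    moreover have "lo k \<le> (\<Sum>k=0..<r. lo k)" by (rule member_le_sum) (use \<open>k < r\<close> in \<open>simp_all add: lo_def\<close>)
    ultimately show ?thesis by simp
  qed
  moreover have "1 \<le> (\<Sum>k=0..<r. hi k)"
  proof -
    obtain k where "k < r" "f k k \<noteq> 0" "f (Suc k) (Suc k) = 0" using last_nonzero[of "\<lambda>k. f k k" r] \<open>f 0 0 \<noteq> 0\<close> rzero by blast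
    then have "hi k = 1" by (simp add: hi_def up1_def f_def)
    moreover have "hi k \<le> (\<Sum>k=0..<r. hi k)" by (rule member_le_sum) (use \<open>k < r\<close> in \<open>simp_all add: hi_def\<close>)
    ultimately show ?thesis by simp
  qed
  moreover have "(\<Sum>k=0..<r. \<Sum>c\<le>Suc k. front_weight f z z d k c) + 2 * (\<Sum>k=0..<r. lo k) + (\<Sum>k=0..<r. hi k)
      \<le> 2 * int (\<Sum>k=0..<r. card (terms_at 2 Q k))"
    unfolding of_nat_sum sum_distrib_left sum.distrib[symmetric] by (rule sum_mono) (use row in \<open>simp add: sum_distrib_left\<close>)
  ultimately have "int (r + 3) \<le> int (2 * (\<Sum>k=0..<r. card (terms_at 2 Q k)))" using 1 by simp
  then show ?thesis by linarith
qed

section \<open>From polynomials that are constant on the simplex to runs\<close>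

text \<open>
The homogeneous parts of \<open>(P - 1) / (s - 1)\<close>, where \<open>s\<close> is the sum of the variables, from the comparison
\<open>s * q_k - q_(k+1) = p_(k+1)\<close> of homogeneous parts.
\<close>

primrec quot :: "nat \<Rightarrow> ((nat \<Rightarrow> nat) \<Rightarrow> real) \<Rightarrow> nat \<Rightarrow> (nat \<Rightarrow> nat) \<Rightarrow> real" where
  "quot n P 0 \<alpha> = (if \<alpha> \<in> expo n \<and> dg n \<alpha> = 0 then 1 - P \<alpha> else 0)"
| "quot n P (Suc k) \<alpha> = (if \<alpha> \<in> expo n \<and> dg n \<alpha> = Suc k then up n (quot n P k) \<alpha> - P \<alpha> else 0)"

definition level :: "nat \<Rightarrow> nat \<Rightarrow> (nat \<Rightarrow> nat) set" where
  "level n k = {\<alpha> \<in> expo n. dg n \<alpha> = k}"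

lemma finite_level: "finite (level n k)"
  unfolding level_def by (rule finite_expo)

text \<open>
Merging all variables into one yields all exponents of a given degree.
\<close>

lemma fibre_level: "fibre n 1 (\<lambda>_. 0) (vec3 k 0 0) = level n k"
proof -
  have "push n 1 (\<lambda>_. 0) \<alpha> = vec3 (dg n \<alpha>) 0 0" for \<alpha>
    by (auto simp: push_def vec3_def dg_def fun_eq_iff lessThan_def)
  then show ?thesis by (auto simp: fibre_def level_def) (metis vec3_simps(1))
qed

lemma level_up:
  "(\<Sum>\<alpha>\<in>level n (Suc k). wt n x \<alpha> * up n Q \<alpha>) = (\<Sum>i<n. x i) * (\<Sum>\<alpha>\<in>level n k. wt n x \<alpha> * Q \<alpha>)"
proof -
  have "(\<Sum>\<alpha>\<in>fibre n 1 (\<lambda>_. 0) (vec3 (Suc k) 0 0). wt n x \<alpha> * up n Q \<alpha>)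
    = (\<Sum>i<n. x i * (if vec3 (Suc k) 0 0 0 = 0 then 0
        else \<Sum>\<gamma>\<in>fibre n 1 (\<lambda>_. 0) ((vec3 (Suc k) 0 0)(0 := vec3 (Suc k) 0 0 0 - 1)). wt n x \<gamma> * Q \<gamma>))"
    by (rule up_fibre) simp
  then show ?thesis by (simp add: vec3_upd fibre_level[unfolded One_nat_def] sum_distrib_right)
qed

lemma digits_unique:
  fixes a b :: "nat \<Rightarrow> nat"
  assumes "\<And>i. i < n \<Longrightarrow> a i < B" "\<And>i. i < n \<Longrightarrow> b i < B" "(\<Sum>i<n. a i * B ^ i) = (\<Sum>i<n. b i * B ^ i)"
  shows "\<forall>i<n. a i = b i"
  using assms
proof (induction n arbitrary: a b)
  case (Suc n)
  have split: "(\<Sum>i<Suc n. c i * B ^ i) = c 0 + B * (\<Sum>i<n. c (Suc i) * B ^ i)" for c :: "nat \<Rightarrow> nat"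
    unfolding sum.lessThan_Suc_shift by (simp add: sum_distrib_left algebra_simps)
  have eq: "a 0 + B * (\<Sum>i<n. a (Suc i) * B ^ i) = b 0 + B * (\<Sum>i<n. b (Suc i) * B ^ i)"
    using Suc.prems(3) unfolding split .
  have lt: "a 0 < B" "b 0 < B" using Suc.prems by auto
  have 0: "a 0 = b 0" using arg_cong[OF eq, of "\<lambda>x. x mod B"] lt by simp
  then have "(\<Sum>i<n. a (Suc i) * B ^ i) = (\<Sum>i<n. b (Suc i) * B ^ i)" using eq lt by simp
  then have "\<forall>i<n. a (Suc i) = b (Suc i)" by (intro Suc.IH) (use Suc.prems in auto)
  then show ?case using 0 by (auto simp: less_Suc_eq_0_disj)
qed simp

text \<open>
Kronecker's substitution \<open>x_i = T ^ (B ^ i)\<close> separates the monomials of degree \<open>k < B\<close>.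
\<close>

lemma level_zero:
  assumes "\<And>x. (\<And>i. i < n \<Longrightarrow> 0 < x i) \<Longrightarrow> (\<Sum>\<alpha>\<in>level n k. wt n x \<alpha> * c \<alpha>) = 0" and \<beta>: "\<beta> \<in> level n k"
  shows "c \<beta> = 0"
proof -
  define B where "B = Suc k"
  \<comment> \<open>exponents are digits in base B\<close>
  define code where "code \<alpha> = (\<Sum>i<n. \<alpha> i * B ^ i)" for \<alpha>
  have inj: "\<alpha> = \<beta>" if "\<alpha> \<in> level n k" "code \<alpha> = code \<beta>" for \<alpha>
  proof -
    have lt: "\<gamma> i < B" if "\<gamma> \<in> level n k" "i < n" for \<gamma> i
    proof -
      have "\<gamma> i \<le> dg n \<gamma>" unfolding dg_def using that(2) by (intro member_le_sum) auto
      then show ?thesis using that(1) by (simp add: level_def B_def)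
    qed
    have "\<forall>i<n. \<alpha> i = \<beta> i" by (rule digits_unique[of n \<alpha> B \<beta>]) (use lt that \<beta> in \<open>auto simp: code_def\<close>)
    then show ?thesis using that(1) \<beta> by (auto simp: level_def expo_def fun_eq_iff) (metis not_le)
  qed
  define p where "p = (\<Sum>\<alpha>\<in>level n k. monom (c \<alpha>) (code \<alpha>))"
  have "poly p T = 0" if "T > 0" for T :: real
  proof -
    have "wt n (\<lambda>i. T ^ (B ^ i)) \<alpha> = T ^ code \<alpha>" for \<alpha>
      by (simp add: wt_def code_def power_sum power_mult[symmetric] mult.commute)
    then show ?thesis using assms(1)[of "\<lambda>i. T ^ (B ^ i)"] that
      by (simp add: p_def poly_sum poly_monom mult.commute)
  qed
  then have "{0<..} \<subseteq> {T. poly p T = 0}" by auto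
  then have "infinite {T. poly p T = 0}" using infinite_Ioi[of "0::real"] finite_subset by blast
  then have "p = 0" using poly_roots_finite by blast
  then have "0 = coeff p (code \<beta>)" by simp
  also have "\<dots> = (\<Sum>\<alpha>\<in>level n k. if \<alpha> = \<beta> then c \<beta> else 0)"
    unfolding p_def coeff_sum by (rule sum.cong) (use inj in auto)
  also have "\<dots> = c \<beta>" using \<beta> finite_level by simp
  finally show ?thesis by simp
qed

text \<open>
On the simplex the form \<open>q_k\<close> agrees with \<open>1\<close> minus the part of \<open>P\<close> of degree at most \<open>k\<close>, so \<open>q_d\<close> vanishes there and, being
homogeneous, it vanishes identically.  The forms before it make up a run whose terms are
monomials of \<open>P\<close>.
\<close>

theorem constant_on_simplex_bound:
  fixes P :: "(nat \<Rightarrow> nat) \<Rightarrow> real"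
  assumes n: "n \<ge> 2" and fin: "finite {\<alpha>. P \<alpha> \<noteq> 0}" and ex: "\<And>\<alpha>. P \<alpha> \<noteq> 0 \<Longrightarrow> \<alpha> \<in> expo n" and nn: "\<And>\<alpha>. 0 \<le> P \<alpha>"
    and deg: "\<And>\<alpha>. P \<alpha> \<noteq> 0 \<Longrightarrow> dg n \<alpha> \<le> d" and top: "P \<alpha>0 \<noteq> 0" "dg n \<alpha>0 = d" and "d \<ge> 1"
    and one: "\<And>x. (\<And>i. i < n \<Longrightarrow> 0 < x i) \<Longrightarrow> (\<Sum>i<n. x i) = 1 \<Longrightarrow> (\<Sum>\<alpha> | P \<alpha> \<noteq> 0. P \<alpha> * wt n x \<alpha>) = 1"
  shows "n = 2 \<Longrightarrow> d + 3 \<le> 2 * card {\<alpha>. P \<alpha> \<noteq> 0}" "n \<ge> 3 \<Longrightarrow> (n - 1) * d + 1 \<le> card {\<alpha>. P \<alpha> \<noteq> 0}"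
proof -
  define E where "E k x = (\<Sum>\<alpha>\<in>level n k. wt n x \<alpha> * quot n P k \<alpha>)" for k x
  have E: "E k x = 1 - (\<Sum>j\<le>k. \<Sum>\<alpha>\<in>level n j. wt n x \<alpha> * P \<alpha>)" if "(\<Sum>i<n. x i) = 1" for k x
  proof (induction k)
    case 0
    have "\<alpha> = (\<lambda>_. 0)" if "\<alpha> \<in> level n 0" for \<alpha>
    proof
      fix i show "\<alpha> i = 0" using that by (cases "i < n") (auto simp: level_def expo_def dg_def)
    qed
    then have "level n 0 = {\<lambda>_. 0}" by (auto simp: level_def expo_def dg_def)
    then show ?case by (simp add: E_def wt_def expo_def dg_def)
  next
    case (Suc k)
    have "E (Suc k) x = (\<Sum>\<alpha>\<in>level n (Suc k). wt n x \<alpha> * up n (quot n P k) \<alpha> - wt n x \<alpha> * P \<alpha>)"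
      unfolding E_def by (rule sum.cong) (auto simp: level_def right_diff_distrib)
    then show ?case using Suc level_up[of n x "quot n P k" k] that by (simp add: sum_subtractf E_def)
  qed
  have all: "(\<Sum>j\<le>d. \<Sum>\<alpha>\<in>level n j. wt n x \<alpha> * P \<alpha>) = (\<Sum>\<alpha> | P \<alpha> \<noteq> 0. P \<alpha> * wt n x \<alpha>)" for x
  proof -
    have "(\<Sum>\<alpha> | P \<alpha> \<noteq> 0. P \<alpha> * wt n x \<alpha>) = (\<Sum>j\<le>d. \<Sum>\<alpha>\<in>{\<alpha> \<in> {\<alpha>. P \<alpha> \<noteq> 0}. dg n \<alpha> = j}. P \<alpha> * wt n x \<alpha>)"
      by (rule sum.group[symmetric]) (use fin deg in auto)
    also have "\<dots> = (\<Sum>j\<le>d. \<Sum>\<alpha>\<in>level n j. wt n x \<alpha> * P \<alpha>)"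
    proof (rule sum.cong)
      fix j
      show "(\<Sum>\<alpha>\<in>{\<alpha> \<in> {\<alpha>. P \<alpha> \<noteq> 0}. dg n \<alpha> = j}. P \<alpha> * wt n x \<alpha>) = (\<Sum>\<alpha>\<in>level n j. wt n x \<alpha> * P \<alpha>)"
        by (rule sum.mono_neutral_cong_left) (use ex finite_level in \<open>auto simp: level_def\<close>)
    qed simp
    finally show ?thesis by simp
  qed
  have Ed: "E d x = 0" if pos: "\<And>i. i < n \<Longrightarrow> 0 < x i" for x
  proof -
    define s where "s = (\<Sum>i<n. x i)"
    have "(0::nat) \<in> {..<n}" using n by simp
    then have s: "s > 0" unfolding s_def by (intro sum_pos) (use pos in auto)
    have sc: "wt n (\<lambda>i. x i / s) \<alpha> * s ^ d = wt n x \<alpha>" if "\<alpha> \<in> level n d" for \<alpha>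
    proof -
      have "wt n (\<lambda>i. x i / s) \<alpha> * s ^ dg n \<alpha> = wt n x \<alpha>"
        using s by (simp add: wt_def dg_def power_sum power_divide prod_dividef)
      then show ?thesis using that by (simp add: level_def)
    qed
    have "(\<Sum>i<n. x i / s) = 1" using s by (simp add: s_def flip: sum_divide_distrib)
    then have "E d (\<lambda>i. x i / s) = 0" using E[of "\<lambda>i. x i / s" d] all one[of "\<lambda>i. x i / s"] pos s by simp
    then have "0 = E d (\<lambda>i. x i / s) * s ^ d" by simp
    also have "\<dots> = E d x" unfolding E_def sum_distrib_right
      by (rule sum.cong) (use sc in \<open>auto simp: algebra_simps\<close>)
    finally show ?thesis by simp
  qed
  have zero: "quot n P k \<alpha> = 0" if "d \<le> k" for k \<alpha>
    using that
  proof (induction k arbitrary: \<alpha> rule: dec_induct)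
    case base
    show ?case
    proof (cases "\<alpha> \<in> level n d")
      case True
      then show ?thesis using level_zero[where c = "quot n P d" and k = d and n = n] Ed unfolding E_def by blast
    next
      case False
      then show ?thesis by (cases d) (auto simp: level_def)
    qed
  next
    case (step k)
    have "up n (quot n P k) \<alpha> = 0" by (rule up_zero) (rule step.IH)
    moreover have "dg n \<alpha> = Suc k \<Longrightarrow> P \<alpha> = 0" using deg[of \<alpha>] step.hyps by force
    ultimately show ?case by simp
  qed
  define Q where "Q \<alpha> = quot n P (dg n \<alpha>) \<alpha>" for \<alpha>
  have Qup: "Q \<alpha> = up n Q \<alpha> - P \<alpha>" if "\<alpha> \<in> expo n" "0 < dg n \<alpha>" for \<alpha>
  proof -
    obtain k where k: "dg n \<alpha> = Suc k" using \<open>0 < dg n \<alpha>\<close> by (cases "dg n \<alpha>") auto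
    have "up n Q \<alpha> = up n (quot n P k) \<alpha>"
      unfolding up_def by (rule sum.cong) (use dg_dec[of _ n \<alpha>] k in \<open>auto simp: Q_def\<close>)
    then show ?thesis using that k by (simp add: Q_def)
  qed
  have run: "run n Q 0 d"
    unfolding run_def
  proof (intro conjI allI impI)
    fix \<alpha>
    show "Q \<alpha> \<noteq> 0 \<Longrightarrow> \<alpha> \<in> expo n" unfolding Q_def by (cases "dg n \<alpha>") (auto split: if_splits)
    show "Q \<alpha> \<noteq> 0 \<Longrightarrow> dg n \<alpha> < 0 + d" using zero[of "dg n \<alpha>" \<alpha>] unfolding Q_def by force
    show "\<alpha> \<in> expo n \<Longrightarrow> 0 < dg n \<alpha> \<Longrightarrow> Q \<alpha> \<le> up n Q \<alpha>" using Qup[of \<alpha>] nn[of \<alpha>] by simp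
  next
    have "Q \<alpha>0 = 0" unfolding Q_def by (rule zero) (use top in simp)
    then have "up n Q \<alpha>0 \<noteq> 0" using Qup[of \<alpha>0] ex[OF top(1)] top \<open>d \<ge> 1\<close> by simp
    then show "\<exists>\<alpha>\<in>expo n. dg n \<alpha> = 0 + d \<and> up n Q \<alpha> \<noteq> 0" using ex[OF top(1)] top by auto
  qed simp
  have "(\<Sum>k=0..<d. card (terms_at n Q k)) = card (\<Union>k\<in>{0..<d}. terms_at n Q k)"
    proof (rule card_UN_disjoint[symmetric])
    show "\<forall>k\<in>{0..<d}. finite (terms_at n Q k)" by (simp add: finite_terms_at)
  qed (auto simp: terms_at_def)
  also have "\<dots> \<le> card {\<alpha>. P \<alpha> \<noteq> 0}"
    by (rule card_mono[OF fin]) (use Qup in \<open>auto simp: terms_at_def\<close>)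
  finally have le: "(\<Sum>k=0..<d. card (terms_at n Q k)) \<le> card {\<alpha>. P \<alpha> \<noteq> 0}" .
  show "d + 3 \<le> 2 * card {\<alpha>. P \<alpha> \<noteq> 0}" if "n = 2"
    using run2_terms[of Q d] run le that by simp
  show "(n - 1) * d + 1 \<le> card {\<alpha>. P \<alpha> \<noteq> 0}" if "n \<ge> 3"
    using run_terms[OF run that] le by simp
qed

section \<open>From proper monomial maps to polynomials\<close>

lemma cmod_monomial: "(cmod (monomial n c \<alpha> z))\<^sup>2 = (cmod c)\<^sup>2 * wt n (\<lambda>i. (cmod (z i))\<^sup>2) \<alpha>"
proof -
  have "(cmod (\<Prod>i<n. z i ^ \<alpha> i))\<^sup>2 = (\<Prod>i<n. ((cmod (z i))\<^sup>2) ^ \<alpha> i)"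
    by (simp add: prod_norm[symmetric] norm_power prod_power_distrib power_mult[symmetric] mult.commute)
  then show ?thesis by (simp add: monomial_def norm_mult power_mult_distrib wt_def)
qed

lemma wt_scale: "wt n (\<lambda>i. t * x i) \<alpha> = t ^ dg n \<alpha> * wt n x \<alpha>"
  by (simp add: wt_def dg_def power_mult_distrib prod.distrib power_sum)

lemma wt_nonneg: "(\<And>i. i < n \<Longrightarrow> 0 \<le> x i) \<Longrightarrow> 0 \<le> wt n x \<alpha>"
  unfolding wt_def by (rule prod_nonneg) auto

lemma closed_complex_space: "closed (complex_space n)"
proof -
  have "complex_space n = (\<Inter>i\<in>{n..}. {z. z i = 0})" by (auto simp: complex_space_def)
  moreover have "closed {z :: nat \<Rightarrow> complex. z i = 0}" for i
    by (rule closed_Collect_eq) (auto intro: continuous_intros)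
  ultimately show ?thesis by auto
qed

lemma compact_closed_ball: "compact {z \<in> complex_space n. (\<Sum>i<n. (cmod (z i))\<^sup>2) \<le> s}"
proof -
  define S where "S i = (if i < n then cball (0 :: complex) (sqrt \<bar>s\<bar>) else {0})" for i :: nat
  have "compact (PiE UNIV S)"
  proof -
    have "compactin (product_topology (\<lambda>_. euclidean) UNIV) (PiE UNIV S)"
      by (subst compactin_PiE) (auto simp: S_def)
    then show ?thesis by (simp add: euclidean_product_topology)
  qed
  moreover have "{z \<in> complex_space n. (\<Sum>i<n. (cmod (z i))\<^sup>2) \<le> s}
      = PiE UNIV S \<inter> (complex_space n \<inter> {z. (\<Sum>i<n. (cmod (z i))\<^sup>2) \<le> s})"
  proof -
    have "z \<in> PiE UNIV S" if "z \<in> complex_space n" "(\<Sum>i<n. (cmod (z i))\<^sup>2) \<le> s" for z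
    proof -
      have "cmod (z i) \<le> sqrt \<bar>s\<bar>" if "i < n" for i
      proof -
        have "(cmod (z i))\<^sup>2 \<le> (\<Sum>i<n. (cmod (z i))\<^sup>2)" by (rule member_le_sum) (use that in auto)
        then have "(cmod (z i))\<^sup>2 \<le> \<bar>s\<bar>" using \<open>(\<Sum>i<n. (cmod (z i))\<^sup>2) \<le> s\<close> by linarith
        then show ?thesis by (rule real_le_rsqrt)
      qed
      then show ?thesis using that(1) by (auto simp: S_def complex_space_def)
    qed
    then show ?thesis by blast
  qed
  moreover have "closed {z :: nat \<Rightarrow> complex. (\<Sum>i<n. (cmod (z i))\<^sup>2) \<le> s}"
    by (intro closed_Collect_le continuous_on_sum continuous_on_power continuous_on_norm continuous_on_product_coordinates continuous_on_const)
  ultimately show ?thesis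
    by (simp only:) (intro compact_Int_closed closed_Int closed_complex_space)
qed

text \<open>
On the diagonal a monomial is a constant times a power of one parameter, so two values
of the parameter determine the degree.
\<close>

lemma degree_unique:
  assumes n: "n \<ge> 1" and c: "c \<noteq> 0" and eq: "\<And>z. z \<in> unit_ball n \<Longrightarrow> monomial n c \<alpha> z = monomial n c' \<beta> z"
  shows "c' \<noteq> 0" "dg n \<alpha> = dg n \<beta>"
proof -
  have val: "cmod c * e ^ dg n \<alpha> = cmod c' * e ^ dg n \<beta>" if e: "0 < e" "e \<le> 1 / (2 * real n)" for e
  proof -
    define z where "z i = (if i < n then complex_of_real e else 0)" for i
    have m: "monomial n c \<gamma> z = c * complex_of_real e ^ dg n \<gamma>" for c \<gamma>
      by (simp add: monomial_def z_def dg_def power_sum)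
    have "e \<le> 1" using e n by (smt (verit) divide_le_eq_1 of_nat_1 of_nat_mono)
    have "(\<Sum>i<n. (cmod (z i))\<^sup>2) = real n * e * e" using e by (simp add: z_def power2_eq_square)
    also have "\<dots> \<le> real n * e * 1" by (rule mult_left_mono) (use e \<open>e \<le> 1\<close> in auto)
    also have "\<dots> \<le> 1 / 2" using e n by (simp add: field_simps)
    finally have "z \<in> unit_ball n" by (simp add: unit_ball_def complex_space_def z_def)
    from arg_cong[OF eq[OF this], of cmod] show ?thesis using e by (simp add: m norm_mult norm_power)
  qed
  define e where "e = 1 / (2 * real n)"
  have e: "0 < e" using n by (simp add: e_def)
  have 1: "cmod c * e ^ dg n \<alpha> = cmod c' * e ^ dg n \<beta>" by (rule val) (use e in \<open>auto simp: e_def\<close>)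
  then show c': "c' \<noteq> 0" using c e by auto
  have 2: "cmod c * (e / 2) ^ dg n \<alpha> = cmod c' * (e / 2) ^ dg n \<beta>" by (rule val) (use e n in \<open>auto simp: e_def field_simps\<close>)
  have "(cmod c * e ^ dg n \<alpha>) * 2 ^ dg n \<beta> = (cmod c' * e ^ dg n \<beta>) * 2 ^ dg n \<alpha>"
    using 2 c c' by (simp add: power_divide field_simps)
  then have "(2 :: real) ^ dg n \<beta> = 2 ^ dg n \<alpha>" using 1 c c' e by simp
  then show "dg n \<alpha> = dg n \<beta>" by simp
qed

lemma map_degree_eq:
  assumes n: "n \<ge> 1" and f: "\<And>j z. j < N \<Longrightarrow> z \<in> unit_ball n \<Longrightarrow> f z j = monomial n (c j) (\<alpha> j) z"
  shows "map_degree n N f = Max {dg n (\<alpha> j) | j. j < N \<and> c j \<noteq> 0}"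
proof -
  have "{\<Sum>i<n. \<beta> i | j c' \<beta>. j < N \<and> c' \<noteq> 0 \<and> (\<forall>z\<in>unit_ball n. f z j = monomial n c' \<beta> z)}
      = {dg n (\<alpha> j) | j. j < N \<and> c j \<noteq> 0}" (is "?L = ?R")
  proof (intro equalityI subsetI)
    fix d assume "d \<in> ?L"
    then obtain j c' \<beta> where j: "j < N" "c' \<noteq> 0" "\<forall>z\<in>unit_ball n. f z j = monomial n c' \<beta> z" "d = dg n \<beta>"
      by (auto simp: dg_def)
    then have "monomial n c' \<beta> z = monomial n (c j) (\<alpha> j) z" if "z \<in> unit_ball n" for z using f[OF j(1) that] that by simp
    from degree_unique[OF n j(2) this] show "d \<in> ?R" using j by auto
  next
    fix d assume "d \<in> ?R"
    then show "d \<in> ?L" using f unfolding dg_def by blast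
  qed
  then show ?thesis unfolding map_degree_def by simp
qed

text \<open>
If the squared norm of \<open>f\<close> were less than one at a boundary point, the image of a radius towards that
point would stay in a compact ball inside the target, although the radius has no limit in the
source.
\<close>

lemma proper_sphere:
  assumes pm: "proper_monomial_map n N f"
    and f: "\<And>j z. j < N \<Longrightarrow> z \<in> unit_ball n \<Longrightarrow> f z j = monomial n (c j) (\<alpha> j) z"
    and x: "\<And>i. i < n \<Longrightarrow> 0 \<le> x i" "(\<Sum>i<n. x i) = 1"
  shows "(\<Sum>j<N. (cmod (c j))\<^sup>2 * wt n x (\<alpha> j)) = 1"
proof -
  define z where "z t = (\<lambda>i. if i < n then complex_of_real (sqrt (t * x i)) else 0)" for t :: real
  define g where "g t = (\<Sum>j<N. (cmod (c j))\<^sup>2 * (t ^ dg n (\<alpha> j) * wt n x (\<alpha> j)))" for t :: real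
  have sq: "(cmod (z t i))\<^sup>2 = t * x i" if "0 \<le> t" "i < n" for t i
    using that x(1) by (simp add: z_def)
  have sum_z: "(\<Sum>i<n. (cmod (z t i))\<^sup>2) = t" if "0 \<le> t" for t
  proof -
    have "(\<Sum>i<n. (cmod (z t i))\<^sup>2) = (\<Sum>i<n. t * x i)" by (rule sum.cong) (use sq that in auto)
    then show ?thesis using x(2) by (simp flip: sum_distrib_left)
  qed
  have ball: "z t \<in> unit_ball n" if "0 \<le> t" "t < 1" for t
    using sum_z that by (simp add: unit_ball_def complex_space_def z_def)
  have fball: "f (z t) \<in> unit_ball N" if "0 \<le> t" "t < 1" for t
    using pm ball[OF that] by (auto simp: proper_monomial_map_def monomial_map_def)
  have gval: "(\<Sum>j<N. (cmod (f (z t) j))\<^sup>2) = g t" if t: "0 \<le> t" "t < 1" for t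
    unfolding g_def
  proof (rule sum.cong)
    fix j assume "j \<in> {..<N}"
    then have "(cmod (f (z t) j))\<^sup>2 = (cmod (c j))\<^sup>2 * wt n (\<lambda>i. (cmod (z t i))\<^sup>2) (\<alpha> j)"
      using f[OF _ ball[OF t]] by (simp add: cmod_monomial)
    also have "wt n (\<lambda>i. (cmod (z t i))\<^sup>2) (\<alpha> j) = wt n (\<lambda>i. t * x i) (\<alpha> j)"
      unfolding wt_def by (rule prod.cong) (use sq t in auto)
    finally show "(cmod (f (z t) j))\<^sup>2 = (cmod (c j))\<^sup>2 * (t ^ dg n (\<alpha> j) * wt n x (\<alpha> j))" by (simp add: wt_scale)
  qed simp
  have cont: "continuous_on UNIV g" unfolding g_def by (intro continuous_intros)
  have mono: "g t \<le> g 1" if "0 \<le> t" "t \<le> 1" for t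
    unfolding g_def by (intro sum_mono mult_left_mono mult_right_mono) (use that wt_nonneg[OF x(1)] in \<open>auto simp: power_le_one\<close>)
  have cl: "{0..1} \<subseteq> A" if "closed A" "{0..<1} \<subseteq> A" for A :: "real set"
    using closure_minimal[OF that(2,1)] by simp
  have "g 1 \<le> 1"
  proof -
    have "closed {t. g t \<le> 1}" by (rule closed_Collect_le) (use cont in \<open>auto intro: continuous_intros\<close>)
    moreover have "{0..<1} \<subseteq> {t. g t \<le> 1}" using gval fball by (fastforce simp: unit_ball_def)
    ultimately have "{0..1} \<subseteq> {t. g t \<le> 1}" by (rule cl)
    from subsetD[OF this, of 1] show ?thesis by simp
  qed
  moreover have "\<not> g 1 < 1"
  proof
    assume lt: "g 1 < 1"
    define K where "K = {w \<in> complex_space N. (\<Sum>i<N. (cmod (w i))\<^sup>2) \<le> g 1}"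
    have "compact K" unfolding K_def by (rule compact_closed_ball)
    moreover have "K \<subseteq> unit_ball N" using lt by (auto simp: K_def unit_ball_def)
    ultimately have "compact {w \<in> unit_ball n. f w \<in> K}"
      using pm by (simp add: proper_monomial_map_def proper_on_def)
    then have A: "closed {w \<in> unit_ball n. f w \<in> K}" by (rule compact_imp_closed)
    have "continuous_on UNIV z"
      unfolding z_def
    proof (rule continuous_on_coordinatewise_then_product)
      fix i show "continuous_on UNIV (\<lambda>t. if i < n then complex_of_real (sqrt (t * x i)) else 0)"
        by (cases "i < n") (simp_all add: continuous_intros)
    qed
    from closed_vimage[OF A this] have "closed (z -` {w \<in> unit_ball n. f w \<in> K})" .
    moreover have "{0..<1} \<subseteq> z -` {w \<in> unit_ball n. f w \<in> K}"
    proof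
      fix t :: real assume "t \<in> {0..<1}"
      then have t: "0 \<le> t" "t < 1" by auto
      have "f (z t) \<in> complex_space N" using fball[OF t] by (simp add: unit_ball_def)
      then show "t \<in> z -` {w \<in> unit_ball n. f w \<in> K}"
        using ball[OF t] gval[OF t] mono[of t] t by (simp add: K_def)
    qed
    ultimately have "{0..1} \<subseteq> z -` {w \<in> unit_ball n. f w \<in> K}" by (rule cl)
    from subsetD[OF this, of 1] have "z 1 \<in> unit_ball n" by simp
    then show False using sum_z[of 1] by (simp add: unit_ball_def)
  qed
  ultimately have "g 1 = 1" by simp
  then show ?thesis by (simp add: g_def)
qed

text \<open>
Coordinates with the same monomial are collected in one coefficient of \<open>P\<close>, and zero coordinates
are dropped; both can only decrease the number of monomials.
\<close>

theorem degree_bound: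
  assumes n: "n \<ge> 2" and pm: "proper_monomial_map n N f" and d: "map_degree n N f = d"
  shows "n = 2 \<Longrightarrow> d + 3 \<le> 2 * N" "n \<ge> 3 \<Longrightarrow> (n - 1) * d + 1 \<le> N"
proof -
  have "\<forall>j<N. \<exists>c \<alpha>. \<forall>z\<in>unit_ball n. f z j = monomial n c \<alpha> z"
    using pm by (simp add: proper_monomial_map_def monomial_map_def)
  then obtain c \<beta> where \<beta>: "\<And>j z. j < N \<Longrightarrow> z \<in> unit_ball n \<Longrightarrow> f z j = monomial n (c j) (\<beta> j) z"
    by metis
  define \<alpha> where "\<alpha> j i = (if i < n then \<beta> j i else 0)" for j i
  have f: "f z j = monomial n (c j) (\<alpha> j) z" if "j < N" "z \<in> unit_ball n" for j z
    using \<beta>[OF that] by (simp add: monomial_def \<alpha>_def)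
  have \<alpha>: "\<alpha> j \<in> expo n" for j by (simp add: \<alpha>_def expo_def)
  define P where "P \<gamma> = (\<Sum>j<N. if \<alpha> j = \<gamma> then (cmod (c j))\<^sup>2 else 0)" for \<gamma>
  define J where "J = {j. j < N \<and> c j \<noteq> 0}"
  have nn: "0 \<le> P \<gamma>" for \<gamma> unfolding P_def by (rule sum_nonneg) simp
  have P: "P \<gamma> \<noteq> 0 \<longleftrightarrow> \<gamma> \<in> \<alpha> ` J" for \<gamma>
  proof -
    have "P \<gamma> = 0 \<longleftrightarrow> (\<forall>j\<in>{..<N}. (if \<alpha> j = \<gamma> then (cmod (c j))\<^sup>2 else 0) = 0)"
      unfolding P_def by (rule sum_nonneg_eq_0_iff) auto
    then show ?thesis by (auto simp: J_def)
  qed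
  then have set: "{\<gamma>. P \<gamma> \<noteq> 0} = \<alpha> ` J" by blast
  have finJ: "finite J" by (simp add: J_def)
  have cardJ: "card (\<alpha> ` J) \<le> N"
    using card_image_le[OF finJ, of \<alpha>] card_mono[of "{..<N}" J] by (force simp: J_def)
  have eval: "(\<Sum>\<gamma> | P \<gamma> \<noteq> 0. P \<gamma> * wt n x \<gamma>) = (\<Sum>j<N. (cmod (c j))\<^sup>2 * wt n x (\<alpha> j))" for x
  proof -
    have "(\<Sum>\<gamma> | P \<gamma> \<noteq> 0. P \<gamma> * wt n x \<gamma>) = (\<Sum>\<gamma>\<in>\<alpha> ` J. \<Sum>j<N. if \<alpha> j = \<gamma> then (cmod (c j))\<^sup>2 * wt n x \<gamma> else 0)"
      unfolding set unfolding P_def sum_distrib_right by (intro sum.cong refl) auto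
    also have "\<dots> = (\<Sum>j<N. \<Sum>\<gamma>\<in>\<alpha> ` J. if \<alpha> j = \<gamma> then (cmod (c j))\<^sup>2 * wt n x \<gamma> else 0)"
      by (rule sum.swap)
    also have "\<dots> = (\<Sum>j<N. (cmod (c j))\<^sup>2 * wt n x (\<alpha> j))"
      by (rule sum.cong) (use finJ in \<open>auto simp: J_def\<close>)
    finally show ?thesis .
  qed
  have sphere: "(\<Sum>j<N. (cmod (c j))\<^sup>2 * wt n x (\<alpha> j)) = 1"
    if "\<And>i. i < n \<Longrightarrow> 0 \<le> x i" "(\<Sum>i<n. x i) = 1" for x
    by (rule proper_sphere[OF pm f]) (use that in auto)
  have J_ne: "J \<noteq> {}"
  proof
    assume "J = {}"
    then have "c j = 0" if "j < N" for j using that by (auto simp: J_def)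
    then have "(\<Sum>j<N. (cmod (c j))\<^sup>2 * wt n (\<lambda>i. 1 / real n) (\<alpha> j)) = 0" by simp
    then show False using sphere[of "\<lambda>i. 1 / real n"] n by simp
  qed
  have "map_degree n N f = Max {dg n (\<alpha> j) | j. j < N \<and> c j \<noteq> 0}"
    by (rule map_degree_eq) (use n f in auto)
  also have "{dg n (\<alpha> j) | j. j < N \<and> c j \<noteq> 0} = (\<lambda>j. dg n (\<alpha> j)) ` J" by (auto simp: J_def)
  finally have dMax: "d = Max ((\<lambda>j. dg n (\<alpha> j)) ` J)" using d by simp
  then have "d \<in> (\<lambda>j. dg n (\<alpha> j)) ` J" using finJ J_ne by (simp add: Max_in)
  then obtain j0 where j0: "j0 \<in> J" "dg n (\<alpha> j0) = d" by auto
  have dle: "dg n (\<alpha> j) \<le> d" if "j \<in> J" for j unfolding dMax using finJ that by simp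
  have d1: "d \<ge> 1"
  proof (rule ccontr)
    assume "\<not> d \<ge> 1"
    then have "dg n (\<alpha> j) = 0" if "j \<in> J" for j using dle[OF that] by simp
    then have z: "wt n x (\<alpha> j) = 1" if "j \<in> J" for j x using that by (auto simp: wt_def dg_def)
    have "(\<Sum>j<N. (cmod (c j))\<^sup>2) = (\<Sum>j<N. (cmod (c j))\<^sup>2 * wt n (\<lambda>i. 1 / real n) (\<alpha> j))"
      by (rule sum.cong) (use z in \<open>auto simp: J_def\<close>)
    then have 1: "(\<Sum>j<N. (cmod (c j))\<^sup>2) = 1" using sphere[of "\<lambda>i. 1 / real n"] n by simp
    have 0: "(\<lambda>i. 0) \<in> unit_ball n" by (simp add: unit_ball_def complex_space_def)
    then have "f (\<lambda>i. 0) \<in> unit_ball N" using pm by (auto simp: proper_monomial_map_def monomial_map_def)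
    then have "(\<Sum>j<N. (cmod (f (\<lambda>i. 0) j))\<^sup>2) < 1" by (simp add: unit_ball_def)
    moreover have "(\<Sum>j<N. (cmod (f (\<lambda>i. 0) j))\<^sup>2) = (\<Sum>j<N. (cmod (c j))\<^sup>2)"
      by (rule sum.cong) (use f[OF _ 0] z in \<open>auto simp: cmod_monomial J_def\<close>)
    ultimately show False using 1 by simp
  qed
  have one: "(\<Sum>\<gamma> | P \<gamma> \<noteq> 0. P \<gamma> * wt n x \<gamma>) = 1"
    if "\<And>i. i < n \<Longrightarrow> 0 < x i" "(\<Sum>i<n. x i) = 1" for x
    unfolding eval by (rule sphere) (use that in \<open>auto intro: less_imp_le\<close>)
  have fin: "finite {\<gamma>. P \<gamma> \<noteq> 0}" unfolding set using finJ by simp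
  have ex: "\<gamma> \<in> expo n" if "P \<gamma> \<noteq> 0" for \<gamma> using that P[of \<gamma>] \<alpha> by auto
  have deg: "dg n \<gamma> \<le> d" if "P \<gamma> \<noteq> 0" for \<gamma> using that P[of \<gamma>] dle by auto
  have top: "P (\<alpha> j0) \<noteq> 0" using P j0 by blast
  have bound2: "d + 3 \<le> 2 * card {\<gamma>. P \<gamma> \<noteq> 0}" if "n = 2"
    by (rule constant_on_simplex_bound(1)[where P = P, OF n fin _ nn _ top j0(2) d1 _ that]) (fact ex deg one)+
  have bound3: "(n - 1) * d + 1 \<le> card {\<gamma>. P \<gamma> \<noteq> 0}" if "n \<ge> 3"
    by (rule constant_on_simplex_bound(2)[where P = P, OF n fin _ nn _ top j0(2) d1 _ that]) (fact ex deg one)+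
  show "d + 3 \<le> 2 * N" if "n = 2" using bound2[OF that] cardJ unfolding set by simp
  show "(n - 1) * d + 1 \<le> N" if "n \<ge> 3" using bound3[OF that] cardJ unfolding set by simp
qed

section \<open>Maps that attain the bound\<close>

text \<open>
Conversely to \<open>proper_sphere\<close>: if the weighted sum of monomials is one on the simplex and all
degrees lie between \<open>1\<close> and \<open>d\<close>, then the squared norm of the image of \<open>z\<close> lies between \<open>t ^ d\<close> and \<open>t\<close>, where \<open>t\<close> is the squared norm
of \<open>z\<close>.  So preimages of compact sets stay away from the sphere.
\<close>

lemma proper_map_from_weights:
  fixes C :: "nat \<Rightarrow> real"
  assumes n: "n \<ge> 1" and C: "\<And>j. j < N \<Longrightarrow> 0 \<le> C j"
    and deg: "\<And>j. j < N \<Longrightarrow> 1 \<le> dg n (\<alpha> j) \<and> dg n (\<alpha> j) \<le> d"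
    and top: "j0 < N" "C j0 \<noteq> 0" "dg n (\<alpha> j0) = d"
    and one: "\<And>x. (\<And>i. i < n \<Longrightarrow> 0 \<le> x i) \<Longrightarrow> (\<Sum>i<n. x i) = 1 \<Longrightarrow> (\<Sum>j<N. C j * wt n x (\<alpha> j)) = 1"
  shows "\<exists>f. proper_monomial_map n N f \<and> map_degree n N f = d"
proof -
  define f where "f = (\<lambda>z j. if j < N then monomial n (complex_of_real (sqrt (C j))) (\<alpha> j) z else 0)"
  define G where "G y = (\<Sum>j<N. C j * wt n y (\<alpha> j))" for y
  have d: "d \<ge> 1" using deg[OF top(1)] top(3) by simp
  have sq: "(\<Sum>j<N. (cmod (f z j))\<^sup>2) = G (\<lambda>i. (cmod (z i))\<^sup>2)" for z
    unfolding G_def by (rule sum.cong) (auto simp: f_def cmod_monomial C)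
  have bounds: "G y \<le> (\<Sum>i<n. y i)" "(\<Sum>i<n. y i) ^ d \<le> G y"
    if y: "\<And>i. 0 \<le> y i" "(\<Sum>i<n. y i) \<le> 1" for y
  proof -
    define t where "t = (\<Sum>i<n. y i)"
    have t: "0 \<le> t" "t \<le> 1" using y by (auto simp: t_def sum_nonneg)
    \<comment> \<open>at the origin any point of the simplex can serve as the direction\<close>
    obtain u where u: "\<And>i. 0 \<le> u i" "(\<Sum>i<n. u i) = 1" "\<And>i. i < n \<Longrightarrow> y i = t * u i"
    proof (cases "t = 0")
      case True
      then have "y i = 0" if "i < n" for i
        using sum_nonneg_eq_0_iff[of "{..<n}" y] y that by (auto simp: t_def)
      then show ?thesis using True n by (intro that[of "\<lambda>i. 1 / real n"]) auto
    next
      case False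
      then show ?thesis using y t
        by (intro that[of "\<lambda>i. y i / t"]) (auto simp: t_def simp flip: sum_divide_distrib)
    qed
    have wt: "wt n y (\<alpha> j) = t ^ dg n (\<alpha> j) * wt n u (\<alpha> j)" for j
      unfolding wt_scale[symmetric] unfolding wt_def by (rule prod.cong) (use u in auto)
    have G1: "(\<Sum>j<N. C j * wt n u (\<alpha> j)) = 1" by (rule one) (use u in auto)
    have cw: "0 \<le> C j * wt n u (\<alpha> j)" if "j < N" for j
      using C[OF that] wt_nonneg[of n u "\<alpha> j"] u by simp
    have Gy: "G y = (\<Sum>j<N. t ^ dg n (\<alpha> j) * (C j * wt n u (\<alpha> j)))"
      unfolding G_def wt by (simp add: algebra_simps)
    have "G y \<le> (\<Sum>j<N. t * (C j * wt n u (\<alpha> j)))"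
      unfolding Gy
    proof (intro sum_mono mult_right_mono)
      fix j assume "j \<in> {..<N}"
      then have "t ^ dg n (\<alpha> j) \<le> t ^ 1" using deg[of j] t by (intro power_decreasing) auto
      then show "t ^ dg n (\<alpha> j) \<le> t" by simp
    qed (use cw in auto)
    then show "G y \<le> (\<Sum>i<n. y i)" using G1 by (simp add: t_def flip: sum_distrib_left)
    have "(\<Sum>j<N. t ^ d * (C j * wt n u (\<alpha> j))) \<le> G y"
      unfolding Gy
    proof (intro sum_mono mult_right_mono)
      fix j assume "j \<in> {..<N}"
      then show "t ^ d \<le> t ^ dg n (\<alpha> j)" using deg[of j] t by (intro power_decreasing) auto
    qed (use cw in auto)
    then show "(\<Sum>i<n. y i) ^ d \<le> G y" using G1 by (simp add: t_def flip: sum_distrib_left)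
  qed
  have fball: "f z \<in> unit_ball N" if "z \<in> unit_ball n" for z
  proof -
    have "(\<Sum>i<n. (cmod (z i))\<^sup>2) < 1" using that by (simp add: unit_ball_def)
    then have "G (\<lambda>i. (cmod (z i))\<^sup>2) < 1" using bounds(1)[of "\<lambda>i. (cmod (z i))\<^sup>2"] by simp
    then show ?thesis using sq[of z] by (simp add: unit_ball_def complex_space_def f_def)
  qed
  have contf: "continuous_on UNIV f"
    unfolding f_def
  proof (rule continuous_on_coordinatewise_then_product)
    fix j
    show "continuous_on UNIV (\<lambda>z. if j < N then monomial n (complex_of_real (sqrt (C j))) (\<alpha> j) z else 0)"
      unfolding monomial_def
      by (cases "j < N") (simp_all add: continuous_on_mult continuous_on_prod continuous_on_power)
  qed
  have "proper_on (unit_ball n) (unit_ball N) f"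
    unfolding proper_on_def
  proof (intro allI impI, elim conjE)
    fix K assume K: "K \<subseteq> unit_ball N" "compact K"
    show "compact {z \<in> unit_ball n. f z \<in> K}"
    proof (cases "K = {}")
      case False
      have "continuous_on K (\<lambda>w. \<Sum>j<N. (cmod (w j))\<^sup>2)"
        by (rule continuous_on_subset[of UNIV])
          (intro continuous_on_sum continuous_on_power continuous_on_norm continuous_on_product_coordinates, simp)
      then obtain w where w: "w \<in> K" "\<And>v. v \<in> K \<Longrightarrow> (\<Sum>j<N. (cmod (v j))\<^sup>2) \<le> (\<Sum>j<N. (cmod (w j))\<^sup>2)"
        using continuous_attains_sup[OF K(2) False] by blast
      define s where "s = (\<Sum>j<N. (cmod (w j))\<^sup>2)"
      have s: "s < 1" using w(1) K(1) by (auto simp: s_def unit_ball_def)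
      \<comment> \<open>the lower bound for the squared norm of the image confines the preimage of a ball\<close>
      define B where "B = {z \<in> complex_space n. (\<Sum>i<n. (cmod (z i))\<^sup>2) \<le> root d s}"
      have "root d s < 1" using s d by simp
      then have "B \<subseteq> unit_ball n" by (auto simp: B_def unit_ball_def)
      moreover have "z \<in> B" if z: "z \<in> unit_ball n" "f z \<in> K" for z
      proof -
        define t where "t = (\<Sum>i<n. (cmod (z i))\<^sup>2)"
        have "t ^ d \<le> G (\<lambda>i. (cmod (z i))\<^sup>2)"
          unfolding t_def by (rule bounds(2)) (use z(1) in \<open>auto simp: unit_ball_def\<close>)
        also have "\<dots> \<le> s" using w(2)[OF z(2)] sq[of z] by (simp add: s_def)
        finally have "root d (t ^ d) \<le> root d s" using d by simp
        moreover have "root d (t ^ d) = t" using d by (intro real_root_power_cancel) (auto simp: t_def sum_nonneg)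
        ultimately show ?thesis using z(1) by (simp add: B_def t_def unit_ball_def)
      qed
      ultimately have "{z \<in> unit_ball n. f z \<in> K} = B \<inter> f -` K" by auto
      moreover have "compact B" unfolding B_def by (rule compact_closed_ball)
      moreover have "closed (f -` K)"
        by (rule closed_vimage[OF compact_imp_closed[OF K(2)] contf])
      ultimately show ?thesis by (simp add: compact_Int_closed)
    qed simp
  qed
  moreover have "monomial_map n N f"
    unfolding monomial_map_def
  proof (intro conjI allI impI)
    show "f \<in> unit_ball n \<rightarrow> unit_ball N" using fball by auto
    fix j assume "j < N"
    then show "\<exists>c \<alpha>. \<forall>z\<in>unit_ball n. f z j = monomial n c \<alpha> z" by (auto simp: f_def)
  qed
  moreover have "map_degree n N f = Max {dg n (\<alpha> j) | j. j < N \<and> complex_of_real (sqrt (C j)) \<noteq> 0}"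
    by (rule map_degree_eq) (use n in \<open>auto simp: f_def\<close>)
  moreover have "Max {dg n (\<alpha> j) | j. j < N \<and> complex_of_real (sqrt (C j)) \<noteq> 0} = d"
    by (rule Max_eqI) (use deg top in auto)
  ultimately show ?thesis by (auto simp: proper_monomial_map_def)
qed

lemma sum_div_mod:
  fixes g :: "nat \<Rightarrow> nat \<Rightarrow> 'a::comm_monoid_add"
  assumes "m > 0"
  shows "(\<Sum>j<d * m. g (j div m) (j mod m)) = (\<Sum>k<d. \<Sum>i<m. g k i)"
proof -
  have "(\<Sum>j=k * m..<k * m + m. g (j div m) (j mod m)) = (\<Sum>i<m. g k i)" for k
    unfolding sum.atLeastLessThan_shift_0[of _ "k * m"] using assms by (simp add: atLeast0LessThan)
  then show ?thesis by (simp flip: sum.nat_group)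
qed

text \<open>
The generalized Whitney map: in the identity \<open>x_0 + \<dots> + x_m = 1\<close>, with \<open>m = n - 1\<close>, the pure power of the last variable is
repeatedly multiplied by the sum of the variables.
\<close>

lemma proper_map_whitney:
  assumes n: "n \<ge> 2" and d: "d \<ge> 1"
  shows "\<exists>f. proper_monomial_map n ((n - 1) * d + 1) f \<and> map_degree n ((n - 1) * d + 1) f = d"
proof -
  define m where "m = n - 1"
  have m: "m > 0" "m < n" "n = Suc m" using n by (auto simp: m_def)
  define \<alpha> where "\<alpha> j l = (if j < d * m then (if l = m then j div m else 0) + (if l = j mod m then 1 else 0)
      else if l = m then d else 0)" for j l :: nat
  have mod: "j mod m < m" for j using m by simp
  have dgs: "dg n (\<alpha> j) = (if j < d * m then j div m + 1 else d)" for j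
    using mod[of j] by (simp add: dg_def \<alpha>_def m(3) sum.distrib)
  have div: "j div m < d" if "j < d * m" for j using that by (simp add: less_mult_imp_div_less)
  have wts: "wt n x (\<alpha> j) = (if j < d * m then x m ^ (j div m) * x (j mod m) else x m ^ d)" for x j
    using mod[of j] by (simp add: wt_def \<alpha>_def m(3) power_add prod.distrib if_distrib[of "(^) _"] cong: if_cong)
  have "\<exists>f. proper_monomial_map n (m * d + 1) f \<and> map_degree n (m * d + 1) f = d"
  proof (rule proper_map_from_weights[where C = "\<lambda>_. 1" and \<alpha> = \<alpha> and ?j0.0 = "m * d"])
    fix x :: "nat \<Rightarrow> real" assume "(\<Sum>i<n. x i) = 1"
    then have x: "(\<Sum>i<m. x i) = 1 - x m" by (simp add: m(3))
    have "(\<Sum>j<m * d + 1. 1 * wt n x (\<alpha> j)) = (\<Sum>j<d * m. x m ^ (j div m) * x (j mod m)) + x m ^ d"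
      by (simp add: wts mult.commute)
    also have "(\<Sum>j<d * m. x m ^ (j div m) * x (j mod m)) = (1 - x m) * (\<Sum>k<d. x m ^ k)"
      unfolding sum_div_mod[OF m(1), of "\<lambda>k i. x m ^ k * x i"]
      by (simp add: x mult.commute flip: sum_distrib_left sum_distrib_right)
    also have "\<dots> = 1 - x m ^ d" by (simp add: one_diff_power_eq)
    finally show "(\<Sum>j<m * d + 1. 1 * wt n x (\<alpha> j)) = 1" by simp
  next
    fix j assume "j < m * d + 1"
    then show "1 \<le> dg n (\<alpha> j) \<and> dg n (\<alpha> j) \<le> d" using div[of j] d by (auto simp: dgs)
  qed (use n in \<open>auto simp: dgs mult.commute\<close>)
  then show ?thesis by (simp add: m_def)
qed

text \<open>
For \<open>x + y = 1\<close> the recursion has the characteristic roots \<open>1\<close> and \<open>- y\<close>, whence the closed form in \<open>lucas_on_simplex\<close>.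
\<close>

fun lucas :: "nat \<Rightarrow> real \<Rightarrow> real \<Rightarrow> real" where
  "lucas 0 x y = 2"
| "lucas (Suc 0) x y = x"
| "lucas (Suc (Suc d)) x y = x * lucas (Suc d) x y + y * lucas d x y"

lemma lucas_on_simplex: "x + y = 1 \<Longrightarrow> lucas d x y = 1 + (- y) ^ d"
proof (induction d x y rule: lucas.induct)
  case (3 d x y)
  then have x: "x = 1 - y" by simp
  show ?case unfolding lucas.simps 3(1)[OF 3(3)] 3(2)[OF 3(3)] unfolding x by (simp add: algebra_simps)
qed auto

lemma lucas_expansion:
  "\<exists>a. (\<forall>j. 0 \<le> a j) \<and> (\<forall>j. d div 2 < j \<longrightarrow> a j = 0)
     \<and> (\<forall>x y. lucas d x y = (\<Sum>j\<le>d div 2. a j * (x ^ (d - 2 * j) * y ^ j)))"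
proof (induction d rule: induct_nat_012)
  case 0
  show ?case by (rule exI[of _ "\<lambda>j. if j = 0 then 2 else 0"]) auto
next
  case 1
  show ?case by (rule exI[of _ "\<lambda>j. if j = 0 then 1 else 0"]) auto
next
  case (ge2 d)
  obtain b where b: "\<And>j. 0 \<le> b j" "\<And>j. d div 2 < j \<Longrightarrow> b j = 0"
      "\<And>x y. lucas d x y = (\<Sum>j\<le>d div 2. b j * (x ^ (d - 2 * j) * y ^ j))"
    using ge2.IH(1) by blast
  obtain a where a: "\<And>j. 0 \<le> a j" "\<And>j. Suc d div 2 < j \<Longrightarrow> a j = 0"
      "\<And>x y. lucas (Suc d) x y = (\<Sum>j\<le>Suc d div 2. a j * (x ^ (Suc d - 2 * j) * y ^ j))"
    using ge2.IH(2) by blast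
  define c where "c j = a j + (case j of 0 \<Rightarrow> 0 | Suc i \<Rightarrow> b i)" for j
  have "0 \<le> c j" for j using a(1) b(1) by (simp add: c_def split: nat.split)
  moreover have "c j = 0" if "Suc (Suc d) div 2 < j" for j
    using that a(2)[of j] b(2) by (auto simp: c_def split: nat.split)
  moreover have "lucas (Suc (Suc d)) x y = (\<Sum>j\<le>Suc (Suc d) div 2. c j * (x ^ (Suc (Suc d) - 2 * j) * y ^ j))" for x y
  proof -
    have "x * lucas (Suc d) x y = (\<Sum>j\<le>Suc d div 2. a j * (x ^ (Suc (Suc d) - 2 * j) * y ^ j))"
      unfolding a(3) sum_distrib_left
    proof (rule sum.cong)
      fix j assume "j \<in> {..Suc d div 2}"
      then have "Suc (Suc d) - 2 * j = Suc (Suc d - 2 * j)" by auto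
      then show "x * (a j * (x ^ (Suc d - 2 * j) * y ^ j)) = a j * (x ^ (Suc (Suc d) - 2 * j) * y ^ j)"
        by (simp only: power_Suc mult.assoc mult.left_commute)
    qed simp
    also have "\<dots> = (\<Sum>j\<le>Suc (Suc d) div 2. a j * (x ^ (Suc (Suc d) - 2 * j) * y ^ j))"
      by (rule sum.mono_neutral_left) (auto simp: a(2))
    finally have 1: "x * lucas (Suc d) x y = (\<Sum>j\<le>Suc (Suc d) div 2. a j * (x ^ (Suc (Suc d) - 2 * j) * y ^ j))" .
    have "(\<Sum>j\<le>Suc (Suc d) div 2. (case j of 0 \<Rightarrow> 0 | Suc i \<Rightarrow> b i) * (x ^ (Suc (Suc d) - 2 * j) * y ^ j))
        = (\<Sum>j\<le>d div 2. b j * (x ^ (d - 2 * j) * (y * y ^ j)))"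
      by (simp add: sum.atMost_Suc_shift del: sum.atMost_Suc)
    also have "\<dots> = y * lucas d x y"
      unfolding b(3) sum_distrib_left by (simp add: mult.left_commute)
    finally show ?thesis using 1 by (simp add: c_def distrib_right sum.distrib del: sum.atMost_Suc)
  qed
  ultimately show ?case by blast
qed

lemma wt_vec2: "wt 2 x (vec3 p q 0) = x 0 ^ p * x 1 ^ q"
  by (simp add: wt_def numeral_2_eq_2)

text \<open>
D'Angelo's polynomials: for odd \<open>d\<close> the sum of the Lucas polynomial and \<open>y ^ d\<close> is one on the line \<open>x + y = 1\<close>.
\<close>

lemma proper_map_odd: "\<exists>f. proper_monomial_map 2 (m + 2) f \<and> map_degree 2 (m + 2) f = 2 * m + 1"
proof -
  obtain a where a: "\<And>j. 0 \<le> a j"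
      "\<And>x y. lucas (2 * m + 1) x y = (\<Sum>j\<le>m. a j * (x ^ (2 * m + 1 - 2 * j) * y ^ j))"
    using lucas_expansion[of "2 * m + 1"] by auto
  show ?thesis
  proof (rule proper_map_from_weights[where ?j0.0 = "m + 1" and C = "\<lambda>j. if j \<le> m then a j else 1"
      and \<alpha> = "\<lambda>j. if j \<le> m then vec3 (2 * m + 1 - 2 * j) j 0 else vec3 0 (2 * m + 1) 0"])
    fix x :: "nat \<Rightarrow> real" assume "(\<Sum>i<2. x i) = 1"
    then have "x 0 + x 1 = 1" by (simp add: numeral_2_eq_2)
    then have "lucas (2 * m + 1) (x 0) (x 1) = 1 - x 1 ^ (2 * m + 1)" by (simp add: lucas_on_simplex)
    moreover have "{..<m + 2} = insert (m + 1) {..m}" by auto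
    ultimately show "(\<Sum>j<m + 2. (if j \<le> m then a j else 1)
        * wt 2 x (if j \<le> m then vec3 (2 * m + 1 - 2 * j) j 0 else vec3 0 (2 * m + 1) 0)) = 1"
      unfolding a(2) by (simp add: wt_vec2 vec2_simps(2))
  qed (use a(1) in \<open>auto simp: wt_vec2 vec2_simps(2)\<close>)
qed

text \<open>
In the polynomial of degree \<open>2 * m + 1\<close> the monomial \<open>y ^ (2 * m + 1)\<close> is multiplied by \<open>x + y\<close>, which costs one
dimension more.
\<close>

lemma proper_map_even: "\<exists>f. proper_monomial_map 2 (m + 3) f \<and> map_degree 2 (m + 3) f = 2 * m + 2"
proof -
  obtain a where a: "\<And>j. 0 \<le> a j"
      "\<And>x y. lucas (2 * m + 1) x y = (\<Sum>j\<le>m. a j * (x ^ (2 * m + 1 - 2 * j) * y ^ j))"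
    using lucas_expansion[of "2 * m + 1"] by auto
  define \<alpha> where "\<alpha> j = (if j \<le> m then vec3 (2 * m + 1 - 2 * j) j 0
      else if j = m + 1 then vec3 1 (2 * m + 1) 0 else vec3 0 (2 * m + 2) 0)" for j
  show ?thesis
  proof (rule proper_map_from_weights[where ?j0.0 = "m + 2" and C = "\<lambda>j. if j \<le> m then a j else 1" and \<alpha> = \<alpha>])
    fix x :: "nat \<Rightarrow> real" assume "(\<Sum>i<2. x i) = 1"
    then have x: "x 0 = 1 - x 1" by (simp add: numeral_2_eq_2)
    then have l: "lucas (2 * m + 1) (x 0) (x 1) = 1 - x 1 ^ (2 * m + 1)" by (simp add: lucas_on_simplex)
    have "{..<m + 3} = insert (m + 2) (insert (m + 1) {..m})" by auto
    then have "(\<Sum>j<m + 3. (if j \<le> m then a j else 1) * wt 2 x (\<alpha> j))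
        = x 1 ^ (2 * m + 2) + x 0 * x 1 ^ (2 * m + 1) + lucas (2 * m + 1) (x 0) (x 1)"
      unfolding a(2) by (simp add: \<alpha>_def wt_vec2 vec2_simps(2))
    also have "\<dots> = 1" unfolding l unfolding x by (simp add: algebra_simps)
    finally show "(\<Sum>j<m + 3. (if j \<le> m then a j else 1) * wt 2 x (\<alpha> j)) = 1" .
  qed (use a(1) in \<open>auto simp: \<alpha>_def wt_vec2 vec2_simps(2)\<close>)
qed

theorem corollary1p2:
  shows "(\<forall>n N d :: nat. \<forall>f.
            n \<ge> 2 \<and> proper_monomial_map n N f \<and> map_degree n N f = d \<longrightarrow>
            real d \<le> (if n = 2 then 2 * real N - 3 else (real N - 1) / (real n - 1)))
       \<and> (\<forall>n d :: nat. n \<ge> 3 \<and> d \<ge> 1 \<longrightarrow>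
            (\<exists>N f. proper_monomial_map n N f \<and> map_degree n N f = d \<and>
                   real d = (real N - 1) / (real n - 1)))
       \<and> (\<forall>d :: nat. odd d \<and> d \<ge> 1 \<longrightarrow>
            (\<exists>N f. proper_monomial_map 2 N f \<and> map_degree 2 N f = d \<and>
                   real d = 2 * real N - 3))
       \<and> (\<forall>d :: nat. even d \<and> d \<ge> 2 \<longrightarrow>
            (\<exists>N f. proper_monomial_map 2 N f \<and> map_degree 2 N f = d \<and>
                   2 * real N - 3 = real d + 1))"
proof (intro conjI allI impI; elim conjE)
  fix n N d :: nat and f
  assume n: "n \<ge> 2" and f: "proper_monomial_map n N f" "map_degree n N f = d"
  show "real d \<le> (if n = 2 then 2 * real N - 3 else (real N - 1) / (real n - 1))"
  proof (cases "n = 2")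
    case True
    then have "real (d + 3) \<le> real (2 * N)" using degree_bound(1)[OF n f] by (simp only: of_nat_le_iff)
    then show ?thesis using True by simp
  next
    case False
    then have "real ((n - 1) * d + 1) \<le> real N" using degree_bound(2)[OF n f] n by (simp only: of_nat_le_iff)
    then have "(real n - 1) * real d + 1 \<le> real N" using n by (simp add: of_nat_diff)
    then show ?thesis using False n by (simp add: pos_le_divide_eq mult.commute)
  qed
next
  fix n d :: nat
  assume "n \<ge> 3" "d \<ge> 1"
  then obtain f where "proper_monomial_map n ((n - 1) * d + 1) f" "map_degree n ((n - 1) * d + 1) f = d"
    using proper_map_whitney[of n d] by auto
  moreover have "real d = (real ((n - 1) * d + 1) - 1) / (real n - 1)"
    using \<open>n \<ge> 3\<close> by (simp add: of_nat_diff)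
  ultimately show "\<exists>N f. proper_monomial_map n N f \<and> map_degree n N f = d \<and> real d = (real N - 1) / (real n - 1)"
    by blast
next
  fix d :: nat
  assume "odd d"
  then obtain m where d: "d = 2 * m + 1" by (rule oddE)
  have "real d = 2 * real (m + 2) - 3" by (simp add: d)
  then show "\<exists>N f. proper_monomial_map 2 N f \<and> map_degree 2 N f = d \<and> real d = 2 * real N - 3"
    using proper_map_odd[of m] d by blast
next
  fix d :: nat
  assume "even d" "d \<ge> 2"
  then obtain k where "d = 2 * k" by (elim evenE)
  then have "d = 2 * (k - 1) + 2" using \<open>d \<ge> 2\<close> by simp
  then obtain m where d: "d = 2 * m + 2" by blast
  have "2 * real (m + 3) - 3 = real d + 1" by (simp add: d)
  then show "\<exists>N f. proper_monomial_map 2 N f \<and> map_degree 2 N f = d \<and> 2 * real N - 3 = real d + 1"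
    using proper_map_even[of m] d by blast
qed

end
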